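(* Let $K/\mathbb{Q}$ be a Galois extension with $[K:\mathbb{Q}]=n_0$, and let $T,X\ge 3$. Let $M$ denote the largest integer less than or equal to $X$ such that $a(M)\neq 0$. Then $$N_{K,X}(T)=\frac{T}{2\pi}\log M+O_K\!\left(\frac{X}{(\log X)^{1-\frac{1}{n_0}}}\right),$$ where the implied constant depends only on $K$.
   Context: For a number field $K$ with ring of integers $O_K$, $a(n)$ denotes the number of non-zero integral ideals $\mathfrak a$ of $O_K$ with absolute norm $\|\mathfrak a\|=n$. The partial sums of the Dedekind zeta function are $$\zeta_{K,X}(s)=\sum_{\|\mathfrak a\|\le X}\frac{1}{\|\mathfrak a\|^s}=\sum_{n\le X}\frac{a(n)}{n^s}.$$ Let $\rho_{K,X}=\beta_{K,X}+i\gamma_{K,X}$ denote a typical non-real zero of $\zeta_{K,X}(s)$. Then $N_{K,X}(T)=\#\{\rho_{K,X}:\gamma_{K,X}\in[0,T]\}$, zeros being counted with multiplicity; if $T$ is the ordinate of a zero, $N_{K,X}(T)$ is defined as $\lim_{\epsilon\to0^+}N_{K,X}(T+\epsilon)$. *)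

theory Defs
  imports
    "HOL-Complex_Analysis.Complex_Analysis"
    "HOL-Algebra.Algebra"
    "HOL-Algebra.Algebraic_Closure_Type"
begin

text \<open>
  Number fields are taken as subsets \<open>K\<close> of an arbitrary type of class \<open>field_char_0\<close>, whose prime
  field is \<open>\<rat>\<close>. Since the class provides the ring operations, the HOL-Algebra notions (subfields,
  dimension, ideals, quotient rings) apply to it through \<open>ring_of_type_algebra\<close>, that is, the whole
  type regarded as a record.
\<close>

abbreviation ambient :: "'a::field_char_0 ring" where
  "ambient \<equiv> ring_of_type_algebra"

definition number_field :: "'a::field_char_0 set \<Rightarrow> bool" where
  "number_field K \<longleftrightarrow> subfield K ambient \<and> (\<exists>n. ring.dimension ambient n \<rat> K)"

text \<open>
  \<open>K\<close> over \<open>F\<close> is Galois in the sense that the fixed field of \<open>Aut(K/F)\<close> is \<open>F\<close>. Elements of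
  \<open>ring_iso\<close> are unconstrained outside the carrier \<open>K\<close>, which does not affect the fixed field.
\<close>

definition field_automorphisms :: "'a::field_char_0 set \<Rightarrow> 'a set \<Rightarrow> ('a \<Rightarrow> 'a) set" where
  "field_automorphisms F K =
     {\<sigma> \<in> ring_iso (ambient\<lparr>carrier := K\<rparr>) (ambient\<lparr>carrier := K\<rparr>). \<forall>x\<in>F. \<sigma> x = x}"

definition galois_over :: "'a::field_char_0 set \<Rightarrow> 'a set \<Rightarrow> bool" where
  "galois_over F K \<longleftrightarrow> F \<subseteq> K \<and> {x \<in> K. \<forall>\<sigma>\<in>field_automorphisms F K. \<sigma> x = x} = F"

definition ring_of_integers :: "'a::field_char_0 set \<Rightarrow> 'a ring" where
  "ring_of_integers K = ambient\<lparr>carrier := {x \<in> K. algebraic_int x}\<rparr>"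

text \<open>
  For a number field every nonzero ideal has finite index and there are finitely many of each norm,
  so \<open>card\<close> is not applied to an infinite set below, except for the norm of the zero ideal.
\<close>

definition ideal_norm :: "'a::field_char_0 set \<Rightarrow> 'a set \<Rightarrow> nat" where
  "ideal_norm K I = card (carrier (ring_of_integers K Quot I))"

definition ideal_count :: "'a::field_char_0 set \<Rightarrow> nat \<Rightarrow> nat" where
  "ideal_count K n = card {I. ideal I (ring_of_integers K) \<and> I \<noteq> {0} \<and> ideal_norm K I = n}"

definition dedekind_partial :: "'a::field_char_0 set \<Rightarrow> real \<Rightarrow> complex \<Rightarrow> complex" where
  "dedekind_partial K x s =
     (\<Sum>n \<in> {n::nat. 1 \<le> n \<and> real n \<le> x}. of_nat (ideal_count K n) / of_nat n powr s)"

definition nonreal_zeros :: "'a::field_char_0 set \<Rightarrow> real \<Rightarrow> complex set" where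
  "nonreal_zeros K x = {\<rho>. \<rho> \<notin> \<real> \<and> dedekind_partial K x \<rho> = 0}"

text \<open>
  For \<open>x \<ge> 1\<close> the sum in \<open>zeros_upto\<close> is over a finite set: the partial sum has constant term 1,
  so it is a nonzero entire function whose zeros lie in a vertical strip of finite width.
\<close>

definition zeros_upto :: "'a::field_char_0 set \<Rightarrow> real \<Rightarrow> real \<Rightarrow> real" where
  "zeros_upto K x T =
     real_of_int (\<Sum>\<rho> \<in> {\<rho> \<in> nonreal_zeros K x. Im \<rho> \<in> {0..T}}. zorder (dedekind_partial K x) \<rho>)"

definition zero_counting :: "'a::field_char_0 set \<Rightarrow> real \<Rightarrow> real \<Rightarrow> real" where
  "zero_counting K x T =
     (if \<exists>\<rho>\<in>nonreal_zeros K x. Im \<rho> = T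
      then Lim (at_right 0) (\<lambda>\<epsilon>. zeros_upto K x (T + \<epsilon>))
      else zeros_upto K x T)"

end

theory Submission
  imports Defs "HOL-Number_Theory.Cong" "Jordan_Normal_Form.Char_Poly"
begin

text \<open>
  Zeros. Write \<open>F\<close> for the partial sum, an exponential sum with positive coefficients and real
  frequencies. The argument principle on the rectangle with corners \<open>-R\<close> and \<open>R + i T\<close> gives the
  main term from the left side, where the last summand dominates, and a bounded contribution from the
  bottom and right sides. On the top side the change of argument is at most \<open>\<pi>\<close> times one plus the
  number of real zeros of \<open>\<sigma> \<mapsto> Im (F (\<sigma> + i T))\<close>, and Rolle's theorem bounds these by the number of
  summands. So the error is at most a constant times the number of \<open>n \<le> x\<close> with \<open>a(n) \<noteq> 0\<close>.

  Norms. Take an algebraic integer \<open>\<alpha>\<close> in \<open>K\<close> with the largest number \<open>d\<close> of conjugates; then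
  \<open>K = \<rat>(\<alpha>)\<close>, so \<open>d\<close> is at least the degree of \<open>K\<close>. If \<open>a(n) \<noteq> 0\<close> and a prime \<open>p\<close> divides \<open>n\<close> exactly
  once, then \<open>K\<close> has a prime ideal with residue field of order \<open>p\<close>, and reducing the conjugates of \<open>\<alpha>\<close>
  modulo it shows that the minimal polynomial \<open>f\<close> of \<open>\<alpha>\<close> has \<open>d\<close> roots modulo \<open>p\<close>, unless \<open>p\<close> divides
  the discriminant.

  Density. The sum of \<open>ln p / p\<close> over such \<open>p \<le> Y\<close> is at most \<open>(ln Y) / d + O(1)\<close>. This is an analogue of
  Legendre's proof of Mertens' theorem in which \<open>N!\<close> is replaced by a box of integer polynomials \<open>v\<close> of
  degree less than \<open>d\<close> with coefficients at most \<open>N\<close>: for each \<open>v \<noteq> 0\<close> the pairs \<open>(p, r)\<close> with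
  \<open>f(r) = v(r) = 0\<close> modulo \<open>p\<close> satisfy \<open>\<Prod> p = O(N\<^sup>d)\<close>, since the integer polynomials modulo \<open>(v, f)\<close> have
  representatives in a box of that size and surject onto the product of the fields of order \<open>p\<close>, while
  each fixed pair \<open>(p, r)\<close> occurs for a proportion of about \<open>1/p\<close> of all \<open>v\<close>. Counting integers all of
  whose simple prime factors are of this kind then gives \<open>O(x / (ln x) powr (1 - 1/d))\<close>.
\<close>

hide_const (open) Polynomials.degree up_ring.coeff up_ring.monom Polynomials.lead_coeff
  Module.smult Divisibility.prime

section \<open>Zeros of exponential sums with positive coefficients\<close>

text \<open>The norms enter only through an upper bound for their number, so an upper estimate of
  Mertens type suffices, and \<open>d \<ge> n0\<close> is the favourable direction. The Galois
  hypothesis puts all conjugates of \<alpha> into \<open>K\<close>: a single prime ideal with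
  residue field of order p then supplies d roots of f modulo p. That ideal is read off from the
  additive group of the quotient by an ideal of norm n, with the theorems of Sylow and Lagrange.

  The density 1/d comes out of the double count over the box: each p carries d pairs (p, r), the
  product bound gives d ln N, and the primes reach Y of size N^d; cancelling d leaves ln N = (ln Y)
  / d. The obstacle is that for p near N^d the polynomials vanishing at r modulo p form a lattice
  whose cells can be as long as the box, so its points need not be evenly spread. A pigeonhole
  argument gives class representatives of size p^(1/d), hence a relative error O(p^(1/d) / N), and a
  dyadic summation with Chebyshev's bound shows that these errors add up to O(1).\<close>

lemma Rolle_zeros_derivative:
  fixes g g' :: "real \<Rightarrow> real"
  assumes "finite Z" "Z \<noteq> {}" and Z: "\<And>x. x \<in> Z \<Longrightarrow> g x = 0"
    and der: "\<And>x. (g has_real_derivative g' x) (at x)"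
  shows "\<exists>W. finite W \<and> Suc (card W) = card Z \<and> (\<forall>w\<in>W. g' w = 0 \<and> w < Max Z)"
  using assms(1-3)
proof (induction rule: finite_linorder_max_induct)
  case empty
  then show ?case by simp
next
  case (insert b A)
  show ?case
  proof (cases "A = {}")
    case True
    then show ?thesis by (intro exI[of _ "{}"]) auto
  next
    case False
    with insert obtain W where W: "finite W" "Suc (card W) = card A" "\<forall>w\<in>W. g' w = 0 \<and> w < Max A"
      by auto
    have mA: "Max A \<in> A" using False insert by auto
    have lt: "Max A < b" using mA insert by auto
    have "\<exists>z>Max A. z < b \<and> g' z = 0"
    proof -
      have "\<exists>z. Max A < z \<and> z < b \<and> DERIV g z :> 0"
      proof (rule Rolle[OF lt])
        show "g (Max A) = g b" using mA insert by auto
        show "continuous_on {Max A..b} g"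
          using der by (meson DERIV_isCont continuous_at_imp_continuous_on)
        show "\<And>x. \<lbrakk>Max A < x; x < b\<rbrakk> \<Longrightarrow> g differentiable at x"
          using der real_differentiable_def by blast
      qed
      then show ?thesis using der DERIV_unique by blast
    qed
    then obtain z where z: "Max A < z" "z < b" "g' z = 0" by auto
    \<comment> \<open>The elements of \<open>W\<close> lie below \<open>Max A\<close> and
      \<open>z\<close> lies above it, so \<open>z\<close> is a new zero; for this purpose the bound
      \<open>w < Max Z\<close> is carried through the induction.\<close>
    have "z \<notin> W" using W(3) z(1) by force
    moreover have "Max (insert b A) = b"
      using insert by (intro Max_eqI) (auto intro: less_imp_le)
    moreover have "b \<notin> A" using insert by auto
    ultimately show ?thesis
      using W z lt insert
      by (intro exI[of _ "insert z W"]) (auto intro: less_trans)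
  qed
qed

text \<open>Rolle's bound holds for every finite set of zeros, and an infinite zero set would
  contain finite subsets exceeding it; so finiteness passes from \<open>g'\<close> to
  \<open>g\<close>.\<close>

lemma card_zeros_le_derivative:
  fixes g g' :: "real \<Rightarrow> real"
  assumes der: "\<And>x. (g has_real_derivative g' x) (at x)"
    and fin: "finite {x. g' x = 0}"
  shows "finite {x. g x = 0} \<and> card {x. g x = 0} \<le> Suc (card {x. g' x = 0})"
proof -
  have *: "card Z \<le> Suc (card {x. g' x = 0})" if "finite Z" "Z \<subseteq> {x. g x = 0}" for Z
  proof (cases "Z = {}")
    case False
    from Rolle_zeros_derivative[OF that(1) False _ der] that(2)
    obtain W where W: "finite W" "Suc (card W) = card Z" "\<forall>w\<in>W. g' w = 0"
      by blast
    have "card W \<le> card {x. g' x = 0}" using W fin by (intro card_mono) auto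
    then show ?thesis using W by auto
  qed auto
  have f: "finite {x. g x = 0}"
  proof (rule ccontr)
    assume "infinite {x. g x = 0}"
    then obtain Z where "finite Z" "Z \<subseteq> {x. g x = 0}" "card Z = Suc (Suc (card {x. g' x = 0}))"
      by (meson infinite_arbitrarily_large)
    with *[of Z] show False by auto
  qed
  with * show ?thesis by auto
qed

text \<open>Multiplying by \<open>exp (l0 * x)\<close> keeps the zeros and makes one summand
  constant; differentiation removes it, so by Rolle's theorem each frequency accounts for at most
  one zero. This is the induction behind Descartes' rule of signs.\<close>

lemma card_zeros_exponential_sum:
  fixes b :: "real \<Rightarrow> real"
  assumes "finite S" "\<exists>l\<in>S. b l \<noteq> 0"
  shows "finite {x::real. (\<Sum>l\<in>S. b l * exp (- l * x)) = 0} \<and>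
         card {x::real. (\<Sum>l\<in>S. b l * exp (- l * x)) = 0} < card S"
  using assms
proof (induction "card S" arbitrary: S b)
  case 0
  then show ?case by auto
next
  case (Suc n)
  then obtain l0 where l0: "l0 \<in> S" by auto
  define S' where "S' = S - {l0}"
  have S': "S = insert l0 S'" "l0 \<notin> S'" "finite S'" "card S' = n"
    using l0 Suc by (auto simp: S'_def)
  define g where "g x = b l0 + (\<Sum>l\<in>S'. b l * exp (- (l - l0) * x))" for x
  define b' where "b' l = - (b l * (l - l0))" for l
  have exp_shift: "exp (- k * x) * exp (- (l - k) * x) = exp (- l * x)" for l k x :: real
    by (simp add: exp_add [symmetric] ring_distribs)
  have exp_shift': "exp (k * x) * exp (- l * x) = exp (- (l - k) * x)" for l k x :: real
    by (simp add: exp_add [symmetric] ring_distribs)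
  have g: "(\<Sum>l\<in>S. b l * exp (- l * x)) = exp (- l0 * x) * g x" for x
  proof -
    have "exp (- l0 * x) * (\<Sum>l\<in>S'. b l * exp (- (l - l0) * x)) = (\<Sum>l\<in>S'. b l * exp (- l * x))"
      unfolding sum_distrib_left
      by (intro sum.cong refl) (metis exp_shift mult.left_commute)
    then show ?thesis unfolding g_def S'(1) using S' by (simp add: distrib_left)
  qed
  have eq: "{x::real. (\<Sum>l\<in>S. b l * exp (- l * x)) = 0} = {x. g x = 0}"
    unfolding g by simp
  show ?case
  proof (cases "\<exists>l\<in>S'. b l \<noteq> 0")
    case False
    then have "b l0 \<noteq> 0" using Suc S' by auto
    with False have "{x. g x = 0} = {}" by (auto simp: g_def)
    with eq show ?thesis using Suc(2) by simp
  next
    case True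
    then have "\<exists>l\<in>S'. b' l \<noteq> 0" using S' by (auto simp: b'_def)
    then have IH: "finite {x::real. (\<Sum>l\<in>S'. b' l * exp (- l * x)) = 0}"
      "card {x::real. (\<Sum>l\<in>S'. b' l * exp (- l * x)) = 0} < card S'"
      using Suc(1)[of S' b'] S' by auto
    define g' where "g' x = (\<Sum>l\<in>S'. b' l * exp (- (l - l0) * x))" for x
    have "g' x = exp (l0 * x) * (\<Sum>l\<in>S'. b' l * exp (- l * x))" for x
      unfolding g'_def sum_distrib_left
      by (intro sum.cong refl) (metis exp_shift' mult.left_commute)
    then have eq': "{x. g' x = 0} = {x::real. (\<Sum>l\<in>S'. b' l * exp (- l * x)) = 0}"
      by simp
    have "(g has_real_derivative g' x) (at x)" for x
    proof -
      have "((\<lambda>x. b l * exp (- (l - l0) * x)) has_real_derivative b' l * exp (- (l - l0) * x)) (at x)" for l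
        unfolding b'_def by (auto intro!: derivative_eq_intros simp: algebra_simps)
      from DERIV_add[OF DERIV_const DERIV_sum[OF this]]
      show ?thesis unfolding g_def[abs_def] g'_def by simp
    qed
    from card_zeros_le_derivative[OF this] IH eq' eq
    show ?thesis using Suc(2) S' by simp
  qed
qed

text \<open>As long as \<open>c * f\<close> stays in the right half plane, the principal logarithm
  of \<open>c * f\<close> is a primitive of the logarithmic derivative, with imaginary part in
  \<open>[-pi/2, pi/2]\<close>. The nonstrict inequality lets the values touch the boundary line, as
  happens where a segment is cut at a zero of the real part.\<close>

lemma Im_log_derivative_integral_le:
  fixes f :: "complex \<Rightarrow> complex"
  assumes hol: "f holomorphic_on UNIV" and c: "c \<noteq> 0"
    and pos: "\<And>z. z \<in> closed_segment a b \<Longrightarrow> f z \<noteq> 0 \<and> 0 \<le> Re (c * f z)"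
  shows "\<bar>Im (contour_integral (linepath a b) (\<lambda>z. deriv f z / f z))\<bar> \<le> pi"
proof -
  have nz: "c * f z \<notin> \<real>\<^sub>\<le>\<^sub>0" "c * f z \<noteq> 0" if "z \<in> closed_segment a b" for z
  proof -
    show "c * f z \<noteq> 0" using pos[OF that] c by simp
    then show "c * f z \<notin> \<real>\<^sub>\<le>\<^sub>0" using pos[OF that]
      by (metis complex_nonpos_Reals_iff complex_eq_iff order_antisym_conv zero_complex.sel)
  qed
  have der: "((\<lambda>z. Ln (c * f z)) has_field_derivative deriv f z / f z) (at z within closed_segment a b)"
    if "z \<in> closed_segment a b" for z
  proof -
    have "(f has_field_derivative deriv f z) (at z)"
      using hol holomorphic_derivI by blast
    then have "((\<lambda>z. c * f z) has_field_derivative c * deriv f z) (at z)"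
      by (rule DERIV_cmult)
    from DERIV_chain2[OF has_field_derivative_Ln[OF nz(1)[OF that]] this]
    have "((\<lambda>z. Ln (c * f z)) has_field_derivative inverse (c * f z) * (c * deriv f z)) (at z)" .
    moreover have "inverse (c * f z) * (c * deriv f z) = deriv f z / f z"
      using c by (simp add: divide_inverse)
    ultimately show ?thesis by (simp add: has_field_derivative_at_within)
  qed
  have "((\<lambda>z. deriv f z / f z) has_contour_integral Ln (c * f b) - Ln (c * f a)) (linepath a b)"
    using contour_integral_primitive[where S = "closed_segment a b" and g = "linepath a b", OF der] by simp
  then have *: "contour_integral (linepath a b) (\<lambda>z. deriv f z / f z) = Ln (c * f b) - Ln (c * f a)"
    by (rule contour_integral_unique)
  have "\<bar>Im (Ln (c * f z))\<bar> \<le> pi / 2" if "z \<in> closed_segment a b" for z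
    using Re_Ln_pos_le[OF nz(2)[OF that]] pos[OF that] by simp
  from this[of a] this[of b] show ?thesis unfolding * by auto
qed

text \<open>Cutting the segment at the zeros of \<open>Re (c * f)\<close> leaves pieces on which the
  sign is constant, and each piece turns the argument by at most \<open>pi\<close>. The induction is
  on the number of interior zeros: splitting at one of them leaves fewer on both sides.\<close>

lemma Im_log_derivative_integral_horizontal_le:
  fixes f :: "complex \<Rightarrow> complex"
  assumes hol: "f holomorphic_on UNIV" and c: "c \<noteq> 0"
    and nz: "\<And>\<sigma>. f (Complex \<sigma> T) \<noteq> 0"
    and "u \<le> v" "finite {\<sigma>. u < \<sigma> \<and> \<sigma> < v \<and> Re (c * f (Complex \<sigma> T)) = 0}"
  shows "\<bar>Im (contour_integral (linepath (Complex v T) (Complex u T)) (\<lambda>z. deriv f z / f z))\<bar>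
           \<le> pi * Suc (card {\<sigma>. u < \<sigma> \<and> \<sigma> < v \<and> Re (c * f (Complex \<sigma> T)) = 0})"
  using assms(4,5)
proof (induction "card {\<sigma>. u < \<sigma> \<and> \<sigma> < v \<and> Re (c * f (Complex \<sigma> T)) = 0}" arbitrary: u v rule: less_induct)
  case less
  define \<phi> where "\<phi> = (\<lambda>\<sigma>. Re (c * f (Complex \<sigma> T)))"
  define Z where "Z u v = {\<sigma>. u < \<sigma> \<and> \<sigma> < v \<and> \<phi> \<sigma> = 0}" for u v
  have contf: "continuous_on S f" for S
    using hol holomorphic_on_imp_continuous_on holomorphic_on_subset by blast
  have cont: "continuous_on S \<phi>" for S
  proof -
    have "continuous_on S (\<lambda>\<sigma>. of_real \<sigma> + \<i> * of_real T)"
      by (intro continuous_intros)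
    then have "continuous_on S (\<lambda>\<sigma>. Complex \<sigma> T)" by (simp add: Complex_eq)
    from continuous_on_compose2[OF contf[of UNIV] this] show ?thesis
      unfolding \<phi>_def by (intro continuous_intros) auto
  qed
  have seg: "z \<in> closed_segment (Complex v T) (Complex u T) \<longleftrightarrow> Im z = T \<and> Re z \<in> {u..v}" for z
    using closed_segment_same_Im[of "Complex v T" "Complex u T"] less.prems(1)
    by (auto simp: closed_segment_eq_real_ivl)
  have finZ: "finite (Z u v)" using less.prems(2) by (simp add: Z_def \<phi>_def)
  show ?case
  proof (cases "Z u v = {}")
    case True
    have "(\<forall>\<sigma>\<in>{u<..<v}. 0 < \<phi> \<sigma>) \<or> (\<forall>\<sigma>\<in>{u<..<v}. \<phi> \<sigma> < 0)"
    proof (rule ccontr)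
      assume "\<not> ?thesis"
      then obtain x y where xy: "x \<in> {u<..<v}" "y \<in> {u<..<v}" "\<phi> x \<le> 0" "0 \<le> \<phi> y"
        by (meson not_less)
      have "connected (\<phi> ` {u<..<v})"
        by (intro connected_continuous_image cont) simp
      then have "0 \<in> \<phi> ` {u<..<v}"
        using xy connectedD_interval[of "\<phi> ` {u<..<v}" "\<phi> x" "\<phi> y" 0] by blast
      then show False using True by (auto simp: Z_def)
    qed
    then have "\<exists>e::real. e \<noteq> 0 \<and> (\<forall>\<sigma>\<in>{u<..<v}. 0 \<le> e * \<phi> \<sigma>)"
    proof
      assume "\<forall>\<sigma>\<in>{u<..<v}. 0 < \<phi> \<sigma>"
      then show ?thesis by (intro exI[of _ 1]) (simp add: less_imp_le)
    next
      assume "\<forall>\<sigma>\<in>{u<..<v}. \<phi> \<sigma> < 0"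
      then show ?thesis by (intro exI[of _ "-1"]) (simp add: less_imp_le)
    qed
    then obtain e :: real where e: "e \<noteq> 0" "\<And>\<sigma>. \<sigma> \<in> {u<..<v} \<Longrightarrow> 0 \<le> e * \<phi> \<sigma>"
      by blast
    \<comment> \<open>The sign is known only on the open interval; the end points, which may be
      zeros of \<phi>, follow by continuity. This takes a nonempty interval, hence the separate case
      \<open>u = v\<close> below.\<close>
    have e': "0 \<le> e * \<phi> \<sigma>" if "\<sigma> \<in> {u..v}" "u < v" for \<sigma>
    proof -
      have "0 \<le> (\<lambda>\<sigma>. e * \<phi> \<sigma>) \<sigma>"
      proof (rule continuous_ge_on_closure[of "{u<..<v}" "\<lambda>\<sigma>. e * \<phi> \<sigma>"])
        show "continuous_on (closure {u<..<v}) (\<lambda>\<sigma>. e * \<phi> \<sigma>)" by (intro continuous_intros cont)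
      qed (use that e in auto)
      then show ?thesis .
    qed
    show ?thesis
    proof (cases "u = v")
      case True
      then show ?thesis by simp
    next
      case False
      have "\<bar>Im (contour_integral (linepath (Complex v T) (Complex u T)) (\<lambda>z. deriv f z / f z))\<bar> \<le> pi"
      proof (rule Im_log_derivative_integral_le[OF hol, of "of_real e * c"])
        fix z assume "z \<in> closed_segment (Complex v T) (Complex u T)"
        then have z: "z = Complex (Re z) T" "Re z \<in> {u..v}" using seg by (auto simp: complex_eq_iff)
        have "0 \<le> e * \<phi> (Re z)" using e'[OF z(2)] False less.prems(1) by auto
        then have "0 \<le> Re (of_real e * c * f z)"
          using z(1) by (metis \<phi>_def Re_complex_of_real Im_complex_of_real mult.assoc times_complex.sel(1) mult_zero_left diff_zero)
        then show "f z \<noteq> 0 \<and> 0 \<le> Re (of_real e * c * f z)"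
          using nz[of "Re z"] z(1) by auto
      qed (use c e in auto)
      then show ?thesis by (simp add: algebra_simps add_increasing2)
    qed
  next
    case False
    then obtain m where m: "m \<in> Z u v" by blast
    then have muv: "u < m" "m < v" by (auto simp: Z_def)
    have "Z u v = insert m (Z u m \<union> Z m v)" using m muv by (auto simp: Z_def)
    moreover have "Z u m \<inter> Z m v = {}" "m \<notin> Z u m" "m \<notin> Z m v" by (auto simp: Z_def)
    moreover have fin: "finite (Z u m)" "finite (Z m v)"
      using finZ muv by (auto intro: finite_subset[of _ "Z u v"] simp: Z_def)
    ultimately have card: "card (Z u v) = Suc (card (Z u m) + card (Z m v))"
      by (simp add: card_Un_disjoint)
    have IH: "\<bar>Im (contour_integral (linepath (Complex m T) (Complex u T)) (\<lambda>z. deriv f z / f z))\<bar> \<le> pi * Suc (card (Z u m))"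
      "\<bar>Im (contour_integral (linepath (Complex v T) (Complex m T)) (\<lambda>z. deriv f z / f z))\<bar> \<le> pi * Suc (card (Z m v))"
      using less.hyps[of u m] less.hyps[of m v] card fin muv unfolding Z_def \<phi>_def by auto
    have "continuous_on (closed_segment (Complex v T) (Complex u T)) (\<lambda>z. deriv f z / f z)"
    proof (intro continuous_intros contf)
      show "continuous_on (closed_segment (Complex v T) (Complex u T)) (deriv f)"
        using hol holomorphic_deriv holomorphic_on_imp_continuous_on holomorphic_on_subset
        by (metis open_UNIV subset_UNIV)
      show "\<forall>x\<in>closed_segment (Complex v T) (Complex u T). f x \<noteq> 0"
        using nz seg by (metis complex.collapse)
    qed
    moreover have "Complex m T \<in> closed_segment (Complex v T) (Complex u T)"
      unfolding seg using muv by auto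
    ultimately have "contour_integral (linepath (Complex v T) (Complex u T)) (\<lambda>z. deriv f z / f z) =
      contour_integral (linepath (Complex v T) (Complex m T)) (\<lambda>z. deriv f z / f z) +
      contour_integral (linepath (Complex m T) (Complex u T)) (\<lambda>z. deriv f z / f z)"
      by (rule contour_integral_split_linepath)
    then have "\<bar>Im (contour_integral (linepath (Complex v T) (Complex u T)) (\<lambda>z. deriv f z / f z))\<bar>
      \<le> pi * Suc (card (Z u m)) + pi * Suc (card (Z m v))"
      using IH by simp
    also have "\<dots> = pi * Suc (card (Z u v))"
      unfolding card by (simp add: algebra_simps)
    finally show ?thesis by (simp add: Z_def \<phi>_def)
  qed
qed

lemma eventually_exp_sum_less:
  fixes c :: "real \<Rightarrow> real"
  assumes "finite S" "\<And>l. l \<in> S \<Longrightarrow> l > 0" "e > 0"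
  shows "eventually (\<lambda>x. (\<Sum>l\<in>S. c l * exp (- (l * x))) < e) at_top"
proof -
  have "((\<lambda>x. \<Sum>l\<in>S. c l * exp (- (l * x))) \<longlongrightarrow> (\<Sum>l\<in>S. c l * 0)) at_top"
  proof (intro tendsto_sum tendsto_mult tendsto_const)
    fix l assume "l \<in> S"
    then have "l > 0" using assms by auto
    then have "filterlim (\<lambda>x. l * x) at_top at_top"
      by (intro filterlim_tendsto_pos_mult_at_top[OF tendsto_const]) (auto simp: filterlim_ident)
    then have "filterlim (\<lambda>x. - (l * x)) at_bot at_top"
      by (simp add: filterlim_uminus_at_bot)
    then show "((\<lambda>x. exp (- (l * x))) \<longlongrightarrow> 0) at_top"
      by (rule filterlim_compose[OF exp_at_bot])
  qed
  then show ?thesis using assms(3) by (intro order_tendstoD(2)) auto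
qed

section \<open>The argument principle for exponential sums\<close>

locale pos_exp_sum =
  fixes S :: "real set" and c :: "real \<Rightarrow> real"
  assumes finS: "finite S" and zeroS: "0 \<in> S" and nonneg: "\<And>l. l \<in> S \<Longrightarrow> 0 \<le> l"
    and cpos: "\<And>l. l \<in> S \<Longrightarrow> 0 < c l"
begin

definition F :: "complex \<Rightarrow> complex" where
  "F s = (\<Sum>l\<in>S. of_real (c l) * exp (- of_real l * s))"

definition L :: real where "L = Max S"

lemma L: "L \<in> S" "l \<in> S \<Longrightarrow> l \<le> L"
  unfolding L_def using finS zeroS by (auto intro!: Max_in)

lemma F_holomorphic: "F holomorphic_on A"
  unfolding F_def[abs_def] by (intro holomorphic_intros)

lemma F_real_pos: "0 < Re (F (of_real x))"
proof -
  have "Re (F (of_real x)) = (\<Sum>l\<in>S. c l * exp (- l * x))"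
    unfolding F_def by (simp add: Re_exp)
  also have "\<dots> > 0" using finS zeroS cpos by (intro sum_pos) auto
  finally show ?thesis .
qed

lemma F_not_zero_real: "F (of_real x) \<noteq> 0"
  using F_real_pos[of x] by auto

text \<open>Far to the right the constant term exceeds the sum of all others in absolute value; far
  to the left the summand with frequency \<open>L\<close> does, once the factor
  \<open>exp (L * s)\<close> makes it constant. Both vertical sides thus lead to functions with
  values in a half plane.\<close>

lemma dominant_side:
  obtains R where "R > 0" "\<And>s. Re s \<ge> R \<Longrightarrow> 0 < Re (F s)"
    "\<And>s. Re s \<le> - R \<Longrightarrow> 0 < Re (F s * exp (of_real L * s))"
proof -
  have e1: "eventually (\<lambda>x. (\<Sum>l\<in>S - {0}. c l * exp (- (l * x))) < c 0) at_top"
  proof (rule eventually_exp_sum_less)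
    fix l assume "l \<in> S - {0}"
    with nonneg[of l] show "l > 0" by auto
  qed (use finS cpos zeroS in auto)
  \<comment> \<open>Reflecting the frequencies by \<open>l \<mapsto> L - l\<close> reduces the left
    side to the same decay statement.\<close>
  have "eventually (\<lambda>x. (\<Sum>l\<in>(\<lambda>l. L - l) ` (S - {L}). c (L - l) * exp (- (l * x))) < c L) at_top"
  proof (rule eventually_exp_sum_less)
    fix l assume "l \<in> (\<lambda>l. L - l) ` (S - {L})"
    then obtain k where "k \<in> S" "k \<noteq> L" "l = L - k" by blast
    with L(2)[of k] show "l > 0" by simp
  qed (use finS cpos L in auto)
  moreover have "(\<Sum>l\<in>(\<lambda>l. L - l) ` (S - {L}). c (L - l) * exp (- (l * x))) =
      (\<Sum>l\<in>S - {L}. c l * exp (- ((L - l) * x)))" for x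
    by (subst sum.reindex) (auto simp: inj_on_def)
  ultimately have e2: "eventually (\<lambda>x. (\<Sum>l\<in>S - {L}. c l * exp (- ((L - l) * x))) < c L) at_top"
    by simp
  from eventually_conj[OF e1 e2] obtain R0 where R0:
    "\<And>x. x \<ge> R0 \<Longrightarrow> (\<Sum>l\<in>S - {0}. c l * exp (- (l * x))) < c 0"
    "\<And>x. x \<ge> R0 \<Longrightarrow> (\<Sum>l\<in>S - {L}. c l * exp (- ((L - l) * x))) < c L"
    by (auto simp: eventually_at_top_linorder)
  define R where "R = max R0 1"
  show ?thesis
  proof (rule that[of R])
    show "R > 0" by (simp add: R_def)
  next
    fix s assume s: "Re s \<ge> R"
    define t where "t = (\<Sum>l\<in>S - {0}. of_real (c l) * exp (- of_real l * s))"
    have "F s = of_real (c 0) + t"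
      unfolding F_def t_def using finS zeroS by (subst sum.remove[of S 0]) auto
    moreover have "norm t \<le> (\<Sum>l\<in>S - {0}. c l * exp (- (l * Re s)))"
      unfolding t_def using cpos by (intro order.trans[OF norm_sum] sum_mono) (simp add: norm_mult less_imp_le)
    moreover have "\<dots> < c 0" using R0(1) s by (auto simp: R_def)
    ultimately show "0 < Re (F s)" using abs_Re_le_cmod[of t] by auto
  next
    fix s assume s: "Re s \<le> - R"
    define t where "t = (\<Sum>l\<in>S - {L}. of_real (c l) * exp (of_real (L - l) * s))"
    have "F s * exp (of_real L * s) = (\<Sum>l\<in>S. of_real (c l) * exp (of_real (L - l) * s))"
      unfolding F_def sum_distrib_right
      by (intro sum.cong refl) (simp add: mult.assoc flip: exp_add, simp add: algebra_simps)
    also have "\<dots> = of_real (c L) + t"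
      unfolding t_def using finS L by (subst sum.remove[of S L]) auto
    finally have "F s * exp (of_real L * s) = of_real (c L) + t" .
    moreover have "norm t \<le> (\<Sum>l\<in>S - {L}. c l * exp (- ((L - l) * (- Re s))))"
      unfolding t_def using cpos by (intro order.trans[OF norm_sum] sum_mono) (simp add: norm_mult less_imp_le)
    moreover have "\<dots> < c L" using R0(2)[of "- Re s"] s by (auto simp: R_def)
    ultimately show "0 < Re (F s * exp (of_real L * s))" using abs_Re_le_cmod[of t] by auto
  qed
qed

lemma finite_zeros_compact:
  assumes "compact K"
  shows "finite {z \<in> K. F z = 0}"
proof (cases "F constant_on UNIV")
  \<comment> \<open>This happens if \<open>0\<close> is the only frequency; the isolation of zeros
    says nothing about constant functions.\<close>
  case True
  then have const: "F z = F (of_real 0)" for z unfolding constant_on_def by (metis UNIV_I)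
  have "F z \<noteq> 0" for z using const[of z] F_not_zero_real[of 0] by metis
  then have "{z \<in> K. F z = 0} = {}" by blast
  then show ?thesis by (metis finite.emptyI)
next
  case False
  then show ?thesis using assms by (intro holomorphic_compact_finite_zeros[OF F_holomorphic[of UNIV]]) auto
qed

lemma strip_zeros:
  obtains R where "R > 0" "\<And>s. F s = 0 \<Longrightarrow> \<bar>Re s\<bar> < R"
proof -
  obtain R where R: "R > 0" "\<And>s. Re s \<ge> R \<Longrightarrow> 0 < Re (F s)"
    "\<And>s. Re s \<le> - R \<Longrightarrow> 0 < Re (F s * exp (of_real L * s))"
    using dominant_side by blast
  have "\<bar>Re s\<bar> < R" if "F s = 0" for s
    using R(2,3)[of s] that by (cases "Re s \<ge> R"; cases "Re s \<le> - R") auto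
  with R(1) that show ?thesis by blast
qed

lemma finite_zeros_strip: "finite {z. F z = 0 \<and> 0 \<le> Im z \<and> Im z \<le> T}"
proof -
  obtain R where R: "R > 0" "\<And>s. F s = 0 \<Longrightarrow> \<bar>Re s\<bar> < R" using strip_zeros by blast
  have "{z. F z = 0 \<and> 0 \<le> Im z \<and> Im z \<le> T} \<subseteq> {z \<in> cbox (Complex (-R) 0) (Complex R T). F z = 0}"
    using R(2) by (force simp: in_cbox_complex_iff)
  then show ?thesis using finite_zeros_compact[OF compact_cbox] finite_subset by blast
qed

text \<open>The bottom side may run along the real axis because positive coefficients exclude real
  zeros. So no zero lies on the contour, and every zero counted lies strictly inside it with winding
  number one.\<close>

lemma argument_principle_rectangle:
  assumes R: "R > 0" "\<And>s. F s = 0 \<Longrightarrow> \<bar>Re s\<bar> < R"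
    and T: "T > 0" "\<And>\<sigma>. F (Complex \<sigma> T) \<noteq> 0"
  defines "q \<equiv> (\<lambda>a b. Im (contour_integral (linepath a b) (\<lambda>z. deriv F z / F z)))"
  shows "2 * pi * real_of_int (\<Sum>\<rho>\<in>{z. F z = 0 \<and> 0 \<le> Im z \<and> Im z \<le> T}. zorder F \<rho>) =
    q (Complex (-R) 0) (Complex R 0) + q (Complex R 0) (Complex R T) +
    q (Complex R T) (Complex (-R) T) + q (Complex (-R) T) (Complex (-R) 0)"
proof -
  define g where "g = rectpath (Complex (-R) 0) (Complex R T)"
  \<comment> \<open>An open convex neighbourhood of the closed rectangle; the zeros in it that lie
    outside the rectangle have winding number zero.\<close>
  define B where "B = box (Complex (-R-1) (-1)) (Complex (R+1) (T+1))"
  define pz where "pz = {w \<in> B. F w = 0}"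
  define Z where "Z = {z. F z = 0 \<and> 0 \<le> Im z \<and> Im z \<le> T}"
  have real_nz: "F s \<noteq> 0" if "Im s = 0" for s
    using F_not_zero_real[of "Re s"] that by (metis complex_eq_iff Re_complex_of_real Im_complex_of_real)
  have finpz: "finite pz"
  proof (rule finite_subset)
    show "pz \<subseteq> {z \<in> cbox (Complex (-R-1) (-1)) (Complex (R+1) (T+1)). F z = 0}"
      using box_subset_cbox by (auto simp: pz_def B_def)
  qed (rule finite_zeros_compact[OF compact_cbox])
  have path: "valid_path g" "pathfinish g = pathstart g" by (simp_all add: g_def)
  have image: "z \<in> path_image g \<longleftrightarrow> Re z \<in> {-R, R} \<and> Im z \<in> {0..T} \<or> Im z \<in> {0, T} \<and> Re z \<in> {-R..R}" for z
    using R T by (auto simp: g_def path_image_rectpath)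
  have imgnz: "F z \<noteq> 0" if "z \<in> path_image g" for z
  proof
    assume "F z = 0"
    moreover from this have "Im z \<noteq> 0" "\<bar>Re z\<bar> < R" using real_nz R by auto
    moreover have "Im z \<noteq> T" using T(2)[of "Re z"] \<open>F z = 0\<close> by (metis complex.collapse)
    ultimately show False using that image by auto
  qed
  have "path_image g \<subseteq> B"
    using R T by (auto simp: image B_def in_box_complex_iff)
  then have img: "path_image g \<subseteq> B - pz"
    using imgnz by (auto simp: pz_def)
  have Zpz: "Z \<subseteq> pz"
    using R(2) by (force simp: Z_def pz_def B_def in_box_complex_iff)
  have w1: "winding_number g \<rho> = 1" if "\<rho> \<in> Z" for \<rho>
  proof -
    have "F \<rho> = 0" "0 \<le> Im \<rho>" "Im \<rho> \<le> T" using that by (auto simp: Z_def)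
    moreover have "Im \<rho> \<noteq> T" using T(2)[of "Re \<rho>"] \<open>F \<rho> = 0\<close> by (metis complex.collapse)
    moreover have "Im \<rho> \<noteq> 0" using \<open>F \<rho> = 0\<close> real_nz by blast
    ultimately have "\<rho> \<in> box (Complex (-R) 0) (Complex R T)"
      using R(2)[of \<rho>] by (auto simp: in_box_complex_iff)
    then show ?thesis unfolding g_def by (rule winding_number_rectpath)
  qed
  have w0: "winding_number g \<rho> = 0" if "\<rho> \<notin> cbox (Complex (-R) 0) (Complex R T)" for \<rho>
    unfolding g_def using that R T by (intro winding_number_rectpath_outside) auto
  have w0': "winding_number g \<rho> = 0" if "\<rho> \<in> pz - Z" for \<rho>
    using that by (intro w0) (auto simp: Z_def pz_def in_cbox_complex_iff)
  have "contour_integral g (\<lambda>x. deriv F x * 1 / F x) = 2 * pi * \<i> *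
          (\<Sum>p\<in>{w\<in>B. F w = 0 \<or> w \<in> {}}. winding_number g p * 1 * zorder F p)"
  proof (rule argument_principle)
    show "open B" "connected B" by (simp_all add: B_def open_box convex_connected convex_box)
    show "\<forall>z. z \<notin> B \<longrightarrow> winding_number g z = 0"
    proof (intro allI impI w0)
      fix z assume "z \<notin> B"
      then show "z \<notin> cbox (Complex (-R) 0) (Complex R T)"
        by (auto simp: B_def in_box_complex_iff in_cbox_complex_iff)
    qed
    show "path_image g \<subseteq> B - {w \<in> B. F w = 0 \<or> w \<in> {}}" using img by (simp add: pz_def)
    show "finite {w \<in> B. F w = 0 \<or> w \<in> {}}" using finpz by (simp add: pz_def)
  qed (use path F_holomorphic in auto)
  then have "contour_integral g (\<lambda>x. deriv F x / F x) = 2 * pi * \<i> * (\<Sum>p\<in>pz. winding_number g p * zorder F p)"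
    by (simp add: pz_def)
  also have "(\<Sum>p\<in>pz. winding_number g p * zorder F p) = (\<Sum>p\<in>Z. of_int (zorder F p))"
    using Zpz finpz w0' w1 by (intro sum.mono_neutral_cong_right) auto
  finally have 1: "contour_integral g (\<lambda>x. deriv F x / F x) =
      \<i> * of_real (2 * pi * real_of_int (\<Sum>p\<in>Z. zorder F p))"
    by simp
  define f where "f = (\<lambda>z. deriv F z / F z)"
  have contf: "continuous_on (path_image g) f"
    unfolding f_def
  proof (intro continuous_intros)
    show "continuous_on (path_image g) F"
      using F_holomorphic holomorphic_on_imp_continuous_on by blast
    show "continuous_on (path_image g) (deriv F)"
      using F_holomorphic[of UNIV] holomorphic_deriv[of F UNIV] holomorphic_on_imp_continuous_on
        continuous_on_subset by blast
  qed (use imgnz in auto)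
  have ci: "f contour_integrable_on linepath a b" if "closed_segment a b \<subseteq> path_image g" for a b
    using contf that by (intro contour_integrable_continuous_linepath) (rule continuous_on_subset)
  have g_eq: "g = linepath (Complex (-R) 0) (Complex R 0) +++ linepath (Complex R 0) (Complex R T) +++
     linepath (Complex R T) (Complex (-R) T) +++ linepath (Complex (-R) T) (Complex (-R) 0)"
    by (simp add: g_def rectpath_def Let_def)
  have segs: "closed_segment (Complex (-R) 0) (Complex R 0) \<subseteq> path_image g"
     "closed_segment (Complex R 0) (Complex R T) \<subseteq> path_image g"
     "closed_segment (Complex R T) (Complex (-R) T) \<subseteq> path_image g"
     "closed_segment (Complex (-R) T) (Complex (-R) 0) \<subseteq> path_image g"
    unfolding g_eq by (auto simp: path_image_join)
  have "contour_integral g f = contour_integral (linepath (Complex (-R) 0) (Complex R 0)) f +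
    (contour_integral (linepath (Complex R 0) (Complex R T)) f +
    (contour_integral (linepath (Complex R T) (Complex (-R) T)) f +
     contour_integral (linepath (Complex (-R) T) (Complex (-R) 0)) f))"
    unfolding g_eq using segs by (simp add: ci contour_integrable_joinI valid_path_join)
  with 1 have "2 * pi * real_of_int (\<Sum>p\<in>Z. zorder F p) = Im (contour_integral (linepath (Complex (-R) 0) (Complex R 0)) f +
    (contour_integral (linepath (Complex R 0) (Complex R T)) f +
    (contour_integral (linepath (Complex R T) (Complex (-R) T)) f +
     contour_integral (linepath (Complex (-R) T) (Complex (-R) 0)) f)))"
    unfolding f_def by (metis Im_i_times Re_complex_of_real)
  then show ?thesis unfolding q_def f_def Z_def by simp
qed

text \<open>With \<open>F = H * exp (- L * s)\<close> the logarithmic derivative splits into that of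
  \<open>H\<close>, which stays in the right half plane, and the constant \<open>- L\<close>.
  Integrated downwards over a length \<open>T\<close>, the constant produces the main term
  \<open>T * L\<close>.\<close>

lemma Im_integral_left_side:
  assumes "R > 0" "T > 0"
    and neg: "\<And>s. Re s \<le> - R \<Longrightarrow> 0 < Re (F s * exp (of_real L * s))"
  shows "\<bar>Im (contour_integral (linepath (Complex (-R) T) (Complex (-R) 0)) (\<lambda>z. deriv F z / F z)) - T * L\<bar> \<le> pi"
proof -
  define H where "H = (\<lambda>z. F z * exp (of_real L * z))"
  define a where "a = Complex (-R) T"
  define b where "b = Complex (-R) 0"
  have seg: "Re z = - R" if "z \<in> closed_segment a b" for z
    using that by (auto simp: a_def b_def closed_segment_same_Re)
  have nz: "F z \<noteq> 0" if "z \<in> closed_segment a b" for z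
    using neg[of z] seg[OF that] by auto
  have Hnz: "H z \<noteq> 0" if "z \<in> closed_segment a b" for z
    using nz[OF that] unfolding H_def by simp
  have holH: "H holomorphic_on UNIV"
    unfolding H_def by (intro holomorphic_intros F_holomorphic)
  have eq: "deriv F z / F z = deriv H z / H z - of_real L" if "z \<in> closed_segment a b" for z
  proof -
    have F: "(F has_field_derivative deriv F z) (at z)"
      by (rule holomorphic_derivI[OF F_holomorphic open_UNIV UNIV_I])
    have E: "((\<lambda>z. exp (of_real L * z)) has_field_derivative exp (of_real L * z) * of_real L) (at z)"
      by (intro DERIV_fun_exp DERIV_cmult_Id)
    have "deriv H z = F z * (exp (of_real L * z) * of_real L) + deriv F z * exp (of_real L * z)"
      unfolding H_def by (intro DERIV_imp_deriv DERIV_mult'[OF F E])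
    then show ?thesis using nz[OF that] by (simp add: H_def add_divide_distrib)
  qed
  have cont: "continuous_on (closed_segment a b) (\<lambda>z. deriv H z / H z)"
  proof (intro continuous_intros)
    show "continuous_on (closed_segment a b) H"
      by (intro holomorphic_on_imp_continuous_on holomorphic_on_subset[OF holH] subset_UNIV)
    show "continuous_on (closed_segment a b) (deriv H)"
      by (intro holomorphic_on_imp_continuous_on holomorphic_on_subset[OF holomorphic_deriv[OF holH open_UNIV]]
          subset_UNIV)
    show "\<forall>x\<in>closed_segment a b. H x \<noteq> 0"
      using Hnz by blast
  qed
  have "((\<lambda>z. deriv H z / H z - of_real L) has_contour_integral
      contour_integral (linepath a b) (\<lambda>z. deriv H z / H z) - of_real L * (b - a)) (linepath a b)"
    by (intro has_contour_integral_diff has_contour_integral_integral has_contour_integral_const_linepath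
        contour_integrable_continuous_linepath cont)
  then have "((\<lambda>z. deriv F z / F z) has_contour_integral
      contour_integral (linepath a b) (\<lambda>z. deriv H z / H z) - of_real L * (b - a)) (linepath a b)"
  proof (rule has_contour_integral_eq)
    fix z assume "z \<in> path_image (linepath a b)"
    then have "z \<in> closed_segment a b" by (simp only: path_image_linepath)
    from eq[OF this] show "deriv H z / H z - of_real L = deriv F z / F z" by (rule sym)
  qed
  then have I: "contour_integral (linepath a b) (\<lambda>z. deriv F z / F z) =
      contour_integral (linepath a b) (\<lambda>z. deriv H z / H z) - of_real L * (b - a)"
    by (rule contour_integral_unique)
  have "b - a = - \<i> * of_real T" by (simp add: a_def b_def complex_eq_iff)
  then have "Im (of_real L * (b - a)) = - (T * L)" by simp
  then have "Im (contour_integral (linepath a b) (\<lambda>z. deriv F z / F z)) =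
      Im (contour_integral (linepath a b) (\<lambda>z. deriv H z / H z)) + T * L"
    unfolding I minus_complex.sel by linarith
  moreover have "\<bar>Im (contour_integral (linepath a b) (\<lambda>z. deriv H z / H z))\<bar> \<le> pi"
  proof (rule Im_log_derivative_integral_le[OF holH, of 1])
    fix z assume "z \<in> closed_segment a b"
    then have "0 < Re (H z)" using neg[of z] seg[of z] by (simp add: H_def)
    then show "H z \<noteq> 0 \<and> 0 \<le> Re (1 * H z)" by auto
  qed auto
  ultimately show ?thesis unfolding a_def [symmetric] b_def [symmetric] by linarith
qed

lemma Im_integral_top_side:
  assumes "R > 0" and T: "\<And>\<sigma>. F (Complex \<sigma> T) \<noteq> 0"
  shows "\<bar>Im (contour_integral (linepath (Complex R T) (Complex (-R) T)) (\<lambda>z. deriv F z / F z))\<bar> \<le> pi * card S"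
proof -
  define b where "b l = - c l * sin (l * T)" for l
  have Im: "Im (F (Complex \<sigma> T)) = (\<Sum>l\<in>S. b l * exp (- l * \<sigma>))" for \<sigma>
    unfolding F_def b_def by (simp add: Im_exp algebra_simps)
  have cardS: "card S \<ge> 1" using finS zeroS by (simp add: card_gt_0_iff Suc_le_eq) blast
  obtain e :: complex where e: "e \<noteq> 0" "finite {\<sigma>. Re (e * F (Complex \<sigma> T)) = 0}"
    "card {\<sigma>. Re (e * F (Complex \<sigma> T)) = 0} < card S"
  \<comment> \<open>The factor \<open>\<i>\<close> turns the imaginary part into a real part up to
    sign. If all \<open>b l\<close> vanish, \<open>F\<close> is real and nonzero on the line, so
    \<open>e = 1\<close> leaves no zero at all.\<close>
  proof (cases "\<exists>l\<in>S. b l \<noteq> 0")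
    case True
    have "{\<sigma>. Re (\<i> * F (Complex \<sigma> T)) = 0} = {\<sigma>. (\<Sum>l\<in>S. b l * exp (- l * \<sigma>)) = 0}"
      unfolding Im[symmetric] by simp
    with card_zeros_exponential_sum[OF finS True] that[of \<i>] show ?thesis by simp
  next
    case False
    then have "Im (F (Complex \<sigma> T)) = 0" for \<sigma> unfolding Im by simp
    then have "{\<sigma>. Re (1 * F (Complex \<sigma> T)) = 0} = {}" using T by (auto simp: complex_eq_iff)
    with that[of 1] cardS show ?thesis by simp
  qed
  define Z where "Z = {\<sigma>. - R < \<sigma> \<and> \<sigma> < R \<and> Re (e * F (Complex \<sigma> T)) = 0}"
  have Z: "finite Z" "card Z \<le> card {\<sigma>. Re (e * F (Complex \<sigma> T)) = 0}"
    using e(2) by (auto simp: Z_def intro: card_mono finite_subset)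
  have "\<bar>Im (contour_integral (linepath (Complex R T) (Complex (-R) T)) (\<lambda>z. deriv F z / F z))\<bar> \<le> pi * Suc (card Z)"
    unfolding Z_def using T assms(1) Z(1) e(1) F_holomorphic
    by (intro Im_log_derivative_integral_horizontal_le) (auto simp: Z_def)
  also have "\<dots> \<le> pi * card S" using Z e(3) by (intro mult_left_mono) auto
  finally show ?thesis .
qed

text \<open>The top side contributes \<open>pi * card S\<close>; the \<open>3\<close> stands for the
  bottom, right and left sides, each with at most \<open>pi\<close>.\<close>

lemma zero_sum_bound_nonordinate:
  assumes T: "T > 0" "\<And>\<sigma>. F (Complex \<sigma> T) \<noteq> 0"
  shows "\<bar>2 * pi * real_of_int (\<Sum>\<rho>\<in>{z. F z = 0 \<and> 0 \<le> Im z \<and> Im z \<le> T}. zorder F \<rho>) - T * L\<bar>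
    \<le> pi * (card S + 3)"
proof -
  obtain R where R: "R > 0" "\<And>s. Re s \<ge> R \<Longrightarrow> 0 < Re (F s)"
    "\<And>s. Re s \<le> - R \<Longrightarrow> 0 < Re (F s * exp (of_real L * s))"
    using dominant_side by blast
  have zR: "\<bar>Re s\<bar> < R" if "F s = 0" for s
    using R(2,3)[of s] that by (cases "Re s \<ge> R"; cases "Re s \<le> - R") auto
  have "\<bar>Im (contour_integral (linepath (Complex (-R) 0) (Complex R 0)) (\<lambda>z. deriv F z / F z))\<bar> \<le> pi"
  proof (rule Im_log_derivative_integral_le[of F 1])
    fix z assume "z \<in> closed_segment (Complex (-R) 0) (Complex R 0)"
    then have "z = of_real (Re z)"
      by (auto simp: closed_segment_same_Im complex_eq_iff)
    then have "0 < Re (F z)" using F_real_pos[of "Re z"] by simp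
    then show "F z \<noteq> 0 \<and> 0 \<le> Re (1 * F z)" by auto
  qed (auto simp: F_holomorphic)
  moreover have "\<bar>Im (contour_integral (linepath (Complex R 0) (Complex R T)) (\<lambda>z. deriv F z / F z))\<bar> \<le> pi"
  proof (rule Im_log_derivative_integral_le[of F 1])
    fix z assume "z \<in> closed_segment (Complex R 0) (Complex R T)"
    then have "Re z = R"
      by (auto simp: closed_segment_same_Re)
    then have "0 < Re (F z)" using R by simp
    then show "F z \<noteq> 0 \<and> 0 \<le> Re (1 * F z)" by auto
  qed (auto simp: F_holomorphic)
  moreover have "\<bar>Im (contour_integral (linepath (Complex (-R) T) (Complex (-R) 0)) (\<lambda>z. deriv F z / F z)) - T * L\<bar> \<le> pi"
    by (rule Im_integral_left_side[OF R(1) T(1)]) (rule R(3))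
  ultimately show ?thesis
    using Im_integral_top_side[OF R(1) T(2)] argument_principle_rectangle[OF R(1) zR T]
    unfolding distrib_left of_nat_add of_nat_numeral by linarith
qed

text \<open>The finitely many ordinates in \<open>(T, T + 1]\<close> leave a gap above
  \<open>T\<close>. The alternative \<open>T + \<epsilon> < 0\<close> appears because only zeros
  with nonnegative imaginary part are considered.\<close>

lemma zero_sum_stable:
  "\<exists>\<delta>>0. \<forall>\<epsilon>. 0 < \<epsilon> \<and> \<epsilon> < \<delta> \<longrightarrow> (\<forall>\<sigma>. F (Complex \<sigma> (T + \<epsilon>)) \<noteq> 0 \<or> T + \<epsilon> < 0) \<and>
     {z. F z = 0 \<and> 0 \<le> Im z \<and> Im z \<le> T + \<epsilon>} = {z. F z = 0 \<and> 0 \<le> Im z \<and> Im z \<le> T}"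
proof -
  \<comment> \<open>The extra element \<open>1\<close> keeps the set nonempty and its minimum within
    the range where all zeros have been listed.\<close>
  define D where "D = insert 1 ((\<lambda>z. Im z - T) ` {z. F z = 0 \<and> 0 \<le> Im z \<and> Im z \<le> T + 1 \<and> T < Im z})"
  have "finite D" unfolding D_def
    by (intro finite.insertI finite_imageI finite_subset[OF _ finite_zeros_strip[of "T + 1"]]) auto
  moreover have "D \<noteq> {}" "\<forall>d\<in>D. d > 0" by (auto simp: D_def)
  ultimately have D: "Min D > 0" "\<And>d. d \<in> D \<Longrightarrow> Min D \<le> d" by auto
  have D1: "Min D \<le> 1" by (intro D) (simp add: D_def)
  have zero: "Im z \<ge> T + Min D" if "F z = 0" "0 \<le> Im z" "T < Im z" for z
  proof (cases "Im z \<le> T + 1")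
    case True
    then have "Im z - T \<in> D" using that by (auto simp: D_def)
    with D(2) show ?thesis by fastforce
  next
    case False
    with D1 show ?thesis by simp
  qed
  show ?thesis
  proof (intro exI[of _ "Min D"] conjI allI impI D(1))
    fix \<epsilon> \<sigma> assume "0 < \<epsilon> \<and> \<epsilon> < Min D"
    then show "F (Complex \<sigma> (T + \<epsilon>)) \<noteq> 0 \<or> T + \<epsilon> < 0"
      using zero[of "Complex \<sigma> (T + \<epsilon>)"] by force
  next
    fix \<epsilon> assume "0 < \<epsilon> \<and> \<epsilon> < Min D"
    then show "{z. F z = 0 \<and> 0 \<le> Im z \<and> Im z \<le> T + \<epsilon>} = {z. F z = 0 \<and> 0 \<le> Im z \<and> Im z \<le> T}"
      using zero by force
  qed
qed

text \<open>If \<open>T\<close> is the ordinate of a zero, the contour is moved up by a small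
  \<epsilon>, which does not change the set of zeros counted, and the bound passes to the
  limit.\<close>

lemma zero_sum_bound:
  assumes T: "T > 0"
  shows "\<bar>2 * pi * real_of_int (\<Sum>\<rho>\<in>{z. F z = 0 \<and> 0 \<le> Im z \<and> Im z \<le> T}. zorder F \<rho>) - T * L\<bar>
    \<le> pi * (card S + 3)" (is "\<bar>?N - T * L\<bar> \<le> ?B")
proof -
  obtain \<delta> where \<delta>: "\<delta> > 0" "\<And>\<epsilon>. 0 < \<epsilon> \<Longrightarrow> \<epsilon> < \<delta> \<Longrightarrow> (\<forall>\<sigma>. F (Complex \<sigma> (T + \<epsilon>)) \<noteq> 0 \<or> T + \<epsilon> < 0) \<and>
     {z. F z = 0 \<and> 0 \<le> Im z \<and> Im z \<le> T + \<epsilon>} = {z. F z = 0 \<and> 0 \<le> Im z \<and> Im z \<le> T}"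
    using zero_sum_stable[of T] by blast
  have ev: "\<bar>?N - (T + \<epsilon>) * L\<bar> \<le> ?B" if "0 < \<epsilon>" "\<epsilon> < \<delta>" for \<epsilon>
    using zero_sum_bound_nonordinate[of "T + \<epsilon>"] \<delta>(2)[OF that] T that by auto
  have "((\<lambda>\<epsilon>. \<bar>?N - (T + \<epsilon>) * L\<bar>) \<longlongrightarrow> \<bar>?N - (T + 0) * L\<bar>) (at_right 0)"
    by (intro tendsto_intros)
  moreover have "eventually (\<lambda>\<epsilon>. \<bar>?N - (T + \<epsilon>) * L\<bar> \<le> ?B) (at_right 0)"
    using ev \<delta>(1) by (auto simp: eventually_at_right[of 0 1] intro!: exI[of _ \<delta>])
  ultimately show ?thesis
    using tendsto_upperbound[of _ _ "at_right 0"] by fastforce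
qed

end

section \<open>Chebyshev's bound\<close>

lemma prod_primes_dvd:
  fixes n :: nat
  assumes "finite P" "\<And>p. p \<in> P \<Longrightarrow> prime p" "\<And>p. p \<in> P \<Longrightarrow> p dvd n"
  shows "\<Prod>P dvd n"
  using assms
proof (induction P rule: finite_induct)
  case (insert p P)
  have "coprime p (\<Prod>P)"
    using insert by (intro prod_coprime_right) (auto intro!: primes_coprime)
  then show ?case using insert by (auto intro!: divides_mult)
qed auto

text \<open>The argument of Erdos: for \<open>n = 2 * m + 1\<close> the primes from
  \<open>m + 2\<close> to \<open>2 * m + 1\<close> all divide one binomial coefficient, and an even
  \<open>n > 2\<close> adds no prime.\<close>

lemma prod_primes_le_4_power: "\<Prod>{p::nat. prime p \<and> p \<le> n} \<le> 4 ^ n"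
proof (induction n rule: less_induct)
  case (less n)
  have fin: "finite {p::nat. prime p \<and> p \<le> k}" for k
    by (rule finite_subset[of _ "{..k}"]) auto
  consider "n \<le> 1" | "n = 2" | "n > 2" "even n" | m where "n = 2 * m + 1" "m > 0"
  proof -
    show thesis if *: "n \<le> 1 \<Longrightarrow> thesis" "n = 2 \<Longrightarrow> thesis" "n > 2 \<Longrightarrow> even n \<Longrightarrow> thesis"
      "\<And>m. n = 2 * m + 1 \<Longrightarrow> m > 0 \<Longrightarrow> thesis" for thesis
    proof (cases "even n")
      case True
      with *(1-3) show thesis by linarith
    next
      case False
      then obtain m where "n = 2 * m + 1" by (rule oddE)
      with *(1) *(4)[of m] show thesis by (cases "m = 0") auto
    qed
  qed
  then show ?case
  proof cases
    case 1
    then have *: "\<not> (prime p \<and> p \<le> n)" for p :: nat using prime_gt_1_nat[of p] by linarith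
    show ?thesis by (simp add: *)
  next
    case 2
    have "{p::nat. prime p \<and> p \<le> 2} = {2}"
    proof (intro equalityI subsetI)
      fix p :: nat assume "p \<in> {p. prime p \<and> p \<le> 2}"
      with prime_ge_2_nat[of p] show "p \<in> {2}" by simp
    qed simp
    then show ?thesis using 2 by simp
  next
    case 3
    have "\<not> prime n" using 3 prime_odd_nat by blast
    then have "{p::nat. prime p \<and> p \<le> n} = {p. prime p \<and> p \<le> n - 1}"
    proof (intro Collect_cong conj_cong refl)
      fix p :: nat assume "prime p"
      with \<open>\<not> prime n\<close> have "p \<noteq> n" by blast
      then show "p \<le> n \<longleftrightarrow> p \<le> n - 1" by linarith
    qed
    then have "\<Prod>{p::nat. prime p \<and> p \<le> n} \<le> 4 ^ (n - 1)" using less[of "n - 1"] 3 by simp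
    also have "\<dots> \<le> 4 ^ n" by (intro power_increasing) auto
    finally show ?thesis .
  next
    case 4
    define Q where "Q = {p::nat. prime p \<and> m + 1 < p \<and> p \<le> 2 * m + 1}"
    have finQ: "finite Q" unfolding Q_def by (rule finite_subset[of _ "{..2*m+1}"]) auto
    have "p dvd (2 * m + 1 choose m)" if "p \<in> Q" for p
    proof -
      have p: "prime p" "m + 1 < p" "p \<le> 2 * m + 1" using that by (auto simp: Q_def)
      have "fact m * fact (m + 1) * (2 * m + 1 choose m) = (fact (2 * m + 1) :: nat)"
        using binomial_fact_lemma[of m "2 * m + 1"] by (simp add: mult_2)
      moreover have "p dvd fact (2 * m + 1)" using p prime_dvd_fact_iff by blast
      ultimately have "p dvd fact m * fact (m + 1) * (2 * m + 1 choose m)" by simp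
      moreover have "\<not> p dvd fact m" "\<not> p dvd fact (m + 1)"
        using p prime_dvd_fact_iff[of p m] prime_dvd_fact_iff[of p "m + 1"] by linarith+
      ultimately show ?thesis using p(1) by (simp add: prime_dvd_mult_iff)
    qed
    then have "\<Prod>Q dvd (2 * m + 1 choose m)"
      using finQ by (intro prod_primes_dvd) (auto simp: Q_def)
    then have "\<Prod>Q \<le> (2 * m + 1 choose m)" by (rule dvd_imp_le) simp
    \<comment> \<open>A row of odd index is symmetric, so its first half sums to
      \<open>2 ^ (2 * m)\<close>.\<close>
    also have "\<dots> \<le> (\<Sum>k\<le>m. (2 * m + 1 choose k))"
      by (rule member_le_sum) auto
    also have "\<dots> = 4 ^ m" using binomial_r_part_sum[of m] by (simp add: power_mult)
    finally have Q: "\<Prod>Q \<le> 4 ^ m" .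
    have "{p::nat. prime p \<and> p \<le> n} = {p. prime p \<and> p \<le> m + 1} \<union> Q"
      using 4 by (auto simp: Q_def)
    moreover have "{p. prime p \<and> p \<le> m + 1} \<inter> Q = {}" by (auto simp: Q_def)
    ultimately have "\<Prod>{p::nat. prime p \<and> p \<le> n} = \<Prod>{p. prime p \<and> p \<le> m + 1} * \<Prod>Q"
      using finQ fin by (simp add: prod.union_disjoint)
    also have "\<dots> \<le> 4 ^ (m + 1) * 4 ^ m"
      using less[of "m + 1"] 4 Q by (intro mult_le_mono) auto
    also have "\<dots> = 4 ^ n" using 4 by (simp add: power_add[symmetric] mult_2)
    finally show ?thesis .
  qed
qed

lemma sum_ln_primes_le:
  "(\<Sum>p | prime p \<and> p \<le> n. ln (real p)) \<le> real n * ln 4"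
proof -
  have fin: "finite {p::nat. prime p \<and> p \<le> n}"
    by (rule finite_subset[of _ "{..n}"]) auto
  have "(\<Sum>p | prime p \<and> p \<le> n. ln (real p)) = ln (real (\<Prod>{p. prime p \<and> p \<le> n}))"
    unfolding of_nat_prod using fin by (intro ln_prod[symmetric]) (auto dest: prime_gt_0_nat)
  also have "\<dots> \<le> ln (real (4 ^ n))"
  proof -
    have "0 < \<Prod>{p::nat. prime p \<and> p \<le> n}" by (intro prod_pos) (auto dest: prime_gt_0_nat)
    moreover have "real (\<Prod>{p::nat. prime p \<and> p \<le> n}) \<le> real (4 ^ n)"
      using prod_primes_le_4_power[of n] by (rule of_nat_mono)
    ultimately show ?thesis by (intro ln_mono) (simp_all only: of_nat_0_less_iff)
  qed
  also have "\<dots> = real n * ln 4" by (simp add: ln_realpow)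
  finally show ?thesis .
qed

section \<open>Boxes of integer polynomials modulo a monic polynomial\<close>

definition poly_box :: "nat \<Rightarrow> int \<Rightarrow> int \<Rightarrow> int poly set" where
  "poly_box d a b = {u. degree u < d \<and> (\<forall>i<d. coeff u i \<in> {a..b})}"

lemma card_poly_box:
  assumes "d > 0"
  shows "card (poly_box d a b) = nat (b - a + 1) ^ d" "finite (poly_box d a b)"
proof -
  define h where "h u = restrict (coeff u) {..<d}" for u :: "int poly"
  have "bij_betw h (poly_box d a b) (PiE {..<d} (\<lambda>_. {a..b}))"
  proof (rule bij_betw_imageI)
    show "inj_on h (poly_box d a b)"
    proof (rule inj_onI)
      fix u v assume uv: "u \<in> poly_box d a b" "v \<in> poly_box d a b" "h u = h v"
      show "u = v"
      proof (rule poly_eqI)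
        fix i
        show "coeff u i = coeff v i"
        proof (cases "i < d")
          case True
          then show ?thesis using fun_cong[OF uv(3), of i] by (simp add: h_def)
        next
          case False
          then show ?thesis using uv by (simp add: poly_box_def coeff_eq_0)
        qed
      qed
    qed
    show "h ` poly_box d a b = PiE {..<d} (\<lambda>_. {a..b})"
    proof (intro equalityI subsetI)
      fix c assume c: "c \<in> PiE {..<d} (\<lambda>_. {a..b})"
      define u where "u = (\<Sum>i<d. monom (c i) i)"
      have co: "coeff u j = (if j < d then c j else 0)" for j
        unfolding u_def coeff_sum by (simp add: sum.delta)
      have "degree u < d"
        using assms by (intro le_less_trans[OF degree_le[of "d - 1"]]) (auto simp: co)
      then have "u \<in> poly_box d a b" using c by (auto simp: poly_box_def co)
      moreover have "h u = c"
        using c by (auto simp: h_def co PiE_def extensional_def fun_eq_iff)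
      ultimately show "c \<in> h ` poly_box d a b" by blast
    qed (auto simp: h_def poly_box_def)
  qed
  from bij_betw_same_card[OF this] bij_betw_finite[OF this]
  show "card (poly_box d a b) = nat (b - a + 1) ^ d" "finite (poly_box d a b)"
    by (auto simp: card_PiE intro!: finite_PiE)
qed

lemma poly_box_diff:
  assumes "u \<in> poly_box d a b" "v \<in> poly_box d a' b'"
  shows "u - v \<in> poly_box d (a - b') (b - a')"
  using assms unfolding poly_box_def by (auto intro: le_less_trans[OF degree_diff_le_max] diff_mono)

text \<open>The Chinese remainder theorem for the maximal ideals \<open>(p, X - r)\<close> of the
  ring of integer polynomials, proved by adding one pair at a time.\<close>

lemma exists_poly_congruences:
  fixes W :: "(nat \<times> int) set" and c :: "nat \<times> int \<Rightarrow> int"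
  assumes "finite W" "\<And>p r. (p, r) \<in> W \<Longrightarrow> prime p"
    "\<And>p r r'. (p, r) \<in> W \<Longrightarrow> (p, r') \<in> W \<Longrightarrow> int p dvd r - r' \<Longrightarrow> r = r'"
  shows "\<exists>z. \<forall>(p, r)\<in>W. [poly z r = c (p, r)] (mod int p)"
  using assms
proof (induction W rule: finite_induct)
  case empty
  then show ?case by auto
next
  case (insert w W)
  obtain p r where w: "w = (p, r)" by (cases w)
  from insert obtain z where z: "\<forall>(p, r)\<in>W. [poly z r = c (p, r)] (mod int p)" by blast
  \<comment> \<open>\<open>e (p', r')\<close> vanishes at the pair \<open>(p', r')\<close> but not
    at the new pair \<open>(p, r)\<close>; a multiple of the product \<open>E\<close> can therefore
    correct the value at \<open>(p, r)\<close> without disturbing the others.\<close>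
  define e where "e = (\<lambda>(p', r'). if p' = p then [:- r', 1:] else [:int p':])"
  define E where "E = (\<Prod>w\<in>W. e w)"
  have p: "prime p" using insert.prems w by blast
  have "\<not> int p dvd poly (e (p', r')) r" if "(p', r') \<in> W" for p' r'
  proof (cases "p' = p")
    case True
    then show ?thesis using insert.prems(2)[of p r r'] insert.hyps w that by (auto simp: e_def)
  next
    case False
    have "prime p'" using insert.prems that by blast
    with False have "\<not> p dvd p'" using primes_dvd_imp_eq[OF p] by blast
    with False show ?thesis by (simp add: e_def int_dvd_int_iff)
  qed
  then have "\<not> int p dvd poly E r"
    using p insert.hyps unfolding E_def poly_prod by (auto simp: prime_dvd_prod_iff)
  then have "coprime (poly E r) (int p)"
    using prime_imp_coprime[of "int p" "poly E r"] p by (simp add: coprime_commute)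
  then obtain x where x: "[poly E r * x = 1] (mod int p)" using cong_solve_coprime_int by blast
  define t where "t = x * (c (p, r) - poly z r)"
  have "[poly (z + smult t E) r = c (p, r)] (mod int p)"
  proof -
    have "[poly z r + (poly E r * x) * (c (p, r) - poly z r) = poly z r + 1 * (c (p, r) - poly z r)] (mod int p)"
        by (intro cong_add cong_mult cong_refl x)
    moreover have "poly z r + 1 * (c (p, r) - poly z r) = c (p, r)" by simp
    moreover have "poly (z + smult t E) r = poly z r + (poly E r * x) * (c (p, r) - poly z r)"
      by (simp add: t_def mult_ac)
    ultimately show ?thesis by metis
  qed
  moreover have "[poly (z + smult t E) r' = c (p', r')] (mod int p')" if "(p', r') \<in> W" for p' r'
  proof -
    have "poly E r' = poly (e (p', r')) r' * (\<Prod>w\<in>W - {(p', r')}. poly (e w) r')"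
      unfolding E_def poly_prod using insert.hyps that by (subst prod.remove) auto
    moreover have "int p' dvd poly (e (p', r')) r'" by (auto simp: e_def)
    ultimately have "int p' dvd poly E r'" by simp
    then have "[poly z r' + t * poly E r' = poly z r' + 0] (mod int p')"
      by (intro cong_add cong_refl) (simp add: cong_0_iff)
    moreover have "[poly z r' = c (p', r')] (mod int p')" using z that by blast
    ultimately have "[poly z r' + t * poly E r' = c (p', r')] (mod int p')"
      by (metis add_0_right cong_trans)
    then show ?thesis by simp
  qed
  ultimately show ?case unfolding w by (intro exI[of _ "z + smult t E"]) blast
qed

lemma monic_int_poly_division:
  fixes f :: "int poly"
  assumes "lead_coeff f = 1" "degree f > 0"
  shows "\<exists>q r. p = f * q + r \<and> degree r < degree f"
proof -
  obtain q r where qr: "pseudo_divmod p f = (q, r)" by fastforce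
  have "f \<noteq> 0" using assms by auto
  from pseudo_divmod[OF this qr] assms have "p = f * q + r" "r = 0 \<or> degree r < degree f" by simp_all
  then show ?thesis using assms(2) by (metis degree_0)
qed

text \<open>The Bezout condition is the form in which irreducibility of \<open>f\<close> over the
  rationals is used: every nonzero \<open>v\<close> of lower degree is invertible modulo
  \<open>f\<close>.\<close>

locale monic_bezout_poly =
  fixes f :: "int poly" and d :: nat
  assumes monic: "lead_coeff f = 1" and deg: "degree f = d" and dpos: "d > 0"
    and bezout: "\<And>v :: int poly. v \<noteq> 0 \<Longrightarrow> degree v < d \<Longrightarrow>
      \<exists>a b :: rat poly. a * of_int_poly v + b * of_int_poly f = 1"
begin

definition rem_pow :: "nat \<Rightarrow> int poly" where
  "rem_pow i = (SOME r. degree r < d \<and> (\<exists>q. monom 1 i = f * q + r))"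

lemma rem_pow: "degree (rem_pow i) < d" "\<exists>q. monom 1 i = f * q + rem_pow i"
proof -
  have "\<exists>r. degree r < d \<and> (\<exists>q. monom 1 i = f * q + r)"
    using monic_int_poly_division[OF monic, of "monom 1 i"] dpos deg by auto
  from someI_ex[OF this] show "degree (rem_pow i) < d" "\<exists>q. monom 1 i = f * q + rem_pow i"
    unfolding rem_pow_def by auto
qed

text \<open>The factor \<open>d\<close> bounds the number of terms in a coefficient of a product of
  two polynomials of degree below \<open>d\<close>, \<open>2 * d\<close> the number of its
  monomials, and the maximum the coefficients of their remainders modulo \<open>f\<close>; the
  \<open>1\<close> makes the bound positive.\<close>

definition rem_bound :: nat where
  "rem_bound = d * (2 * d) * Max ((\<lambda>(i, j). nat \<bar>coeff (rem_pow i) j\<bar>) ` ({..<2 * d} \<times> {..<d})) + 1"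

lemma rem_bound_pos: "rem_bound > 0"
  by (simp add: rem_bound_def)

lemma reduce_rat_poly:
  fixes p :: "rat poly"
  assumes "degree p < 2 * d"
  shows "\<exists>g. p = of_int_poly f * g + (\<Sum>i<2*d. smult (coeff p i) (of_int_poly (rem_pow i)))"
proof -
  have "\<forall>i. \<exists>q. monom (1::int) i = f * q + rem_pow i" using rem_pow(2) by blast
  then obtain q where q: "\<And>i. monom (1::int) i = f * q i + rem_pow i" by metis
  have mono: "monom (1::rat) i = of_int_poly f * of_int_poly (q i) + of_int_poly (rem_pow i)" for i
    using arg_cong[OF q[of i], of "of_int_poly :: int poly \<Rightarrow> rat poly"] by (simp add: hom_distribs)
  have "p = (\<Sum>i<2*d. monom (coeff p i) i)"
  proof (rule poly_eqI)
    fix j show "coeff p j = coeff (\<Sum>i<2*d. monom (coeff p i) i) j"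
      using assms by (auto simp: coeff_sum coeff_eq_0)
  qed
  also have "\<dots> = (\<Sum>i<2*d. smult (coeff p i) (monom 1 i))"
    by (simp add: smult_monom)
  also have "\<dots> = (\<Sum>i<2*d. of_int_poly f * smult (coeff p i) (of_int_poly (q i)) +
      smult (coeff p i) (of_int_poly (rem_pow i)))"
    unfolding mono by (simp add: smult_add_right)
  also have "\<dots> = of_int_poly f * (\<Sum>i<2*d. smult (coeff p i) (of_int_poly (q i))) +
      (\<Sum>i<2*d. smult (coeff p i) (of_int_poly (rem_pow i)))"
    by (simp add: sum.distrib sum_distrib_left)
  finally show ?thesis by blast
qed

lemma coeff_mult_bound:
  fixes v h :: "rat poly"
  assumes "degree v < d" "\<And>i. \<bar>coeff v i\<bar> \<le> V" "\<And>i. 0 \<le> coeff h i \<and> coeff h i \<le> 1" "0 \<le> V"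
  shows "\<bar>coeff (v * h) k\<bar> \<le> of_nat d * V"
proof -
  have "\<bar>coeff (v * h) k\<bar> \<le> (\<Sum>i\<le>k. \<bar>coeff v i * coeff h (k - i)\<bar>)"
    unfolding coeff_mult by (rule sum_abs)
  also have "\<dots> \<le> (\<Sum>i\<le>k. if i < d then V else 0)"
  proof (rule sum_mono)
    fix i assume "i \<in> {..k}"
    show "\<bar>coeff v i * coeff h (k - i)\<bar> \<le> (if i < d then V else 0)"
    proof (cases "i < d")
      case True
      have "\<bar>coeff v i\<bar> * \<bar>coeff h (k - i)\<bar> \<le> V * 1"
        using assms(2)[of i] assms(3)[of "k - i"] assms(4) by (intro mult_mono) auto
      then show ?thesis using True by (simp add: abs_mult)
    next
      case False
      then show ?thesis using assms(1) by (simp add: coeff_eq_0)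
    qed
  qed
  also have "\<dots> = (\<Sum>i\<in>{..k} \<inter> {..<d}. V)"
    by (simp add: sum.If_cases lessThan_def)
  also have "\<dots> = of_nat (card ({..k} \<inter> {..<d})) * V" by simp
  also have "\<dots> \<le> of_nat d * V"
    using card_mono[of "{..<d}" "{..k} \<inter> {..<d}"] assms(4) by (intro mult_right_mono) auto
  finally show ?thesis .
qed

text \<open>The multiples of \<open>v\<close> modulo \<open>f\<close> form a lattice of full rank, and rounding the coordinates
  with respect to its basis \<open>v, v X, v X\<^sup>2, \<dots>\<close> reduces any polynomial to a small one.\<close>

lemma small_residue:
  assumes v: "v \<noteq> 0" "v \<in> poly_box d (- int V) (int V)"
  shows "\<exists>u w g. u \<in> poly_box d (- int (rem_bound * V)) (int (rem_bound * V)) \<and> z = u + v * w + f * g"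
proof -
  have dv: "degree v < d" and cv: "\<And>i. i < d \<Longrightarrow> \<bar>coeff v i\<bar> \<le> int V"
    using v(2) by (auto simp: poly_box_def abs_le_iff)
  define F V' Z where FVZ: "F = (of_int_poly f :: rat poly)" "V' = (of_int_poly v :: rat poly)" "Z = (of_int_poly z :: rat poly)"
  have dF: "degree F = d" "F \<noteq> 0" using deg dpos by (auto simp: FVZ)
  obtain a b where ab: "a * V' + b * F = 1" using bezout[OF v(1) dv] unfolding FVZ by blast
  \<comment> \<open>\<open>a\<close> inverts \<open>v\<close> modulo \<open>f\<close>, so
    \<open>v * w\<close> is congruent to \<open>z\<close> with rational coefficients; after
    rounding, only the fractional part \<open>h\<close> of \<open>w\<close> remains in the
    residue.\<close>
  define w where "w = (Z * a) mod F"
  define w0 where "w0 = map_poly floor w"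
  define h where "h = w - of_int_poly w0"
  have dw: "degree w < d" unfolding w_def using degree_mod_less[OF dF(2), of "Z * a"] dF(1) dpos
    by (cases "Z * a mod F = 0") simp_all
  have h: "0 \<le> coeff h i \<and> coeff h i \<le> 1" for i
    unfolding h_def w0_def by (simp add: coeff_map_poly) linarith
  have dh: "degree h < d"
  proof -
    have "degree (of_int_poly w0 :: rat poly) \<le> degree w"
      unfolding w0_def by (intro order.trans[OF degree_map_poly_le] degree_map_poly_le)
    with dw show ?thesis unfolding h_def by (intro le_less_trans[OF degree_diff_le_max]) simp
  qed
  obtain g u where gu: "z - v * w0 = f * g + u" "degree u < d"
    using monic_int_poly_division[OF monic, of "z - v * w0"] dpos deg by auto
  define Q where "Q = (Z * a) div F"
  have Za: "Z * a = F * Q + w" unfolding w_def Q_def by simp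
  have "Z = Z * (a * V' + b * F)" using ab by simp
  also have "\<dots> = V' * (Z * a) + F * (Z * b)" by (simp add: algebra_simps)
  also have "\<dots> = V' * w + F * (V' * Q + Z * b)" unfolding Za by (simp add: algebra_simps)
  finally have Z: "Z = V' * w + F * (V' * Q + Z * b)" .
  have "(of_int_poly (z - v * w0) :: rat poly) = of_int_poly (f * g + u)" using gu by simp
  then have "Z - V' * of_int_poly w0 = F * of_int_poly g + of_int_poly u"
    by (simp add: FVZ hom_distribs)
  then have "of_int_poly u = Z - V' * of_int_poly w0 - F * of_int_poly g" by (simp add: algebra_simps)
  moreover define B where "B = V' * Q + Z * b"
  have ZB: "Z = V' * w + F * B" unfolding B_def by (rule Z)
  ultimately have U1: "of_int_poly u = V' * h + F * (B - of_int_poly g)"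
    unfolding h_def by (simp only: ZB) (simp add: algebra_simps)
  have "degree (V' * h) < 2 * d"
    using degree_mult_le[of V' h] dv dh by (simp add: FVZ)
  from reduce_rat_poly[OF this] obtain g' where
    g': "V' * h = F * g' + (\<Sum>i<2*d. smult (coeff (V' * h) i) (of_int_poly (rem_pow i)))"
    unfolding FVZ by blast
  define R where "R = (\<Sum>i<2*d. smult (coeff (V' * h) i) (of_int_poly (rem_pow i)))"
  have dR: "degree R < d"
    unfolding R_def
  proof (rule degree_sum_less)
    fix i assume "i \<in> {..<2*d}"
    show "degree (smult (coeff (V' * h) i) (of_int_poly (rem_pow i))) < d"
      using rem_pow(1)[of i] dpos by (auto intro: le_less_trans[OF degree_smult_le])
  qed (use dpos in auto)
  \<comment> \<open>Both \<open>u\<close> and \<open>R\<close> are reductions of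
    \<open>v * h\<close> modulo \<open>f\<close> of degree below \<open>d\<close>. A multiple of
    \<open>f\<close> of such a degree vanishes, so they agree and \<open>u\<close> inherits the
    bound for \<open>R\<close>.\<close>
  have "F * (g' + B - of_int_poly g) = of_int_poly u - R"
    unfolding U1 R_def by (subst g') (simp add: algebra_simps)
  moreover have "degree (of_int_poly u - R) < degree F"
    using dR gu(2) dF by (intro le_less_trans[OF degree_diff_le_max]) auto
  ultimately have "of_int_poly u - R = 0"
  proof (cases "g' + B - of_int_poly g = 0")
    case False
    have "degree (F * (g' + B - of_int_poly g)) = degree F + degree (g' + B - of_int_poly g)"
      by (rule degree_mult_eq[OF dF(2) False])
    with \<open>F * _ = _\<close> \<open>degree (of_int_poly u - R) < degree F\<close> show ?thesis by simp
  qed (simp only: mult_zero_right)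
  then have uR: "of_int_poly u = R" by simp
  define A where "A = Max ((\<lambda>(i, j). nat \<bar>coeff (rem_pow i) j\<bar>) ` ({..<2 * d} \<times> {..<d}))"
  have A: "\<bar>coeff (rem_pow i) j\<bar> \<le> int A" if "i < 2 * d" "j < d" for i j
  proof -
    have "nat \<bar>coeff (rem_pow i) j\<bar> \<le> A"
      unfolding A_def using that by (intro Max_ge) (auto intro!: image_eqI[of _ _ "(i, j)"])
    then show ?thesis by simp
  qed
  have "\<bar>coeff u j\<bar> \<le> int (rem_bound * V)" if "j < d" for j
  proof -
    have "of_int \<bar>coeff u j\<bar> = \<bar>coeff R j\<bar>"
      unfolding uR[symmetric] by (simp add: coeff_map_poly)
    also have "\<dots> \<le> (\<Sum>i<2*d. \<bar>coeff (V' * h) i\<bar> * of_int \<bar>coeff (rem_pow i) j\<bar>)"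
      unfolding R_def coeff_sum by (rule order.trans[OF sum_abs]) (simp add: abs_mult coeff_map_poly)
    also have "\<dots> \<le> (\<Sum>i<2*d. (of_nat d * of_nat V) * of_nat A)"
    proof (intro sum_mono mult_mono)
      fix i assume i: "i \<in> {..<2*d}"
      show "\<bar>coeff (V' * h) i\<bar> \<le> of_nat d * of_nat V"
      proof (rule coeff_mult_bound[OF _ _ h])
        show "degree V' < d" using dv by (simp add: FVZ)
        fix i
        have "\<bar>coeff v i\<bar> \<le> int V" using cv[of i] dv by (cases "i < d") (auto simp: coeff_eq_0)
        then have "of_int \<bar>coeff v i\<bar> \<le> (of_int (int V) :: rat)" by (simp only: of_int_le_iff)
        then show "\<bar>coeff V' i\<bar> \<le> of_nat V" by (simp add: FVZ coeff_map_poly)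
      qed simp
      have "of_int \<bar>coeff (rem_pow i) j\<bar> \<le> (of_int (int A) :: rat)"
        using A[of i j] i that by (simp only: of_int_le_iff) simp
      then show "of_int \<bar>coeff (rem_pow i) j\<bar> \<le> (of_nat A :: rat)" by simp
    qed auto
    also have "\<dots> = of_nat (d * (2 * d) * A * V)" by simp
    finally have "of_int \<bar>coeff u j\<bar> \<le> (of_int (int (d * (2 * d) * A * V)) :: rat)" by simp
    then have "\<bar>coeff u j\<bar> \<le> int (d * (2 * d) * A * V)" by (simp only: of_int_le_iff)
    moreover have "d * (2 * d) * A * V \<le> rem_bound * V"
      unfolding rem_bound_def A_def[symmetric] by (intro mult_right_mono) auto
    ultimately show ?thesis by linarith
  qed
  then have "u \<in> poly_box d (- int (rem_bound * V)) (int (rem_bound * V))"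
    using gu(2) unfolding poly_box_def by (force simp: abs_le_iff)
  moreover have "z = u + v * w0 + f * g" using gu(1) by (simp add: algebra_simps)
  ultimately show ?thesis by blast
qed

text \<open>Thue's argument: more than \<open>p\<close> polynomials with coefficients in
  \<open>{0..k}\<close> include two with equal values at \<open>r\<close> modulo \<open>p\<close>.
  Their difference \<open>v\<close> vanishes at \<open>r\<close>, and reducing the constant
  \<open>c\<close> modulo \<open>v\<close> and \<open>f\<close> gives a representative of size
  \<open>k\<close> up to a constant, where \<open>k\<close> may be about the \<open>d\<close>-th
  root of \<open>p\<close>.\<close>

lemma small_class_representative:
  assumes p: "p < (k + 1) ^ d" "p > 0" and r: "int p dvd poly f r"
  shows "\<exists>u \<in> poly_box d (- int (rem_bound * k)) (int (rem_bound * k)). [poly u r = c] (mod int p)"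
proof -
  have "card ((\<lambda>u. poly u r mod int p) ` poly_box d 0 (int k)) \<le> card {0..<int p}"
    using p by (intro card_mono) auto
  also have "\<dots> < card (poly_box d 0 (int k))"
    using p card_poly_box[OF dpos, of 0 "int k"] by (simp add: nat_add_distrib)
  finally have "\<not> inj_on (\<lambda>u. poly u r mod int p) (poly_box d 0 (int k))"
    using pigeonhole by blast
  then obtain x y where xy: "x \<in> poly_box d 0 (int k)" "y \<in> poly_box d 0 (int k)" "x \<noteq> y"
    "poly x r mod int p = poly y r mod int p"
    by (auto simp: inj_on_def)
  define v where "v = x - y"
  have v: "v \<noteq> 0" "v \<in> poly_box d (- int k) (int k)"
    using xy(3) poly_box_diff[OF xy(1,2)] by (auto simp: v_def)
  have vr: "int p dvd poly v r" using xy(4) by (simp add: v_def mod_eq_dvd_iff)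
  obtain u w g where u: "u \<in> poly_box d (- int (rem_bound * k)) (int (rem_bound * k))"
    "[:c:] = u + v * w + f * g"
    using small_residue[OF v, of "[:c:]"] by blast
  have "c = poly u r + poly v r * poly w r + poly f r * poly g r"
    using arg_cong[OF u(2), of "\<lambda>q. poly q r"] by simp
  then have "int p dvd c - poly u r" using vr r by (auto intro!: dvd_add)
  then have "[c = poly u r] (mod int p)" by (simp add: cong_iff_dvd_diff)
  with u(1) show ?thesis using cong_sym by blast
qed

lemma prod_primes_le_box:
  assumes v: "v \<noteq> 0" "v \<in> poly_box d (- int V) (int V)"
    and W: "finite W" "\<And>p r. (p, r) \<in> W \<Longrightarrow> prime p"
    "\<And>p r r'. (p, r) \<in> W \<Longrightarrow> (p, r') \<in> W \<Longrightarrow> int p dvd r - r' \<Longrightarrow> r = r'"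
    "\<And>p r. (p, r) \<in> W \<Longrightarrow> int p dvd poly f r" "\<And>p r. (p, r) \<in> W \<Longrightarrow> int p dvd poly v r"
  shows "(\<Prod>(p, r)\<in>W. p) \<le> (2 * rem_bound * V + 1) ^ d"
proof -
  define B where "B = poly_box d (- int (rem_bound * V)) (int (rem_bound * V))"
  define h where "h u = restrict (\<lambda>(p, r). poly u r mod int p) W" for u
  have "PiE W (\<lambda>w. {0..<int (fst w)}) \<subseteq> h ` B"
  proof
    fix c assume c: "c \<in> PiE W (\<lambda>w. {0..<int (fst w)})"
    have "\<exists>z. \<forall>(p, r)\<in>W. [poly z r = c (p, r)] (mod int p)"
      by (rule exists_poly_congruences[OF W(1)], erule W(2), erule (2) W(3))
    then obtain z where z: "\<forall>(p, r)\<in>W. [poly z r = c (p, r)] (mod int p)" by blast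
    \<comment> \<open>Replacing \<open>z\<close> by \<open>u\<close> changes no residue, since
      \<open>v\<close> and \<open>f\<close> vanish at all pairs of \<open>W\<close>.\<close>
    obtain u w g where u: "u \<in> B" "z = u + v * w + f * g"
      using small_residue[OF v, of z] unfolding B_def by blast
    have "h u = c"
    proof
      fix x
      show "h u x = c x"
      proof (cases "x \<in> W")
        case True
        obtain p r where x: "x = (p, r)" by (cases x)
        with True have pr: "(p, r) \<in> W" by simp
        have "poly z r - poly u r = poly v r * poly w r + poly f r * poly g r"
          unfolding u(2) by simp
        also have "int p dvd \<dots>" using W(4,5)[OF pr] by simp
        finally have "[poly z r = poly u r] (mod int p)" by (simp add: cong_iff_dvd_diff)
        with z pr have "[poly u r = c (p, r)] (mod int p)"
          using cong_sym cong_trans by blast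
        moreover have "c (p, r) \<in> {0..<int p}" using c pr by (metis PiE_mem fst_conv)
        ultimately show ?thesis using x pr by (simp add: h_def cong_def)
      next
        case False
        then show ?thesis using PiE_arb[OF c False] by (simp add: h_def)
      qed
    qed
    then show "c \<in> h ` B" using u(1) by blast
  qed
  then have "card (PiE W (\<lambda>w. {0..<int (fst w)})) \<le> card (h ` B)"
    unfolding B_def using card_poly_box(2)[OF dpos] by (intro card_mono finite_imageI) auto
  also have "\<dots> \<le> card B" unfolding B_def using card_poly_box(2)[OF dpos] by (rule card_image_le)
  also have "\<dots> = (2 * rem_bound * V + 1) ^ d"
    unfolding B_def card_poly_box(1)[OF dpos] by (simp add: nat_add_distrib nat_mult_distrib algebra_simps)
  finally show ?thesis using W(1) by (simp add: card_PiE case_prod_beta)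
qed

text \<open>Translation by a small representative of a residue class moves that class, within the
  smaller box, into the lattice within the larger one. So none of the \<open>p\<close> classes is
  larger than the lattice set; the margin \<open>rem_bound * k\<close> is the size of the
  translations.\<close>

lemma card_box_le_lattice:
  assumes p: "p < (k + 1) ^ d" "p > 0" and r: "int p dvd poly f r" and N: "rem_bound * k \<le> N"
  shows "(2 * (N - rem_bound * k) + 1) ^ d \<le>
    p * card {u \<in> poly_box d (- int N) (int N). int p dvd poly u r}"
proof -
  define D where "D = rem_bound * k"
  define L where "L = {u \<in> poly_box d (- int N) (int N). int p dvd poly u r}"
  define B where "B = poly_box d (- int (N - D)) (int (N - D))"
  have finL: "finite L" unfolding L_def using card_poly_box(2)[OF dpos] by simp
  have finB: "finite B" unfolding B_def using card_poly_box(2)[OF dpos] by simp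
  have cls: "card {u \<in> B. poly u r mod int p = c} \<le> card L" if "c \<in> {0..<int p}" for c
  proof -
    obtain e where e: "e \<in> poly_box d (- int D) (int D)" "[poly e r = c] (mod int p)"
      using small_class_representative[OF p r] unfolding D_def by blast
    have "(\<lambda>u. u - e) ` {u \<in> B. poly u r mod int p = c} \<subseteq> L"
    proof clarify
      fix u assume u: "u \<in> B" "c = poly u r mod int p"
      then have "u - e \<in> poly_box d (- int N) (int N)"
        using poly_box_diff[OF u(1)[unfolded B_def] e(1)] N by (simp add: D_def of_nat_diff)
      moreover have "[poly u r = poly e r] (mod int p)" using e(2) u(2) by (simp add: cong_def)
      ultimately show "u - e \<in> L" by (simp add: L_def cong_iff_dvd_diff)
    qed
    then have "card ((\<lambda>u. u - e) ` {u \<in> B. poly u r mod int p = c}) \<le> card L"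
      using finL by (rule card_mono[rotated])
    moreover have "inj_on (\<lambda>u. u - e) {u \<in> B. poly u r mod int p = c}" by (auto simp: inj_on_def)
    ultimately show ?thesis by (simp add: card_image)
  qed
  have "(2 * (N - D) + 1) ^ d = card B"
    unfolding B_def card_poly_box(1)[OF dpos] by (simp add: nat_add_distrib nat_mult_distrib algebra_simps)
  also have "B = (\<Union>c\<in>{0..<int p}. {u \<in> B. poly u r mod int p = c})" using p by auto
  also have "card \<dots> \<le> (\<Sum>c\<in>{0..<int p}. card {u \<in> B. poly u r mod int p = c})"
    by (rule card_UN_le) simp
  also have "\<dots> \<le> (\<Sum>c\<in>{0..<int p}. card L)" using cls by (rule sum_mono)
  also have "\<dots> = p * card L" by simp
  finally show ?thesis by (simp add: D_def L_def)
qed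

section \<open>A Mertens bound for primes modulo which \<open>f\<close> has \<open>d\<close>
  roots\<close>

text \<open>With \<open>2 ^ ((j - 1) * d) < p \<le> 2 ^ (j * d)\<close> the weight
  \<open>2 ^ j\<close> is the \<open>d\<close>-th root of \<open>p\<close> up to a factor two.
  Chebyshev's bound on each block gives a geometric series dominated by its last term; it measures
  the total boundary error of the lattice counts.\<close>

lemma dyadic_sum_le:
  fixes S :: "nat set"
  assumes "\<And>p. p \<in> S \<Longrightarrow> prime p" and Y: "\<And>p. p \<in> S \<Longrightarrow> p \<le> 2 ^ (J * d)" and fin: "finite S"
  defines "j \<equiv> (\<lambda>p. LEAST j. p \<le> 2 ^ (j * d))"
  shows "(\<Sum>p\<in>S. ln (real p) / real p * 2 ^ j p) \<le> 2 ^ (J + 1) * (2 ^ d * ln 4)"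
proof -
  have j: "p \<le> 2 ^ (j p * d)" "j p \<le> J" if "p \<in> S" for p
    using LeastI[of "\<lambda>j. p \<le> 2 ^ (j * d)", OF Y[OF that]] Least_le[of "\<lambda>j. p \<le> 2 ^ (j * d)", OF Y[OF that]]
    by (simp_all add: j_def)
  have j0: "j p > 0" if "p \<in> S" for p
    using j(1)[OF that] prime_gt_1_nat[OF assms(1)[OF that]] by (cases "j p") auto
  have j': "2 ^ ((j p - 1) * d) < p" if "p \<in> S" for p
    using not_less_Least[of "j p - 1" "\<lambda>j. p \<le> 2 ^ (j * d)"] j0[OF that] by (auto simp: j_def)
  have grp: "(\<Sum>p\<in>{p \<in> S. j p = i}. ln (real p) / real p * 2 ^ j p) \<le> 2 ^ i * (2 ^ d * ln 4)" if i: "i \<in> {1..J}" for i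
  proof -
    have "(\<Sum>p\<in>{p \<in> S. j p = i}. ln (real p) / real p * 2 ^ j p)
       \<le> (\<Sum>p\<in>{p \<in> S. j p = i}. ln (real p) * (2 ^ i / 2 ^ ((i - 1) * d)))"
    proof (rule sum_mono)
      fix p assume "p \<in> {p \<in> S. j p = i}"
      then have p: "p \<in> S" "j p = i" by auto
      have "real (2 ^ ((i - 1) * d)) \<le> real p" using j'[OF p(1)] p(2) by (simp only: of_nat_le_iff)
      then have "2 ^ ((i - 1) * d) \<le> real p" by simp
      then have "ln (real p) / real p \<le> ln (real p) / 2 ^ ((i - 1) * d)"
        using prime_gt_1_nat[OF assms(1)[OF p(1)]] by (intro divide_left_mono) auto
      then have "ln (real p) / real p * 2 ^ i \<le> ln (real p) / 2 ^ ((i - 1) * d) * 2 ^ i"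
        by (intro mult_right_mono) auto
      then show "ln (real p) / real p * 2 ^ j p \<le> ln (real p) * (2 ^ i / 2 ^ ((i - 1) * d))"
        using p(2) by simp
    qed
    also have "\<dots> = (\<Sum>p\<in>{p \<in> S. j p = i}. ln (real p)) * (2 ^ i / 2 ^ ((i - 1) * d))"
      by (simp only: sum_distrib_right)
    also have "\<dots> \<le> (real (2 ^ (i * d)) * ln 4) * (2 ^ i / 2 ^ ((i - 1) * d))"
    proof (intro mult_right_mono)
      have "(\<Sum>p\<in>{p \<in> S. j p = i}. ln (real p)) \<le> (\<Sum>p | prime p \<and> p \<le> 2 ^ (i * d). ln (real p))"
      proof (rule sum_mono2)
        show "finite {p::nat. prime p \<and> p \<le> 2 ^ (i * d)}"
          by (rule finite_subset[of _ "{..2 ^ (i * d)}"]) auto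
        show "{p \<in> S. j p = i} \<subseteq> {p. prime p \<and> p \<le> 2 ^ (i * d)}"
          using j(1) assms(1) by auto
        fix p :: nat assume "p \<in> {p. prime p \<and> p \<le> 2 ^ (i * d)} - {p \<in> S. j p = i}"
        then show "0 \<le> ln (real p)" using prime_gt_1_nat[of p] by (simp add: ln_ge_zero)
      qed
      also have "\<dots> \<le> real (2 ^ (i * d)) * ln 4" by (rule sum_ln_primes_le)
      finally show "(\<Sum>p\<in>{p \<in> S. j p = i}. ln (real p)) \<le> real (2 ^ (i * d)) * ln 4" .
    qed auto
    also have "\<dots> = 2 ^ i * (2 ^ d * ln 4)"
    proof -
      have "i * d = (i - 1) * d + d" using i by (simp add: algebra_simps)
      then have "(2::real) ^ (i * d) = 2 ^ ((i - 1) * d) * 2 ^ d" by (simp only: power_add)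
      then show ?thesis by simp
    qed
    finally show ?thesis .
  qed
  have "(\<Sum>p\<in>S. ln (real p) / real p * 2 ^ j p) = (\<Sum>i\<in>{1..J}. \<Sum>p\<in>{p \<in> S. j p = i}. ln (real p) / real p * 2 ^ j p)"
  proof (rule sum.group[symmetric])
    show "j ` S \<subseteq> {1..J}" using j(2) j0 by (auto simp: Suc_le_eq)
  qed (use fin in auto)
  also have "\<dots> \<le> (\<Sum>i\<in>{1..J}. 2 ^ i * (2 ^ d * ln 4))"
    using grp by (rule sum_mono)
  also have "\<dots> = (\<Sum>i\<in>{1..J}. 2 ^ i) * (2 ^ d * ln 4)" by (simp only: sum_distrib_right)
  also have "\<dots> \<le> 2 ^ (J + 1) * (2 ^ d * ln 4)"
  proof (intro mult_right_mono)
    have "(\<Sum>i\<in>{1..J}. (2::real) ^ i) \<le> (\<Sum>i<J + 1. 2 ^ i)" by (intro sum_mono2) auto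
    also have "\<dots> = 2 ^ (J + 1) - 1" by (simp add: geometric_sum)
    finally show "(\<Sum>i\<in>{1..J}. (2::real) ^ i) \<le> 2 ^ (J + 1)" by simp
  qed auto
  finally show ?thesis .
qed

text \<open>The double count runs over a nonzero \<open>v\<close> in the box together with a pair
  \<open>(p, r)\<close> at which \<open>v\<close> vanishes, weighted by \<open>ln p\<close>;
  \<open>prod_primes_le_box\<close> bounds it from above and \<open>card_box_le_lattice\<close> from
  below.\<close>

lemma sum_splitting_primes_le:
  assumes S: "\<And>p. p \<in> S \<Longrightarrow> prime p" and R: "\<And>p. p \<in> S \<Longrightarrow> R p \<subseteq> {0..<int p} \<and> card (R p) = d"
    and root: "\<And>p r. p \<in> S \<Longrightarrow> r \<in> R p \<Longrightarrow> int p dvd poly f r"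
    and Y: "\<And>p. p \<in> S \<Longrightarrow> p \<le> 2 ^ (J * d)" and fin: "finite S"
  shows "(\<Sum>p\<in>S. ln (real p) / real p) \<le>
    real J * ln 2 + (ln (3 * real rem_bound ^ 2) + ln 4 + real d * (2 * (2 ^ d * ln 4)))"
proof -
  define C where "C = rem_bound"
  have C: "C > 0" using rem_bound_pos by (simp add: C_def)
  \<comment> \<open>Large enough for every margin \<open>D p\<close>, while \<open>N ^ d\<close>
    exceeds the range \<open>2 ^ (J * d)\<close> of the primes only by a constant factor, which
    keeps \<open>ln N\<close> at \<open>J * ln 2 + O(1)\<close>.\<close>
  define N where "N = C * 2 ^ J"
  have N: "N > 0" using C by (simp add: N_def)
  define j where "j p = (LEAST j. p \<le> 2 ^ (j * d))" for p :: nat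
  have j: "p \<le> 2 ^ (j p * d)" "j p \<le> J" if "p \<in> S" for p
    using LeastI[of "\<lambda>j. p \<le> 2 ^ (j * d)", OF Y[OF that]] Least_le[of "\<lambda>j. p \<le> 2 ^ (j * d)", OF Y[OF that]]
    by (simp_all add: j_def)
  define D where "D p = C * 2 ^ j p" for p :: nat
  have DN: "D p \<le> N" if "p \<in> S" for p
    using j(2)[OF that] by (simp add: D_def N_def)
  define B where "B = poly_box d (- int N) (int N)"
  have cB: "card B = (2 * N + 1) ^ d" and finB: "finite B"
    unfolding B_def using card_poly_box[OF dpos] by (auto simp: nat_add_distrib nat_mult_distrib algebra_simps)
  define b where "b = real (2 * N + 1) ^ d"
  have b: "b > 0" by (simp add: b_def)
  have cBb: "real (card B) = b" by (simp add: cB b_def)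
  have zeroB: "0 \<in> B" using dpos by (auto simp: B_def poly_box_def)
  define P where "P = (SIGMA p:S. R p)"
  have finR: "finite (R p)" if "p \<in> S" for p
    using R[OF that] finite_subset by blast
  have finP: "finite P" unfolding P_def using fin finR by (intro finite_SigmaI) auto
  define M where "M = real d * ln (2 * real C * real N + 1)"
  have vb: "(\<Sum>q\<in>{q \<in> P. int (fst q) dvd poly v (snd q)}. ln (real (fst q))) \<le> M" if v: "v \<in> B - {0}" for v
  proof -
    define W where "W = {q \<in> P. int (fst q) dvd poly v (snd q)}"
    have finW: "finite W" unfolding W_def using finP by (rule rev_finite_subset) auto
    have WP: "p \<in> S" "r \<in> R p" "int p dvd poly v r" if "(p, r) \<in> W" for p r
      using that by (auto simp: W_def P_def)
    have uniq: "r = r'" if "(p, r) \<in> W" "(p, r') \<in> W" "int p dvd r - r'" for p r r'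
    proof -
      have "r \<in> {0..<int p}" "r' \<in> {0..<int p}" using R WP that(1,2) by blast+
      then show ?thesis using that(3) by (simp add: mod_eq_dvd_iff[symmetric])
    qed
    have "(\<Prod>(p, r)\<in>W. p) \<le> (2 * rem_bound * N + 1) ^ d"
    proof (rule prod_primes_le_box[OF _ _ finW])
      show "v \<noteq> 0" "v \<in> poly_box d (- int N) (int N)" using v by (auto simp: B_def)
    qed (use uniq WP S root in blast)+
    moreover have pos: "0 < p" if "(p, r) \<in> W" for p r using S[OF WP(1)[OF that]] prime_gt_0_nat by blast
    then have "0 < (\<Prod>(p, r)\<in>W. p)" by (intro prod_pos) auto
    ultimately have "ln (real (\<Prod>(p, r)\<in>W. p)) \<le> ln (real ((2 * rem_bound * N + 1) ^ d))"
      by (intro ln_mono) (simp_all only: of_nat_0_less_iff of_nat_le_iff)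
    also have "\<dots> = M" by (simp add: M_def C_def ln_realpow algebra_simps)
    also have "ln (real (\<Prod>(p, r)\<in>W. p)) = (\<Sum>q\<in>W. ln (real (fst q)))"
      unfolding of_nat_prod case_prod_beta using finW pos by (intro ln_prod) auto
    finally show ?thesis by (simp add: W_def)
  qed
  have "(\<Sum>v\<in>B - {0}. \<Sum>q\<in>{q \<in> P. int (fst q) dvd poly v (snd q)}. ln (real (fst q))) \<le> (\<Sum>v\<in>B - {0}. M)"
    using vb by (rule sum_mono)
  also have "\<dots> \<le> b * M"
  proof -
    have "M \<ge> 0" unfolding M_def by (intro mult_nonneg_nonneg ln_ge_zero) auto
    moreover have "real (card (B - {0})) \<le> b" unfolding cBb[symmetric] using finB by (simp add: card_mono)
    ultimately show ?thesis by (simp add: mult_right_mono)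
  qed
  also have "(\<Sum>v\<in>B - {0}. \<Sum>q\<in>{q \<in> P. int (fst q) dvd poly v (snd q)}. ln (real (fst q))) = (\<Sum>q\<in>P. \<Sum>v\<in>{v \<in> B - {0}. int (fst q) dvd poly v (snd q)}. ln (real (fst q)))"
    using finB finP by (intro sum.swap_restrict) auto
  also have "\<dots> = (\<Sum>q\<in>P. real (card {v \<in> B - {0}. int (fst q) dvd poly v (snd q)}) * ln (real (fst q)))"
    by simp
  finally have main: "(\<Sum>q\<in>P. real (card {v \<in> B - {0}. int (fst q) dvd poly v (snd q)}) * ln (real (fst q))) \<le> b * M" .
  \<comment> \<open>Bernoulli's inequality turns the shrunken box into a relative loss of at most
    \<open>d * D p / N\<close>; the \<open>- 1\<close> removes the zero polynomial, which lies in
    every lattice.\<close>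
  have low: "(b * (1 - real d * real (D p) / real N) / real p - 1) * ln (real p) \<le>
     real (card {v \<in> B - {0}. int p dvd poly v r}) * ln (real p)" if pr: "p \<in> S" "r \<in> R p" for p r
  proof (rule mult_right_mono)
    have p: "p > 0" "p > 1" using S[OF pr(1)] prime_gt_1_nat[of p] by auto
    have "p < (2 ^ j p + 1) ^ d"
    proof -
      have "p \<le> (2 ^ j p) ^ d" using j(1)[OF pr(1)] by (simp add: power_mult)
      also have "\<dots> < (2 ^ j p + 1) ^ d" using dpos by (intro power_strict_mono) auto
      finally show ?thesis .
    qed
    from card_box_le_lattice[OF this p(1) root[OF pr], of N] DN[OF pr(1)]
    have "(2 * (N - D p) + 1) ^ d \<le> p * card {u \<in> B. int p dvd poly u r}"
      by (simp add: D_def C_def B_def)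
    also have "{u \<in> B. int p dvd poly u r} = insert 0 {v \<in> B - {0}. int p dvd poly v r}"
      using zeroB by auto
    also have "card \<dots> = Suc (card {v \<in> B - {0}. int p dvd poly v r})"
      using finB by (intro card_insert_disjoint) auto
    finally have "real ((2 * (N - D p) + 1) ^ d) \<le> real (p * Suc (card {v \<in> B - {0}. int p dvd poly v r}))"
      by (rule of_nat_mono)
    moreover have "real (2 * (N - D p) + 1) = 2 * (real N - real (D p)) + 1"
      using DN[OF pr(1)] by (simp add: of_nat_diff)
    ultimately have 1: "(2 * (real N - real (D p)) + 1) ^ d \<le> real p * (1 + real (card {v \<in> B - {0}. int p dvd poly v r}))"
      by (simp only: of_nat_power of_nat_mult[of p] of_nat_Suc)
    define x where "x = 2 * real (D p) / (2 * real N + 1)"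
    have x: "0 \<le> x" "x \<le> 1" "x \<le> real (D p) / real N"
    proof -
      show "0 \<le> x" by (simp add: x_def)
      show "x \<le> 1" using DN[OF pr(1)] by (simp add: x_def)
      have "real (D p) / real N = 2 * real (D p) / (2 * real N)" by simp
      moreover have "x \<le> 2 * real (D p) / (2 * real N)"
        unfolding x_def using N by (intro divide_left_mono) auto
      ultimately show "x \<le> real (D p) / real N" by simp
    qed
    have "1 - real d * real (D p) / real N \<le> 1 + real d * (- x)"
      using mult_left_mono[OF x(3), of "real d"] by simp
    also have "\<dots> \<le> (1 + (- x)) ^ d" using x by (intro Bernoulli_inequality) auto
    finally have "b * (1 - real d * real (D p) / real N) \<le> b * (1 + (- x)) ^ d"
      using b by (intro mult_left_mono) auto
    also have "\<dots> = (2 * (real N - real (D p)) + 1) ^ d"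
    proof -
      have "(2 * real N + 1) * (1 + (- x)) = 2 * (real N - real (D p)) + 1"
      proof -
        have "(2 * real N + 1) * x = 2 * real (D p)" by (simp add: x_def)
        moreover have "(2 * real N + 1) * (1 + (- x)) = (2 * real N + 1) - (2 * real N + 1) * x"
          by (simp only: distrib_left mult_minus_right mult_1_right)
        ultimately have "(2 * real N + 1) * (1 + (- x)) = 2 * real N + 1 - 2 * real (D p)"
          by (simp only:)
        also have "\<dots> = 2 * (real N - real (D p)) + 1" by (simp only: right_diff_distrib diff_add_eq)
        finally show ?thesis .
      qed
      then show ?thesis unfolding b_def by (simp add: power_mult_distrib[symmetric] add.commute)
    qed
    also note 1
    finally have "b * (1 - real d * real (D p) / real N) / real p \<le> 1 + real (card {v \<in> B - {0}. int p dvd poly v r})"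
      using p by (simp add: divide_le_eq mult.commute)
    then show "b * (1 - real d * real (D p) / real N) / real p - 1 \<le> real (card {v \<in> B - {0}. int p dvd poly v r})"
      by simp
    show "0 \<le> ln (real p)" using p by (simp add: ln_ge_zero)
  qed
  have "(\<Sum>q\<in>P. (b * (1 - real d * real (D (fst q)) / real N) / real (fst q) - 1) * ln (real (fst q))) \<le> b * M"
  proof (rule order.trans[OF sum_mono main])
    fix q assume "q \<in> P"
    then have "fst q \<in> S" "snd q \<in> R (fst q)" by (auto simp: P_def)
    from low[OF this]
    show "(b * (1 - real d * real (D (fst q)) / real N) / real (fst q) - 1) * ln (real (fst q)) \<le>
      real (card {v \<in> B - {0}. int (fst q) dvd poly v (snd q)}) * ln (real (fst q))" .
  qed
  also have "(\<Sum>q\<in>P. (b * (1 - real d * real (D (fst q)) / real N) / real (fst q) - 1) * ln (real (fst q))) =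
    (\<Sum>p\<in>S. \<Sum>r\<in>R p. (b * (1 - real d * real (D p) / real N) / real p - 1) * ln (real p))"
    unfolding P_def using fin finR by (subst sum.Sigma) (auto simp: case_prod_beta)
  \<comment> \<open>Every \<open>p\<close> has \<open>d\<close> roots; this factor cancels the
    \<open>d\<close> in \<open>M\<close> and so produces the density \<open>1 / d\<close>.\<close>
  also have "\<dots> = real d * (\<Sum>p\<in>S. (b * (1 - real d * real (D p) / real N) / real p - 1) * ln (real p))"
    using R by (simp add: sum_distrib_left)
  finally have "real d * (\<Sum>p\<in>S. (b * (1 - real d * real (D p) / real N) / real p - 1) * ln (real p)) \<le>
      real d * (b * ln (2 * real C * real N + 1))"
    by (simp add: M_def mult.left_commute)
  then have "(\<Sum>p\<in>S. (b * (1 - real d * real (D p) / real N) / real p - 1) * ln (real p)) \<le> b * ln (2 * real C * real N + 1)"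
    using dpos by simp
  moreover have "(b * (1 - real d * real (D p) / real N) / real p - 1) * ln (real p) =
     b * (ln (real p) / real p) - b * (real d / 2 ^ J) * (ln (real p) / real p * 2 ^ j p) - ln (real p)" for p
  proof -
    have "real (D p) / real N = 2 ^ j p / 2 ^ J" using C by (simp add: D_def N_def)
    then have "real d * real (D p) / real N = real d * (2 ^ j p / 2 ^ J)" by (metis times_divide_eq_right)
    then show ?thesis by (simp add: algebra_simps diff_divide_distrib)
  qed
  ultimately have "b * (\<Sum>p\<in>S. ln (real p) / real p) - b * (real d / 2 ^ J) * (\<Sum>p\<in>S. ln (real p) / real p * 2 ^ j p)
      - (\<Sum>p\<in>S. ln (real p)) \<le> b * ln (2 * real C * real N + 1)"
    by (simp only: sum_subtractf sum_distrib_left)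
  \<comment> \<open>The cost of leaving out the zero polynomial: Chebyshev's bound suffices, since
    the primes are at most \<open>2 ^ (J * d)\<close> and this is at most the size \<open>b\<close>
    of the box.\<close>
  moreover have "(\<Sum>p\<in>S. ln (real p)) \<le> b * ln 4"
  proof -
    have "(\<Sum>p\<in>S. ln (real p)) \<le> (\<Sum>p | prime p \<and> p \<le> 2 ^ (J * d). ln (real p))"
    proof (rule sum_mono2)
      show "finite {p::nat. prime p \<and> p \<le> 2 ^ (J * d)}"
        by (rule finite_subset[of _ "{..2 ^ (J * d)}"]) auto
      show "S \<subseteq> {p. prime p \<and> p \<le> 2 ^ (J * d)}" using S Y by auto
      fix p :: nat assume "p \<in> {p. prime p \<and> p \<le> 2 ^ (J * d)} - S"
      then show "0 \<le> ln (real p)" using prime_gt_1_nat[of p] by (simp add: ln_ge_zero)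
    qed
    also have "\<dots> \<le> real (2 ^ (J * d)) * ln 4" by (rule sum_ln_primes_le)
    also have "\<dots> \<le> b * ln 4"
    proof (rule mult_right_mono)
      have "(2 ^ J) ^ d \<le> (2 * N + 1) ^ d"
      proof (rule power_mono)
        have "2 ^ J \<le> N" unfolding N_def using C by simp
        then show "2 ^ J \<le> 2 * N + 1" by linarith
      qed simp
      then have "real (2 ^ (J * d)) \<le> real ((2 * N + 1) ^ d)"
        by (simp only: power_mult of_nat_le_iff)
      then show "real (2 ^ (J * d)) \<le> b"
        unfolding b_def by (simp only: of_nat_power)
    qed simp
    finally show ?thesis .
  qed
  moreover have "b * (real d / 2 ^ J) * (\<Sum>p\<in>S. ln (real p) / real p * 2 ^ j p) \<le> b * (real d * (2 * (2 ^ d * ln 4)))"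
  proof -
    have "(real d / 2 ^ J) * (\<Sum>p\<in>S. ln (real p) / real p * 2 ^ j p) \<le> (real d / 2 ^ J) * (2 ^ (J + 1) * (2 ^ d * ln 4))"
    proof (rule mult_left_mono)
      show "(\<Sum>p\<in>S. ln (real p) / real p * 2 ^ j p) \<le> 2 ^ (J + 1) * (2 ^ d * ln 4)"
        unfolding j_def by (rule dyadic_sum_le[OF S Y fin])
    qed simp
    also have "\<dots> = real d * (2 * (2 ^ d * ln 4))" by simp
    finally have "b * ((real d / 2 ^ J) * (\<Sum>p\<in>S. ln (real p) / real p * 2 ^ j p)) \<le> b * (real d * (2 * (2 ^ d * ln 4)))"
      by (rule mult_left_mono) (use b in simp)
    then show ?thesis by (simp only: mult.assoc)
  qed
  ultimately have "b * (\<Sum>p\<in>S. ln (real p) / real p) \<le> b * ln (2 * real C * real N + 1) + b * ln 4 + b * (real d * (2 * (2 ^ d * ln 4)))"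
    by linarith
  then have "b * (\<Sum>p\<in>S. ln (real p) / real p) \<le> b * (ln (2 * real C * real N + 1) + ln 4 + real d * (2 * (2 ^ d * ln 4)))"
    by (simp only: distrib_left)
  then have "(\<Sum>p\<in>S. ln (real p) / real p) \<le> ln (2 * real C * real N + 1) + ln 4 + real d * (2 * (2 ^ d * ln 4))"
    using b by (simp only: mult_le_cancel_left_pos)
  \<comment> \<open>\<open>C\<close> enters once through \<open>N\<close> and once through the
    product bound, whence its square.\<close>
  also have "ln (2 * real C * real N + 1) \<le> ln (3 * real C ^ 2 * 2 ^ J)"
  proof (rule ln_mono)
    have "1 * 1 \<le> real C * real N" using C N by (intro mult_mono) auto
    moreover have "3 * real C ^ 2 * 2 ^ J = 3 * (real C * real N)" by (simp add: N_def power2_eq_square)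
    ultimately show "2 * real C * real N + 1 \<le> 3 * real C ^ 2 * 2 ^ J" by linarith
    show "0 < 2 * real C * real N + 1" by (simp add: add_nonneg_pos)
  qed
  also have "\<dots> = ln (3 * real C ^ 2) + real J * ln 2"
    using C by (subst ln_mult) (auto simp: ln_realpow)
  finally show ?thesis by (simp add: C_def)
qed

end

section \<open>Integers whose simple prime factors lie in a given set\<close>

lemma sum_powers_le:
  fixes x :: real
  assumes "0 \<le> x" "x \<le> 1 / 2"
  shows "(\<Sum>k\<in>{2..K}. x ^ k) \<le> 2 * x ^ 2" "(\<Sum>k\<in>{2..K}. real k * x ^ k) \<le> 6 * x ^ 2"
proof -
  \<comment> \<open>The subtracted tail makes the induction work: as \<open>2 * x \<le> 1\<close>,
    it decreases at each step by at least the new summand.\<close>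
  have "(\<Sum>k\<in>{2..Suc n}. x ^ k) \<le> 2 * x ^ 2 - 2 * x ^ (n + 2)" for n
  proof (induction n)
    case (Suc n)
    have "(2 * x) * x ^ (n + 2) \<le> 1 * x ^ (n + 2)" using assms by (intro mult_right_mono) auto
    moreover have "2 * x ^ (Suc n + 2) = (2 * x) * x ^ (n + 2)" by simp
    moreover have "(\<Sum>k\<in>{2..Suc (Suc n)}. x ^ k) = (\<Sum>k\<in>{2..Suc n}. x ^ k) + x ^ (n + 2)" by simp
    ultimately show ?case using Suc by linarith
  qed (simp add: power2_eq_square)
  moreover have "0 \<le> x ^ (n + 2)" for n using assms by simp
  ultimately have 1: "(\<Sum>k\<in>{2..Suc n}. x ^ k) \<le> 2 * x ^ 2" for n by (smt (verit, best))
  have "(\<Sum>k\<in>{2..Suc n}. real k * x ^ k) \<le> 6 * x ^ 2 - 2 * (real n + 3) * x ^ (n + 2)" for n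
  proof (induction n)
    case (Suc n)
    have "(2 * x) * ((real n + 4) * x ^ (n + 2)) \<le> 1 * ((real n + 4) * x ^ (n + 2))" using assms by (intro mult_right_mono) auto
    moreover have "2 * (real (Suc n) + 3) * x ^ (Suc n + 2) = (2 * x) * ((real n + 4) * x ^ (n + 2))" by (simp add: algebra_simps)
    moreover have "(\<Sum>k\<in>{2..Suc (Suc n)}. real k * x ^ k) = (\<Sum>k\<in>{2..Suc n}. real k * x ^ k) + real (n + 2) * x ^ (n + 2)" by simp
    moreover have "2 * (real n + 3) * x ^ (n + 2) = (real n + 4) * x ^ (n + 2) + real (n + 2) * x ^ (n + 2)"
      by (simp add: algebra_simps)
    ultimately show ?case using Suc by linarith
  qed (simp add: power2_eq_square)
  moreover have "0 \<le> 2 * (real n + 3) * x ^ (n + 2)" for n using assms by simp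
  ultimately have 2: "(\<Sum>k\<in>{2..Suc n}. real k * x ^ k) \<le> 6 * x ^ 2" for n by (smt (verit, best))
  show "(\<Sum>k\<in>{2..K}. x ^ k) \<le> 2 * x ^ 2" using 1[of "K - 1"] by (cases K) auto
  show "(\<Sum>k\<in>{2..K}. real k * x ^ k) \<le> 6 * x ^ 2" using 2[of "K - 1"] by (cases K) auto
qed

text \<open>Partial summation in the form of an induction: a step costs the partial sum times
  \<open>1 / u - 1 / v\<close> for consecutive logarithms \<open>u\<close> and \<open>v\<close>, and
  \<open>1 - u / v \<le> ln v - ln u\<close> lets the main part telescope to a double
  logarithm.\<close>

lemma Abel_sum_inverse_ln:
  fixes c :: "nat \<Rightarrow> real" and a K :: real
  assumes a: "a \<ge> 0" "K \<ge> 0"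
    and bound: "\<And>n. n \<ge> 2 \<Longrightarrow> (\<Sum>k\<in>{2..n}. c k) \<le> a * ln n + K"
    and "n \<ge> 2"
  shows "(\<Sum>k\<in>{2..n}. c k / ln k) \<le>
     (\<Sum>k\<in>{2..n}. c k) / ln n + a * (ln (ln n) - ln (ln 2)) + K * (1 / ln 2 - 1 / ln n)"
  using \<open>n \<ge> 2\<close>
proof (induction n rule: nat_induct_at_least)
  case base
  then show ?case by simp
next
  case (Suc n)
  define P where "P = (\<Sum>k\<in>{2..n}. c k)"
  define u v where uv: "u = ln (real n)" "v = ln (real (Suc n))"
  have u: "0 < u" "u < v" using Suc by (auto simp: uv)
  have IH: "(\<Sum>k\<in>{2..n}. c k / ln k) \<le> P / u + a * (ln u - ln (ln 2)) + K * (1 / ln 2 - 1 / u)"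
    using Suc by (simp add: P_def uv)
  have S: "(\<Sum>k\<in>{2..Suc n}. c k / ln k) = (\<Sum>k\<in>{2..n}. c k / ln k) + c (Suc n) / v"
    "(\<Sum>k\<in>{2..Suc n}. c k) = P + c (Suc n)"
    using Suc by (simp_all add: P_def uv)
  have d: "0 \<le> 1 / u - 1 / v" using u by (simp add: frac_le)
  have "P * (1 / u - 1 / v) \<le> (a * u + K) * (1 / u - 1 / v)"
    using bound[OF Suc(1)] d unfolding P_def uv by (rule mult_right_mono)
  also have "\<dots> = a * (1 - u / v) + K * (1 / u - 1 / v)"
    using u by (simp add: field_simps)
  also have "1 - u / v \<le> ln v - ln u"
  proof -
    have "ln (u / v) \<le> u / v - 1" using u by (intro ln_le_minus_one) simp
    then show ?thesis using u by (simp add: ln_div)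
  qed
  finally have "P * (1 / u - 1 / v) \<le> a * (ln v - ln u) + K * (1 / u - 1 / v)"
    using a by (simp add: mult_left_mono)
  then have "P / u \<le> P / v + a * (ln v - ln u) + K * (1 / u - 1 / v)"
    by (simp add: right_diff_distrib)
  with IH have "(\<Sum>k\<in>{2..n}. c k / ln k) + c (Suc n) / v \<le>
     P / v + c (Suc n) / v + a * (ln v - ln (ln 2)) + K * (1 / ln 2 - 1 / v)"
    by (simp add: right_diff_distrib)
  then show ?case unfolding S uv[symmetric] by (simp add: add_divide_distrib)
qed

lemma sum_inverse_primes_le:
  fixes S :: "nat set" and d :: nat
  assumes d: "d > 0" and S: "\<And>p. p \<in> S \<Longrightarrow> prime p"
    and bound: "\<And>J. (\<Sum>p\<in>{p \<in> S. p \<le> 2 ^ (J * d)}. ln (real p) / real p) \<le> real J * ln 2 + C0"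
  shows "\<exists>C. \<forall>n\<ge>2. (\<Sum>p\<in>{p \<in> S. p \<le> n}. 1 / real p) \<le> ln (ln (real n)) / real d + C"
proof -
  define c where "c k = (if k \<in> S then ln (real k) / real k else 0)" for k
  have sumS: "(\<Sum>p\<in>{p \<in> S. p \<le> n}. h p) = (\<Sum>k\<in>{2..n}. if k \<in> S then h k else 0)" for h :: "nat \<Rightarrow> real" and n
  proof -
    have "{p \<in> S. p \<le> n} = {2..n} \<inter> S" using S prime_ge_2_nat by auto
    then show ?thesis by (simp add: sum.inter_restrict)
  qed
  \<comment> \<open>\<open>ln 2\<close> pays for rounding \<open>n\<close> up to the next
    \<open>2 ^ (J * d)\<close>; the maximum makes \<open>K\<close> nonnegative, as partial summation
    requires.\<close>
  define K where "K = ln 2 + max C0 0"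
  have b: "(\<Sum>k\<in>{2..n}. c k) \<le> (1 / real d) * ln (real n) + K" if n: "n \<ge> 2" for n
  proof -
    define J where "J = (LEAST J. n \<le> 2 ^ (J * d))"
    have "n \<le> 2 ^ (n * d)"
    proof -
      have "n < 2 ^ n" by simp
      also have "(2::nat) ^ n \<le> 2 ^ (n * d)" using d by (intro power_increasing) auto
      finally show ?thesis by simp
    qed
    then have J: "n \<le> 2 ^ (J * d)" unfolding J_def by (rule LeastI)
    then have J0: "J > 0" using n by (cases J) auto
    have "\<not> n \<le> 2 ^ ((J - 1) * d)" using J0 not_less_Least[of "J - 1" "\<lambda>J. n \<le> 2 ^ (J * d)"] by (simp add: J_def)
    then have "real (2 ^ ((J - 1) * d)) \<le> real n" by (simp only: of_nat_le_iff not_le less_imp_le)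
    then have "ln (real (2 ^ ((J - 1) * d))) \<le> ln (real n)" by (intro ln_mono) auto
    then have "real (J - 1) * real d * ln 2 \<le> ln (real n)" by (simp add: ln_realpow)
    then have "real (J - 1) * ln 2 \<le> ln (real n) / real d" using d by (simp add: pos_le_divide_eq mult_ac)
    then have J2: "real J * ln 2 \<le> ln (real n) / real d + ln 2" using J0 by (simp add: of_nat_diff left_diff_distrib)
    have "(\<Sum>k\<in>{2..n}. c k) = (\<Sum>p\<in>{p \<in> S. p \<le> n}. ln (real p) / real p)"
      unfolding sumS c_def ..
    also have "\<dots> \<le> (\<Sum>p\<in>{p \<in> S. p \<le> 2 ^ (J * d)}. ln (real p) / real p)"
    proof (rule sum_mono2)
      show "finite {p \<in> S. p \<le> 2 ^ (J * d)}" by (rule finite_subset[of _ "{..2 ^ (J * d)}"]) auto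
      show "{p \<in> S. p \<le> n} \<subseteq> {p \<in> S. p \<le> 2 ^ (J * d)}" using J by auto
      fix p assume "p \<in> {p \<in> S. p \<le> 2 ^ (J * d)} - {p \<in> S. p \<le> n}"
      then have "1 < p" using prime_gt_1_nat[OF S] by blast
      then show "0 \<le> ln (real p) / real p" by (simp add: ln_ge_zero)
    qed
    also have "\<dots> \<le> real J * ln 2 + C0" by (rule bound)
    finally show ?thesis using J2 by (simp add: K_def)
  qed
  have K0: "K \<ge> 0" by (simp add: K_def)
  define C where "C = 1 / real d + K / ln 2 - ln (ln 2) / real d + K / ln 2"
  have "(\<Sum>p\<in>{p \<in> S. p \<le> n}. 1 / real p) \<le> ln (ln (real n)) / real d + C" if n: "n \<ge> 2" for n
  proof -
    have "(\<Sum>p\<in>{p \<in> S. p \<le> n}. 1 / real p) = (\<Sum>k\<in>{2..n}. c k / ln k)"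
      unfolding sumS c_def by (intro sum.cong) auto
    also have "\<dots> \<le> (\<Sum>k\<in>{2..n}. c k) / ln n + (1 / real d) * (ln (ln n) - ln (ln 2)) + K * (1 / ln 2 - 1 / ln n)"
      by (rule Abel_sum_inverse_ln[OF _ K0 b n]) auto
    also have "\<dots> \<le> (1 / real d + K / ln 2) + (1 / real d) * (ln (ln n) - ln (ln 2)) + K / ln 2"
    proof (intro add_mono order.refl)
      have ln2: "ln 2 \<le> ln (real n)" "0 < ln (real n)" using n by auto
      have "(\<Sum>k\<in>{2..n}. c k) / ln n \<le> ((1 / real d) * ln (real n) + K) / ln n"
        using b[OF n] ln2 by (intro divide_right_mono) auto
      also have "\<dots> = 1 / real d + K / ln n" using ln2 by (simp add: add_divide_distrib)
      also have "\<dots> \<le> 1 / real d + K / ln 2" using ln2 K0 by (intro add_left_mono divide_left_mono mult_pos_pos) auto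
      finally show "(\<Sum>k\<in>{2..n}. c k) / ln n \<le> 1 / real d + K / ln 2" .
      show "K * (1 / ln 2 - 1 / ln n) \<le> K / ln 2" using ln2 K0 by (simp add: right_diff_distrib)
    qed
    also have "\<dots> = ln (ln (real n)) / real d + C" by (simp add: C_def diff_divide_distrib)
    finally show ?thesis .
  qed
  then show ?thesis by blast
qed

text \<open>Only primes of multiplicity one are constrained, because the residue field of order
  \<open>p\<close> is constructed for these alone; the others contribute a convergent factor to the
  Euler product.\<close>

definition simple_primes_in :: "nat set \<Rightarrow> nat set" where
  "simple_primes_in S = {n. n > 0 \<and> (\<forall>p. prime p \<longrightarrow> multiplicity p n = 1 \<longrightarrow> p \<in> S)}"

lemma simple_primes_in_split:
  assumes n: "n \<in> simple_primes_in S" and p: "prime p"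
  shows "n div p ^ multiplicity p n * p ^ multiplicity p n = n"
    "n div p ^ multiplicity p n \<in> simple_primes_in S" "\<not> p dvd n div p ^ multiplicity p n"
proof -
  have n0: "n > 0" using n by (simp add: simple_primes_in_def)
  define m where "m = n div p ^ multiplicity p n"
  show eq: "n div p ^ multiplicity p n * p ^ multiplicity p n = n"
    by (rule dvd_div_mult_self) (rule multiplicity_dvd)
  then have m0: "m > 0" using n0 by (metis gr0I m_def mult_0)
  show nd: "\<not> p dvd n div p ^ multiplicity p n"
    using n0 p by (intro multiplicity_decompose) (auto dest: prime_gt_1_nat)
  have "q \<in> S" if q: "prime q" "multiplicity q m = 1" for q
  proof -
    have "q \<noteq> p" using nd q(2) by (metis m_def not_dvd_imp_multiplicity_0 zero_neq_one)
    have "multiplicity q n = multiplicity q (m * p ^ multiplicity p n)" using eq by (simp add: m_def)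
    also have "\<dots> = multiplicity q m + multiplicity q (p ^ multiplicity p n)"
      using q(1) m0 p by (intro prime_elem_multiplicity_mult_distrib) (auto dest: prime_gt_0_nat)
    also have "multiplicity q (p ^ multiplicity p n) = 0"
      using q(1) p \<open>q \<noteq> p\<close> by (rule multiplicity_distinct_prime_power)
    finally have "multiplicity q n = 1" using q(2) by simp
    then show ?thesis using n q(1) by (simp add: simple_primes_in_def)
  qed
  with m0 show "n div p ^ multiplicity p n \<in> simple_primes_in S"
    by (simp add: simple_primes_in_def m_def)
qed

text \<open>The power of one prime \<open>p\<close> is split off at a time: exponent
  \<open>0\<close> gives \<open>1\<close>, exponent \<open>1\<close> occurs only if
  \<open>p \<in> S\<close>, and the exponents from \<open>2\<close> on sum to at most
  \<open>2 / p ^ 2\<close>.\<close>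

lemma Euler_product_le:
  assumes "finite P" "\<And>p. p \<in> P \<Longrightarrow> prime p" "finite F" "F \<subseteq> simple_primes_in S"
    "\<And>m q. m \<in> F \<Longrightarrow> prime q \<Longrightarrow> q dvd m \<Longrightarrow> q \<in> P"
  shows "(\<Sum>m\<in>F. 1 / real m) \<le> (\<Prod>p\<in>P. 1 + ((if p \<in> S then 1 / real p else 0) + 2 / real p ^ 2))"
  using assms
proof (induction P arbitrary: F rule: finite_induct)
  case empty
  have "F \<subseteq> {1}"
  proof
    fix m assume m: "m \<in> F"
    have "m = 1" using empty.prems(4)[OF m] prime_factor_nat[of m] by blast
    then show "m \<in> {1}" by simp
  qed
  then have "(\<Sum>m\<in>F. 1 / real m) \<le> (\<Sum>m\<in>{1}. 1 / real m)" by (intro sum_mono2) auto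
  then show ?case by simp
next
  case (insert p P)
  have p: "prime p" using insert.prems(1) by blast
  then have p2: "p \<ge> 2" by (rule prime_ge_2_nat)
  define x where "x = 1 / real p"
  have x: "0 \<le> x" "x \<le> 1 / 2" using p2 by (auto simp: x_def)
  define f v where fv: "f m = m div p ^ multiplicity p m" "v m = multiplicity p m" for m
  have split: "f m * p ^ v m = m" "f m \<in> simple_primes_in S" "\<not> p dvd f m" if "m \<in> F" for m
    using simple_primes_in_split[of m S p] insert.prems(3) p that by (auto simp: fv)
  have inj: "inj_on (\<lambda>m. (f m, v m)) F"
    by (rule inj_onI) (metis split(1) prod.inject)
  define K where "K = v ` F"
  have finK: "finite K" using insert.prems(2) by (simp add: K_def)
  have K1: "p \<in> S" if "1 \<in> K"
  proof -
    from that obtain m where "m \<in> F" "multiplicity p m = 1" by (auto simp: K_def fv)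
    then show ?thesis using insert.prems(3) p by (auto simp: simple_primes_in_def)
  qed
  have IH: "(\<Sum>m\<in>f ` F. 1 / real m) \<le> (\<Prod>p\<in>P. 1 + ((if p \<in> S then 1 / real p else 0) + 2 / real p ^ 2))"
  proof (rule insert.IH)
    show "finite (f ` F)" using insert.prems(2) by simp
    show "f ` F \<subseteq> simple_primes_in S" using split(2) by blast
    fix m q assume m: "m \<in> f ` F" "prime q" "q dvd m"
    then obtain n where n: "n \<in> F" "m = f n" by blast
    then have "q dvd n" using split(1)[OF n(1)] m(3) by (metis dvd_mult2)
    then have "q \<in> insert p P" using insert.prems(4) n(1) m(2) by blast
    moreover have "q \<noteq> p" using split(3)[OF n(1)] m(3) n(2) by blast
    ultimately show "q \<in> P" by blast
  qed (use insert.prems(1) in blast)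
  have "(\<Sum>m\<in>F. 1 / real m) = (\<Sum>m\<in>F. 1 / real (f m) * x ^ v m)"
  proof (rule sum.cong[OF refl])
    fix m assume "m \<in> F"
    from split(1)[OF this] have "real m = real (f m) * real p ^ v m" by (metis of_nat_mult of_nat_power)
    then show "1 / real m = 1 / real (f m) * x ^ v m" by (simp add: x_def power_one_over)
  qed
  also have "\<dots> = (\<Sum>(m, k)\<in>(\<lambda>m. (f m, v m)) ` F. 1 / real m * x ^ k)"
    by (simp add: sum.reindex[OF inj])
  also have "\<dots> \<le> (\<Sum>(m, k)\<in>(f ` F) \<times> K. 1 / real m * x ^ k)"
    using insert.prems(2) finK x by (intro sum_mono2) (auto simp: K_def)
  also have "\<dots> = (\<Sum>m\<in>f ` F. 1 / real m) * (\<Sum>k\<in>K. x ^ k)"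
    by (simp add: sum_product sum.cartesian_product)
  also have "\<dots> \<le> (\<Prod>p\<in>P. 1 + ((if p \<in> S then 1 / real p else 0) + 2 / real p ^ 2)) *
      (1 + ((if p \<in> S then 1 / real p else 0) + 2 / real p ^ 2))"
  proof (rule mult_mono[OF IH])
    show "(\<Sum>k\<in>K. x ^ k) \<le> 1 + ((if p \<in> S then 1 / real p else 0) + 2 / real p ^ 2)"
    proof -
      define M where "M = Max (insert 1 K)"
      have M: "k \<le> M" if "k \<in> K" for k using that finK by (simp add: M_def)
      have sub: "K \<subseteq> {0} \<union> (if p \<in> S then {1} else {}) \<union> {2..M}"
      proof
        fix k assume k: "k \<in> K"
        consider "k = 0" | "k = 1" | "k \<ge> 2" by linarith
        then show "k \<in> {0} \<union> (if p \<in> S then {1} else {}) \<union> {2..M}"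
          using K1 k M[OF k] by cases auto
      qed
      have "(\<Sum>k\<in>K. x ^ k) \<le> (\<Sum>k\<in>{0} \<union> (if p \<in> S then {1} else {}) \<union> {2..M}. x ^ k)"
        using sub x by (intro sum_mono2) auto
      also have "\<dots> = 1 + (if p \<in> S then x else 0) + (\<Sum>k\<in>{2..M}. x ^ k)"
        by (subst sum.union_disjoint) auto
      also have "\<dots> \<le> 1 + (if p \<in> S then x else 0) + 2 * x ^ 2"
        using sum_powers_le(1)[OF x] by simp
      finally show ?thesis by (cases "p \<in> S") (simp_all add: x_def power_one_over)
    qed
    show "0 \<le> (\<Prod>p\<in>P. 1 + ((if p \<in> S then 1 / real p else 0) + 2 / (real p)\<^sup>2))"
      by (intro prod_nonneg) auto
    show "0 \<le> (\<Sum>k\<in>K. x ^ k)" using x by (intro sum_nonneg) auto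
  qed
  finally show ?case using insert.hyps by (simp add: mult.commute)
qed

text \<open>Compared with the exponent \<open>2\<close>, the exponent \<open>3 / 2\<close> leaves
  room for a factor \<open>ln p \<le> 2 * sqrt p\<close>, so one constant serves both the Euler
  product and the logarithmic sum.\<close>

lemma summable_three_halves: "summable (\<lambda>n. 1 / real n powr (3 / 2))"
proof -
  have "summable (\<lambda>n. real n powr (- (3 / 2)))" by (subst summable_real_powr_iff) simp
  then show ?thesis by (simp only: powr_minus_divide)
qed

text \<open>By \<open>1 + a \<le> exp a\<close> the Euler product is at most the exponential of a
  sum over primes, and \<open>ln (ln n) / d\<close> in the exponent becomes \<open>ln n\<close> to
  the power \<open>1 / d\<close>.\<close>

lemma sum_inverse_simple_primes_le:
  fixes S :: "nat set" and d :: nat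
  assumes C: "\<And>n. n \<ge> 2 \<Longrightarrow> (\<Sum>p\<in>{p \<in> S. p \<le> n}. 1 / real p) \<le> ln (ln (real n)) / real d + C"
    and S: "\<And>p. p \<in> S \<Longrightarrow> prime p"
  defines "Z \<equiv> suminf (\<lambda>n::nat. 1 / real n powr (3 / 2))"
  assumes n: "n \<ge> 2"
  shows "(\<Sum>m\<in>{m \<in> simple_primes_in S. m \<le> n}. 1 / real m) \<le> exp (C + 2 * Z) * ln (real n) powr (1 / real d)"
proof -
  define P where "P = {p::nat. prime p \<and> p \<le> n}"
  have finP: "finite P" unfolding P_def by (rule finite_subset[of _ "{..n}"]) auto
  define a where "a p = (if p \<in> S then 1 / real p else 0) + 2 / real p ^ 2" for p
  have "(\<Sum>m\<in>{m \<in> simple_primes_in S. m \<le> n}. 1 / real m) \<le> (\<Prod>p\<in>P. 1 + a p)"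
    unfolding a_def
  proof (rule Euler_product_le[OF finP])
    show "finite {m \<in> simple_primes_in S. m \<le> n}" by (rule finite_subset[of _ "{..n}"]) auto
    fix m q assume "m \<in> {m \<in> simple_primes_in S. m \<le> n}" "prime q" "q dvd m"
    then have "m > 0" "m \<le> n" "q dvd m" by (auto simp: simple_primes_in_def)
    then have "q \<le> n" using dvd_imp_le[of q m] by linarith
    then show "q \<in> P" using \<open>prime q\<close> by (simp add: P_def)
  qed (auto simp: P_def)
  also have "\<dots> \<le> (\<Prod>p\<in>P. exp (a p))"
    by (intro prod_mono) (auto simp: a_def)
  also have "\<dots> = exp (\<Sum>p\<in>P. a p)" using finP by (simp add: exp_sum)
  also have "(\<Sum>p\<in>P. a p) \<le> ln (ln (real n)) / real d + C + 2 * Z"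
  proof -
    have "(\<Sum>p\<in>P. if p \<in> S then 1 / real p else 0) = (\<Sum>p\<in>{p \<in> S. p \<le> n}. 1 / real p)"
    proof -
      have "{p \<in> S. p \<le> n} = P \<inter> S" using S by (auto simp: P_def)
      then show ?thesis using finP by (simp add: sum.inter_restrict)
    qed
    moreover have "(\<Sum>p\<in>P. 2 / real p ^ 2) \<le> 2 * Z"
    proof -
      have "(\<Sum>p\<in>P. 2 / real p ^ 2) \<le> (\<Sum>p\<in>P. 2 * (1 / real p powr (3 / 2)))"
      proof (rule sum_mono)
        fix p assume "p \<in> P"
        then have "p \<ge> 2" by (auto simp: P_def prime_ge_2_nat)
        then have "real p powr (3 / 2) \<le> real p powr 2" by (intro powr_mono) auto
        also have "\<dots> = real p ^ 2" using \<open>p \<ge> 2\<close> by (simp add: powr_numeral)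
        finally have "2 / real p ^ 2 \<le> 2 / real p powr (3 / 2)"
          using \<open>p \<ge> 2\<close> by (intro divide_left_mono) auto
        then show "2 / real p ^ 2 \<le> 2 * (1 / real p powr (3 / 2))" by simp
      qed
      also have "\<dots> = 2 * (\<Sum>p\<in>P. 1 / real p powr (3 / 2))" by (simp only: sum_distrib_left)
      also have "(\<Sum>p\<in>P. 1 / real p powr (3 / 2)) \<le> Z"
        unfolding Z_def by (rule sum_le_suminf[OF summable_three_halves finP]) auto
      finally show ?thesis by simp
    qed
    ultimately show ?thesis using C[OF n] by (simp add: a_def sum.distrib)
  qed
  also have "exp (ln (ln (real n)) / real d + C + 2 * Z) = exp (C + 2 * Z) * ln (real n) powr (1 / real d)"
    using n by (simp add: powr_def exp_add mult_ac)
  finally show ?thesis by simp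
qed

lemma ln_le_2_sqrt:
  assumes "x > (0::real)"
  shows "ln x \<le> 2 * sqrt x"
proof -
  have "ln (sqrt x) \<le> sqrt x - 1" using assms by (intro ln_le_minus_one) simp
  then show ?thesis using assms by (simp add: ln_sqrt)
qed

lemma ln_eq_sum_multiplicity:
  assumes "n > 0"
  shows "ln (real n) = (\<Sum>p\<in>prime_factors n. real (multiplicity p n) * ln (real p))"
proof -
  have "real n = (\<Prod>p\<in>prime_factors n. real p ^ multiplicity p n)"
    using arg_cong[OF prime_factorization_nat[OF assms], of real] by simp
  then have "ln (real n) = ln (\<Prod>p\<in>prime_factors n. real p ^ multiplicity p n)" by (rule arg_cong)
  also have "\<dots> = (\<Sum>p\<in>prime_factors n. ln (real p ^ multiplicity p n))"
    by (rule ln_prod) (auto dest: in_prime_factors_imp_prime prime_gt_0_nat)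
  also have "\<dots> = (\<Sum>p\<in>prime_factors n. real (multiplicity p n) * ln (real p))"
    by (rule sum.cong[OF refl]) (simp add: ln_realpow in_prime_factors_imp_prime prime_gt_0_nat)
  finally show ?thesis .
qed

text \<open>Write \<open>n = m p\<^sup>k\<close> with \<open>p\<close> not dividing \<open>m\<close> for each prime factor \<open>p\<close> of \<open>n\<close>. The terms with
  \<open>k = 1\<close> are controlled by Chebyshev's bound, those with \<open>k \<ge> 2\<close> by \<open>1 \<le> x / (m p\<^sup>k)\<close>.\<close>

lemma sum_ln_simple_primes_le:
  fixes x :: real and S :: "nat set"
  defines "B \<equiv> {n \<in> simple_primes_in S. real n \<le> x}"
    and "Z \<equiv> suminf (\<lambda>n::nat. 1 / real n powr (3 / 2))"
  assumes x: "x \<ge> 1"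
  shows "(\<Sum>n\<in>B. ln (real n)) \<le> (ln 4 + 12 * Z) * x * (\<Sum>m\<in>B. 1 / real m)"
proof -
  define N where "N = nat \<lfloor>x\<rfloor>"
  have le_N: "n \<le> N \<longleftrightarrow> real n \<le> x" for n using x by (simp add: N_def le_nat_iff le_floor_iff)
  have finB: "finite B" unfolding B_def by (rule finite_subset[of _ "{..N}"]) (auto simp: le_N)
  have Bpos: "n > 0" if "n \<in> B" for n using that by (simp add: B_def simple_primes_in_def)
  define P where "P = {p::nat. prime p \<and> p \<le> N}"
  have finP: "finite P" unfolding P_def by (rule finite_subset[of _ "{..N}"]) auto
  have Pge: "p \<ge> 2" if "p \<in> P" for p using that by (simp add: P_def prime_ge_2_nat)
  define T where "T = (SIGMA n:B. prime_factors n)"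
  have finT: "finite T" unfolding T_def using finB by (intro finite_SigmaI) auto
  define \<phi> where "\<phi> = (\<lambda>(n::nat, p::nat). (n div p ^ multiplicity p n, p, multiplicity p n))"
  have \<phi>: "(m, p, k) \<in> (B \<times> P \<times> {1..N}) \<and> m * p ^ k \<le> N \<and> n = m * p ^ k"
    if "(n, p) \<in> T" "\<phi> (n, p) = (m, p', k)" "p' = p" for n p m p' k
  proof -
    have n: "n \<in> B" "prime p" "p dvd n" using that(1) by (auto simp: T_def)
    have mk: "m = n div p ^ multiplicity p n" "k = multiplicity p n" using that(2) by (auto simp: \<phi>_def)
    have nS: "n \<in> simple_primes_in S" using n(1) by (simp add: B_def)
    note sp = simple_primes_in_split[OF nS n(2)]
    have eq: "n = m * p ^ k" using sp(1) mk by simp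
    have nN: "n \<le> N" using n(1) by (simp add: B_def le_N)
    have n0: "n > 0" using Bpos n(1) by blast
    have "p > 1" using n(2) by (rule prime_gt_1_nat)
    have "m \<le> n" unfolding mk by simp
    then have "m \<le> N" using nN by simp
    then have "m \<in> B" using sp(2) unfolding mk(1) by (simp add: B_def flip: le_N)
    moreover have "p \<le> N" using dvd_imp_le[OF n(3) n0] nN by simp
    moreover have k1: "1 \<le> k" using n n0 \<open>p > 1\<close> by (simp add: mk Suc_le_eq prime_multiplicity_gt_zero_iff)
    moreover have "k \<le> N"
    proof -
      have "k < p ^ k" using \<open>p > 1\<close> by (intro power_gt_expt) simp
      also have "p ^ k \<le> n" using n0 by (intro dvd_imp_le) (simp_all add: eq)
      finally show ?thesis using nN by simp
    qed
    ultimately show ?thesis using n(2) eq nN by (simp add: P_def)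
  qed
  have inj: "inj_on \<phi> T"
  proof (rule inj_onI)
    fix a b assume ab: "a \<in> T" "b \<in> T" "\<phi> a = \<phi> b"
    obtain n p n' p' where ab': "a = (n, p)" "b = (n', p')" by (cases a, cases b)
    obtain m k where mk: "\<phi> (n, p) = (m, p, k)" by (simp add: \<phi>_def)
    obtain m' k' where mk': "\<phi> (n', p') = (m', p', k')" by (simp add: \<phi>_def)
    have "m = m'" "p = p'" "k = k'" using ab(3) mk mk' ab' by auto
    moreover have "n = m * p ^ k" "n' = m' * p' ^ k'"
      using \<phi>[OF _ mk refl] \<phi>[OF _ mk' refl] ab ab' by auto
    ultimately show "a = b" using ab' by simp
  qed
  \<comment> \<open>A majorant that depends on the triple alone and is nonnegative on all of
    \<open>B \<times> P \<times> {1..N}\<close>, so that the sum over the image of \<phi> may be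
    extended to the whole product.\<close>
  define g where "g = (\<lambda>(m, p, k). if k = 1 then (if m * p \<le> N then ln (real p) else 0)
     else x / real m * (ln (real p) * (real k * (1 / real p) ^ k)))"
  have g0: "0 \<le> g q" if "q \<in> B \<times> P \<times> {1..N}" for q
  proof -
    obtain m p k where q: "q = (m, p, k)" by (cases q)
    with that have "0 \<le> ln (real p)" using Pge[of p] by (simp add: ln_ge_zero)
    then show ?thesis using x q by (simp add: g_def)
  qed
  have "(\<Sum>n\<in>B. ln (real n)) = (\<Sum>n\<in>B. \<Sum>p\<in>prime_factors n. real (multiplicity p n) * ln (real p))"
    using Bpos by (intro sum.cong refl ln_eq_sum_multiplicity) auto
  also have "\<dots> = (\<Sum>(n, p)\<in>T. real (multiplicity p n) * ln (real p))"
    unfolding T_def using finB by (subst sum.Sigma) auto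
  also have "\<dots> \<le> (\<Sum>a\<in>T. g (\<phi> a))"
  proof (rule sum_mono)
    fix a assume a: "a \<in> T"
    obtain n p where np: "a = (n, p)" by (cases a)
    obtain m k where mk: "\<phi> (n, p) = (m, p, k)" "k = multiplicity p n" by (simp add: \<phi>_def)
    from \<phi>[OF _ mk(1) refl] a np have 1: "m \<in> B" "p \<in> P" "1 \<le> k" "m * p ^ k \<le> N" by auto
    have ln0: "0 \<le> ln (real p)" using Pge[OF 1(2)] by (simp add: ln_ge_zero)
    have "real k * ln (real p) \<le> g (m, p, k)"
    proof (cases "k = 1")
      case True
      then show ?thesis using 1 by (simp add: g_def)
    next
      case False
      have pos: "0 < real m * real p ^ k" using Bpos[OF 1(1)] Pge[OF 1(2)] by simp
      have "real (m * p ^ k) \<le> x" using 1(4) by (simp only: le_N)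
      then have "1 \<le> x / (real m * real p ^ k)" using pos by (simp add: pos_le_divide_eq)
      then have "1 * (real k * ln (real p)) \<le> x / (real m * real p ^ k) * (real k * ln (real p))"
        using ln0 by (intro mult_right_mono) auto
      also have "\<dots> = g (m, p, k)" using False by (simp add: g_def power_one_over)
      finally show ?thesis by simp
    qed
    then show "(case a of (n, p) \<Rightarrow> real (multiplicity p n) * ln (real p)) \<le> g (\<phi> a)"
      using np mk by simp
  qed
  also have "\<dots> = (\<Sum>q\<in>\<phi> ` T. g q)" by (simp add: sum.reindex[OF inj])
  also have "\<dots> \<le> (\<Sum>q\<in>B \<times> P \<times> {1..N}. g q)"
  proof (rule sum_mono2)
    show "\<phi> ` T \<subseteq> B \<times> P \<times> {1..N}"
    proof
      fix q assume "q \<in> \<phi> ` T"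
      then obtain n p where np: "(n, p) \<in> T" "q = \<phi> (n, p)" by auto
      obtain m k where mk: "\<phi> (n, p) = (m, p, k)" by (simp add: \<phi>_def)
      from \<phi>[OF np(1) mk refl] np(2) mk show "q \<in> B \<times> P \<times> {1..N}" by simp
    qed
  qed (use finB finP g0 in auto)
  also have "\<dots> = (\<Sum>m\<in>B. \<Sum>p\<in>P. \<Sum>k\<in>{1..N}. g (m, p, k))"
    by (simp add: sum.cartesian_product)
  also have "\<dots> \<le> (\<Sum>m\<in>B. (ln 4 + 12 * Z) * x * (1 / real m))"
  proof (rule sum_mono)
    fix m assume m: "m \<in> B"
    have m0: "m > 0" using Bpos[OF m] .
    have xm: "0 \<le> x / real m" using x by simp
    \<comment> \<open>The \<open>12\<close> is the \<open>6\<close> of the power sum times the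
      \<open>2\<close> of \<open>ln p \<le> 2 * sqrt p\<close>.\<close>
    have inner: "(\<Sum>k\<in>{1..N}. g (m, p, k)) \<le> (if m * p \<le> N then ln (real p) else 0) + x / real m * (12 * (1 / real p powr (3 / 2)))"
      if p: "p \<in> P" for p
    proof -
      have p2: "p \<ge> 2" "p \<le> N" using Pge[OF p] p by (auto simp: P_def)
      have "{1..N} = insert 1 {2..N}" using p2 by auto
      then have "(\<Sum>k\<in>{1..N}. g (m, p, k)) = g (m, p, 1) + (\<Sum>k\<in>{2..N}. g (m, p, k))" by simp
      also have "(\<Sum>k\<in>{2..N}. g (m, p, k)) = (\<Sum>k\<in>{2..N}. x / real m * ln (real p) * (real k * (1 / real p) ^ k))"
        by (rule sum.cong[OF refl]) (simp add: g_def)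
      also have "\<dots> = x / real m * ln (real p) * (\<Sum>k\<in>{2..N}. real k * (1 / real p) ^ k)"
        by (simp only: sum_distrib_left)
      also have "\<dots> \<le> x / real m * ln (real p) * (6 * (1 / real p) ^ 2)"
      proof (rule mult_left_mono)
        show "(\<Sum>k\<in>{2..N}. real k * (1 / real p) ^ k) \<le> 6 * (1 / real p) ^ 2"
          using p2 by (intro sum_powers_le(2)) auto
        show "0 \<le> x / real m * ln (real p)" using xm p2 by (intro mult_nonneg_nonneg ln_ge_zero) auto
      qed
      also have "\<dots> \<le> x / real m * (12 * (1 / real p powr (3 / 2)))"
      proof -
        have "ln (real p) * (6 * (1 / real p) ^ 2) \<le> (2 * sqrt (real p)) * (6 * (1 / real p) ^ 2)"
          using p2 by (intro mult_right_mono ln_le_2_sqrt) auto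
        also have "\<dots> = 12 * (1 / real p powr (3 / 2))"
        proof -
          have "real p ^ 2 = real p powr (3 / 2) * real p powr (1 / 2)"
            using p2 by (simp add: powr_add[symmetric] powr_numeral)
          moreover have "sqrt (real p) = real p powr (1 / 2)" using p2 by (simp add: powr_half_sqrt)
          ultimately show ?thesis using p2 by (simp add: power_one_over)
        qed
        finally have "x / real m * (ln (real p) * (6 * (1 / real p) ^ 2)) \<le> x / real m * (12 * (1 / real p powr (3 / 2)))"
          using xm by (rule mult_left_mono)
        then show ?thesis by (simp only: mult.assoc)
      qed
      finally show ?thesis by (simp add: g_def)
    qed
    have "(\<Sum>p\<in>P. \<Sum>k\<in>{1..N}. g (m, p, k)) \<le>
        (\<Sum>p\<in>P. (if m * p \<le> N then ln (real p) else 0) + x / real m * (12 * (1 / real p powr (3 / 2))))"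
      using inner by (rule sum_mono)
    also have "\<dots> = (\<Sum>p\<in>P. if m * p \<le> N then ln (real p) else 0) + x / real m * (12 * (\<Sum>p\<in>P. 1 / real p powr (3 / 2)))"
      by (simp only: sum.distrib sum_distrib_left)
    also have "\<dots> \<le> x / real m * ln 4 + x / real m * (12 * Z)"
    proof (rule add_mono)
      define y where "y = N div m"
      have y: "m * p \<le> N \<longleftrightarrow> p \<le> y" for p
        using m0 by (simp add: y_def less_eq_div_iff_mult_less_eq mult.commute)
      have yN: "y \<le> N" by (simp add: y_def)
      have "{p. prime p \<and> p \<le> y} = P \<inter> {p. m * p \<le> N}" using y yN by (auto simp: P_def)
      then have "(\<Sum>p\<in>P. if m * p \<le> N then ln (real p) else 0) = (\<Sum>p | prime p \<and> p \<le> y. ln (real p))"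
        using finP by (simp add: sum.inter_restrict)
      also have "\<dots> \<le> real y * ln 4" by (rule sum_ln_primes_le)
      also have "\<dots> \<le> x / real m * ln 4"
      proof (rule mult_right_mono)
        have "m * y \<le> N" by (simp add: y_def)
        then have "real (m * y) \<le> x" by (simp only: le_N)
        then show "real y \<le> x / real m" using m0 by (simp add: pos_le_divide_eq mult.commute)
      qed simp
      finally show "(\<Sum>p\<in>P. if m * p \<le> N then ln (real p) else 0) \<le> x / real m * ln 4" .
      have "(\<Sum>p\<in>P. 1 / real p powr (3 / 2)) \<le> Z"
        unfolding Z_def by (rule sum_le_suminf[OF summable_three_halves finP]) auto
      then show "x / real m * (12 * (\<Sum>p\<in>P. 1 / real p powr (3 / 2))) \<le> x / real m * (12 * Z)"
        using xm by (intro mult_left_mono) auto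
    qed
    also have "\<dots> = (ln 4 + 12 * Z) * x * (1 / real m)"
      by (simp add: ring_distribs add_divide_distrib mult_ac)
    finally show "(\<Sum>p\<in>P. \<Sum>k\<in>{1..N}. g (m, p, k)) \<le> (ln 4 + 12 * Z) * x * (1 / real m)" .
  qed
  also have "\<dots> = (ln 4 + 12 * Z) * x * (\<Sum>m\<in>B. 1 / real m)"
    by (simp only: sum_distrib_left)
  finally show ?thesis .
qed

text \<open>Above \<open>sqrt x\<close> every \<open>ln n\<close> is at least
  \<open>ln x / 2\<close>, so dividing the weighted sum by \<open>ln x / 2\<close> bounds the count
  and turns the exponent \<open>1 / d\<close> of the logarithm into \<open>1 / d - 1\<close>; up to
  \<open>sqrt x\<close> the trivial count suffices.\<close>

lemma card_simple_primes_in_le: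
  fixes S :: "nat set" and d :: nat
  assumes d: "d > 0" and S: "\<And>p. p \<in> S \<Longrightarrow> prime p"
    and bound: "\<And>J. (\<Sum>p\<in>{p \<in> S. p \<le> 2 ^ (J * d)}. ln (real p) / real p) \<le> real J * ln 2 + C0"
  shows "\<exists>C\<ge>0. \<forall>x::real\<ge>3. real (card {n \<in> simple_primes_in S. real n \<le> x}) \<le> C * (x / ln x powr (1 - 1 / real d))"
proof -
  obtain C where C: "\<And>n. n \<ge> 2 \<Longrightarrow> (\<Sum>p\<in>{p \<in> S. p \<le> n}. 1 / real p) \<le> ln (ln (real n)) / real d + C"
    using sum_inverse_primes_le[OF d S bound] by blast
  define Z where "Z = suminf (\<lambda>n::nat. 1 / real n powr (3 / 2))"
  have Z: "Z \<ge> 0" unfolding Z_def by (rule suminf_nonneg[OF summable_three_halves]) auto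
  define E where "E = (ln 4 + 12 * Z) * exp (C + 2 * Z)"
  have E: "E \<ge> 0" unfolding E_def using Z by (intro mult_nonneg_nonneg add_nonneg_nonneg) auto
  have "real (card {n \<in> simple_primes_in S. real n \<le> x}) \<le> (2 + 2 * E) * (x / ln x powr (1 - 1 / real d))"
    if x: "x \<ge> 3" for x :: real
  proof -
    define B where "B = {n \<in> simple_primes_in S. real n \<le> x}"
    define N where "N = nat \<lfloor>x\<rfloor>"
    have le_N: "n \<le> N \<longleftrightarrow> real n \<le> x" for n using x by (simp add: N_def le_nat_iff le_floor_iff)
    have finB: "finite B" unfolding B_def by (rule finite_subset[of _ "{..N}"]) (auto simp: le_N)
    have Bpos: "n > 0" if "n \<in> B" for n using that by (simp add: B_def simple_primes_in_def)
    have lnx: "ln x \<ge> 1"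
    proof -
      have "ln (exp 1) \<le> ln x" using x exp_le by (intro ln_mono) auto
      then show ?thesis by simp
    qed
    have "2 \<le> N" using x by (simp add: le_N)
    have "(\<Sum>m\<in>B. 1 / real m) \<le> exp (C + 2 * Z) * ln (real N) powr (1 / real d)"
      unfolding B_def Z_def le_N[symmetric] by (rule sum_inverse_simple_primes_le[OF C S \<open>2 \<le> N\<close>])
    also have "\<dots> \<le> exp (C + 2 * Z) * ln x powr (1 / real d)"
    proof (intro mult_left_mono powr_mono2)
      show "ln (real N) \<le> ln x" using \<open>2 \<le> N\<close> le_N[of N] by (intro ln_mono) auto
    qed (use \<open>2 \<le> N\<close> in auto)
    finally have H: "(\<Sum>m\<in>B. 1 / real m) \<le> exp (C + 2 * Z) * ln x powr (1 / real d)" .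
    have "(\<Sum>n\<in>B. ln (real n)) \<le> (ln 4 + 12 * Z) * x * (\<Sum>m\<in>B. 1 / real m)"
      unfolding B_def Z_def using x by (intro sum_ln_simple_primes_le) auto
    also have "\<dots> \<le> (ln 4 + 12 * Z) * x * (exp (C + 2 * Z) * ln x powr (1 / real d))"
      using x Z by (intro mult_left_mono[OF H] mult_nonneg_nonneg add_nonneg_nonneg) auto
    also have "\<dots> = E * x * ln x powr (1 / real d)" by (simp add: E_def)
    finally have L: "(\<Sum>n\<in>B. ln (real n)) \<le> E * x * ln x powr (1 / real d)" .
    define B1 B2 where "B1 = {n \<in> B. real n \<le> sqrt x}" and "B2 = {n \<in> B. \<not> real n \<le> sqrt x}"
    have "B = B1 \<union> B2" "B1 \<inter> B2 = {}" by (auto simp: B1_def B2_def)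
    then have cardB: "card B = card B1 + card B2" using finB by (metis card_Un_disjoint finite_Un)
    have "B1 \<subseteq> {1..nat \<lfloor>sqrt x\<rfloor>}"
      using Bpos by (auto simp: B1_def Suc_le_eq intro!: le_nat_floor)
    then have "card B1 \<le> nat \<lfloor>sqrt x\<rfloor>" using card_mono[of "{1..nat \<lfloor>sqrt x\<rfloor>}" B1] by simp
    then have c1: "real (card B1) \<le> sqrt x"
      using x by (meson of_nat_floor of_nat_mono order_trans real_sqrt_ge_zero le_numeral_extra(3) zero_le_numeral)
    have "real (card B2) * (ln x / 2) = (\<Sum>n\<in>B2. ln x / 2)" by simp
    also have "\<dots> \<le> (\<Sum>n\<in>B2. ln (real n))"
    proof (rule sum_mono)
      fix n assume "n \<in> B2"
      then have "sqrt x \<le> real n" by (simp add: B2_def)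
      then have "ln (sqrt x) \<le> ln (real n)" using x by (intro ln_mono) auto
      then show "ln x / 2 \<le> ln (real n)" using x by (simp add: ln_sqrt)
    qed
    also have "\<dots> \<le> (\<Sum>n\<in>B. ln (real n))"
    proof (rule sum_mono2[OF finB])
      fix n assume "n \<in> B - B2"
      then have "n > 0" using Bpos by blast
      then show "0 \<le> ln (real n)" by (simp add: ln_ge_zero)
    qed (auto simp: B2_def)
    also note L
    finally have "real (card B2) \<le> 2 * (E * x * ln x powr (1 / real d)) / ln x"
      using lnx by (simp add: pos_le_divide_eq)
    also have "\<dots> = 2 * E * (x / ln x powr (1 - 1 / real d))"
    proof -
      have "ln x powr (1 - 1 / real d) = ln x / ln x powr (1 / real d)"
        using lnx by (simp add: powr_diff)
      then show ?thesis using lnx by simp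
    qed
    finally have c2: "real (card B2) \<le> 2 * E * (x / ln x powr (1 - 1 / real d))" .
    have "sqrt x \<le> 2 * (x / ln x powr (1 - 1 / real d))"
    proof -
      have "ln x powr (1 - 1 / real d) \<le> ln x powr 1" using lnx by (intro powr_mono) auto
      also have "\<dots> = ln x" using lnx by simp
      also have "\<dots> \<le> 2 * sqrt x" using x by (intro ln_le_2_sqrt) auto
      finally have "sqrt x * ln x powr (1 - 1 / real d) \<le> sqrt x * (2 * sqrt x)"
        using x by (intro mult_left_mono) auto
      also have "\<dots> = 2 * x" using x by simp
      finally have "sqrt x \<le> 2 * x / ln x powr (1 - 1 / real d)"
        using lnx by (simp add: pos_le_divide_eq)
      then show ?thesis by simp
    qed
    with c1 c2 have "real (card B) \<le> 2 * (x / ln x powr (1 - 1 / real d)) + 2 * E * (x / ln x powr (1 - 1 / real d))"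
      unfolding cardB of_nat_add by linarith
    then show ?thesis unfolding B_def[symmetric] by (simp only: distrib_right)
  qed
  then show ?thesis using E by (intro exI[of _ "2 + 2 * E"]) auto
qed

section \<open>Algebraic integers\<close>

text \<open>The numbers \<open>w\<close> form an eigenvector, so \<open>x\<close> is a root of the
  characteristic polynomial of \<open>A\<close>, which is monic with integer coefficients.\<close>

lemma algebraic_int_integer_matrix:
  fixes w :: "'i \<Rightarrow> 'a::field_char_0" and A :: "'i \<Rightarrow> 'i \<Rightarrow> int"
  assumes fin: "finite I" and i0: "i0 \<in> I" "w i0 \<noteq> 0"
    and eq: "\<And>i. i \<in> I \<Longrightarrow> x * w i = (\<Sum>j\<in>I. of_int (A i j) * w j)"
  shows "algebraic_int x"
proof -
  define n where "n = card I"
  obtain h where h: "bij_betw h {..<n} I"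
    using ex_bij_betw_nat_finite[OF fin] by (auto simp: n_def atLeast0LessThan)
  define M where "M = Matrix.mat n n (\<lambda>(i, j). A (h i) (h j))"
  define v where "v = Matrix.vec n (\<lambda>i. w (h i))"
  have M: "M \<in> carrier_mat n n" by (simp add: M_def)
  have "eigenvector (map_mat of_int M) v x"
    unfolding eigenvector_def
  proof (intro conjI)
    show "v \<in> carrier_vec (dim_row (map_mat of_int M))" by (simp add: v_def M_def)
    obtain k where k: "k < n" "h k = i0" using h i0(1) by (auto simp: bij_betw_def)
    have "v $ k \<noteq> 0\<^sub>v n $ k" using k i0 by (simp add: v_def)
    then show "v \<noteq> 0\<^sub>v (dim_row (map_mat of_int M))" by (auto simp: M_def)
    show "map_mat of_int M *\<^sub>v v = x \<cdot>\<^sub>v v"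
    proof (rule eq_vecI)
      fix i assume "i < dim_vec (x \<cdot>\<^sub>v v)"
      then have i: "i < n" by (simp add: v_def)
      then have hi: "h i \<in> I" using h by (auto simp: bij_betw_def)
      have "(map_mat of_int M *\<^sub>v v) $ i = (\<Sum>j<n. of_int (A (h i) (h j)) * w (h j))"
        using i by (simp add: M_def v_def scalar_prod_def atLeast0LessThan)
      also have "\<dots> = (\<Sum>j\<in>I. of_int (A (h i) j) * w j)"
        by (rule sum.reindex_bij_betw[OF h])
      also have "\<dots> = x * w (h i)" using eq[OF hi] by simp
      finally show "(map_mat of_int M *\<^sub>v v) $ i = (x \<cdot>\<^sub>v v) $ i" using i by (simp add: v_def)
    qed (simp add: M_def v_def)
  qed
  then have "eigenvalue (map_mat of_int M) x" by (auto simp: eigenvalue_def)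
  then have "poly (char_poly (map_mat of_int M)) x = 0"
    using eigenvalue_root_char_poly[of "map_mat of_int M" n x] M by simp
  then have "poly (of_int_poly (char_poly M)) x = 0" by (simp add: of_int_hom.char_poly_hom[OF M])
  moreover have "lead_coeff (char_poly M) = 1" using degree_monic_char_poly[OF M] by simp
  ultimately show ?thesis unfolding algebraic_int_altdef_ipoly by blast
qed

text \<open>With \<open>a\<close> the leading coefficient, multiplication by \<open>a * x\<close>
  maps \<open>1, x, ..., x ^ (n - 1)\<close> to integer combinations of these powers: the equation
  of \<open>x\<close> is used only for the last one, where the factor \<open>a\<close> clears the
  denominator.\<close>

lemma algebraic_int_lead_coeff_mult:
  fixes x :: "'a::field_char_0" and q :: "int poly"
  assumes "q \<noteq> 0" "poly (of_int_poly q) x = 0"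
  shows "algebraic_int (of_int (lead_coeff q) * x)"
proof -
  define n where "n = degree q"
  have n: "n > 0"
  proof (rule ccontr)
    assume "\<not> n > 0"
    then obtain c where "q = [:c:]" by (metis degree_eq_zeroE n_def gr0I)
    with assms show False by simp
  qed
  have root: "(\<Sum>i\<le>n. of_int (coeff q i) * x ^ i) = 0"
    using assms(2) by (simp add: poly_altdef n_def)
  define A where "A i j = (if Suc i < n then (if j = Suc i then coeff q n else 0) else - coeff q j)" for i j
  show ?thesis
  proof (rule algebraic_int_integer_matrix[of "{..<n}" 0 "\<lambda>i. x ^ i" _ A])
    fix i assume i: "i \<in> {..<n}"
    show "of_int (lead_coeff q) * x * x ^ i = (\<Sum>j\<in>{..<n}. of_int (A i j) * x ^ j)"
    proof (cases "Suc i < n")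
      case True
      then have "(\<Sum>j\<in>{..<n}. of_int (A i j) * x ^ j) = (\<Sum>j\<in>{..<n}. if j = Suc i then of_int (coeff q n) * x ^ j else 0)"
        by (intro sum.cong) (auto simp: A_def)
      also have "\<dots> = of_int (coeff q n) * x ^ Suc i" using True by (subst sum.delta) auto
      finally show ?thesis by (simp add: n_def mult.assoc)
    next
      case False
      then have ni: "Suc i = n" using i by simp
      have "(\<Sum>j\<in>{..<n}. of_int (A i j) * x ^ j) = - (\<Sum>j<n. of_int (coeff q j) * x ^ j)"
        using False by (simp add: A_def sum_negf)
      also have "\<dots> = of_int (coeff q n) * x ^ n"
        using root by (simp add: lessThan_Suc_atMost[symmetric] neg_eq_iff_add_eq_0 add.commute)
      also have "\<dots> = of_int (lead_coeff q) * x * x ^ i" 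
      proof -
        have "x ^ n = x * x ^ i" unfolding ni[symmetric] by (rule power_Suc)
        then show ?thesis by (simp add: n_def mult.assoc)
      qed
      finally show ?thesis by simp
    qed
  next
    show "(0::nat) \<in> {..<n}" using n by simp
    show "x ^ 0 \<noteq> 0" by simp
    show "finite {..<n}" by simp
  qed
qed

text \<open>The numbers that act by integer matrices on the finitely many monomials
  \<open>x ^ i * y ^ j\<close> are closed under sums and products, and \<open>x\<close> and
  \<open>y\<close> are among them.\<close>

lemma algebraic_int_add_mult:
  fixes x y :: "'a::field_char_0"
  assumes "algebraic_int x" "algebraic_int y"
  shows "algebraic_int (x + y)" "algebraic_int (x * y)"
proof -
  have *: "\<exists>n a. n > 0 \<and> z ^ n = (\<Sum>k<n. of_int (a k) * z ^ k)" if z: "algebraic_int z" for z :: 'a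
  proof -
    obtain p :: "int poly" where p: "poly (of_int_poly p) z = 0" "lead_coeff p = 1"
      using z unfolding algebraic_int_altdef_ipoly by blast
    define n where "n = degree p"
    have n: "n > 0"
    proof (rule ccontr)
      assume "\<not> n > 0"
      then obtain c where "p = [:c:]" by (metis degree_eq_zeroE n_def gr0I)
      with p show False by simp
    qed
    have "(\<Sum>i\<le>n. of_int (coeff p i) * z ^ i) = 0"
      using p(1) by (simp add: poly_altdef n_def)
    then have "(\<Sum>k<n. of_int (coeff p k) * z ^ k) + z ^ n = 0"
      using p(2) by (simp add: lessThan_Suc_atMost[symmetric] n_def)
    then have "z ^ n = (\<Sum>k<n. of_int (- coeff p k) * z ^ k)"
      by (simp add: sum_negf eq_neg_iff_add_eq_0 add.commute)
    with n show ?thesis by (intro exI[of _ n] exI[of _ "\<lambda>k. - coeff p k"] conjI)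
  qed
  obtain m a where m: "m > 0" "x ^ m = (\<Sum>k<m. of_int (a k) * x ^ k)" using *[OF assms(1)] by (elim exE conjE) (rule that)
  obtain n b where n: "n > 0" "y ^ n = (\<Sum>k<n. of_int (b k) * y ^ k)" using *[OF assms(2)] by (elim exE conjE) (rule that)
  define I where "I = {..<m} \<times> {..<n}"
  define w where "w = (\<lambda>(i, j). x ^ i * y ^ j)"
  define acts where "acts z \<longleftrightarrow> (\<exists>A :: nat \<times> nat \<Rightarrow> nat \<times> nat \<Rightarrow> int. \<forall>i\<in>I. z * w i = (\<Sum>j\<in>I. of_int (A i j) * w j))" for z
  have finI: "finite I" by (simp add: I_def)
  have power_comb: "\<exists>c. z ^ Suc i = (\<Sum>k<l. of_int (c k) * z ^ k)"
    if "z ^ l = (\<Sum>k<l. of_int (e k) * z ^ k)" "i < l" for z :: 'a and l i e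
  proof (cases "Suc i < l")
    case True
    have "(\<Sum>k<l. of_int (if k = Suc i then 1 else 0) * z ^ k) = (\<Sum>k<l. if k = Suc i then z ^ k else 0)"
      by (intro sum.cong) auto
    also have "\<dots> = z ^ Suc i" using True by (subst sum.delta) auto
    finally show ?thesis by metis
  next
    case False
    then have "Suc i = l" using that by simp
    with that(1) show ?thesis by metis
  qed
  have "acts x"
  proof -
    obtain c where c: "\<And>i. i < m \<Longrightarrow> x ^ Suc i = (\<Sum>k<m. of_int (c i k) * x ^ k)"
      using power_comb[OF m(2)] by metis
    define A :: "nat \<times> nat \<Rightarrow> nat \<times> nat \<Rightarrow> int" where "A = (\<lambda>(i, j) (k, l). if l = j then c i k else 0)"
    have "x * w (i, j) = (\<Sum>q\<in>I. of_int (A (i, j) q) * w q)" if "i < m" "j < n" for i j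
    proof -
      have "(\<Sum>q\<in>I. of_int (A (i, j) q) * w q) = (\<Sum>k<m. \<Sum>l<n. of_int (A (i, j) (k, l)) * w (k, l))"
        by (simp add: I_def sum.cartesian_product)
      also have "\<dots> = (\<Sum>k<m. \<Sum>l<n. if l = j then of_int (c i k) * (x ^ k * y ^ l) else 0)"
        by (intro sum.cong refl) (simp add: A_def w_def)
      also have "\<dots> = (\<Sum>k<m. of_int (c i k) * (x ^ k * y ^ j))" using that by (simp add: sum.delta)
      also have "\<dots> = (\<Sum>k<m. of_int (c i k) * x ^ k) * y ^ j" by (simp add: sum_distrib_right mult.assoc)
      also have "\<dots> = x * w (i, j)" unfolding c[OF that(1), symmetric] by (simp add: w_def)
      finally show ?thesis by simp
    qed
    then show ?thesis unfolding acts_def by (intro exI[of _ A]) (auto simp: I_def)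
  qed
  moreover have "acts y"
  proof -
    obtain c where c: "\<And>i. i < n \<Longrightarrow> y ^ Suc i = (\<Sum>k<n. of_int (c i k) * y ^ k)"
      using power_comb[OF n(2)] by metis
    define A :: "nat \<times> nat \<Rightarrow> nat \<times> nat \<Rightarrow> int" where "A = (\<lambda>(i, j) (k, l). if k = i then c j l else 0)"
    have "y * w (i, j) = (\<Sum>q\<in>I. of_int (A (i, j) q) * w q)" if "i < m" "j < n" for i j
    proof -
      have "(\<Sum>q\<in>I. of_int (A (i, j) q) * w q) = (\<Sum>k<m. \<Sum>l<n. of_int (A (i, j) (k, l)) * w (k, l))"
        by (simp add: I_def sum.cartesian_product)
      also have "\<dots> = (\<Sum>l<n. \<Sum>k<m. of_int (A (i, j) (k, l)) * w (k, l))" by (rule sum.swap)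
      also have "\<dots> = (\<Sum>l<n. \<Sum>k<m. if k = i then of_int (c j l) * (x ^ k * y ^ l) else 0)"
        by (intro sum.cong refl) (simp add: A_def w_def)
      also have "\<dots> = (\<Sum>l<n. x ^ i * (of_int (c j l) * y ^ l))" using that by (simp add: sum.delta mult.left_commute)
      also have "\<dots> = x ^ i * (\<Sum>l<n. of_int (c j l) * y ^ l)" by (simp only: sum_distrib_left)
      also have "\<dots> = y * w (i, j)" unfolding c[OF that(2), symmetric] by (simp add: w_def mult.left_commute)
      finally show ?thesis by simp
    qed
    then show ?thesis unfolding acts_def by (intro exI[of _ A]) (auto simp: I_def)
  qed
  moreover have "acts (u + v)" if "acts u" "acts v" for u v
  proof -
    from that obtain A B :: "nat \<times> nat \<Rightarrow> nat \<times> nat \<Rightarrow> int" where AB: "\<forall>i\<in>I. u * w i = (\<Sum>j\<in>I. of_int (A i j) * w j)"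
      "\<forall>i\<in>I. v * w i = (\<Sum>j\<in>I. of_int (B i j) * w j)" unfolding acts_def by blast
    show ?thesis unfolding acts_def
    proof (intro exI[of _ "\<lambda>i j. A i j + B i j"] ballI)
      fix i assume i: "i \<in> I"
      have "(u + v) * w i = (\<Sum>j\<in>I. of_int (A i j) * w j) + (\<Sum>j\<in>I. of_int (B i j) * w j)"
        using AB i by (simp only: distrib_right)
      also have "\<dots> = (\<Sum>j\<in>I. of_int (A i j + B i j) * w j)"
        by (simp add: sum.distrib[symmetric] distrib_right)
      finally show "(u + v) * w i = (\<Sum>j\<in>I. of_int (A i j + B i j) * w j)" .
    qed
  qed
  moreover have "acts (u * v)" if "acts u" "acts v" for u v
  proof -
    from that obtain A B :: "nat \<times> nat \<Rightarrow> nat \<times> nat \<Rightarrow> int" where AB: "\<And>i. i \<in> I \<Longrightarrow> u * w i = (\<Sum>j\<in>I. of_int (A i j) * w j)"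
      "\<And>i. i \<in> I \<Longrightarrow> v * w i = (\<Sum>j\<in>I. of_int (B i j) * w j)" unfolding acts_def by metis
    show ?thesis unfolding acts_def
    proof (intro exI[of _ "\<lambda>i k. \<Sum>j\<in>I. B i j * A j k"] ballI)
      fix i assume i: "i \<in> I"
      have "u * v * w i = u * (v * w i)" by (rule mult.assoc)
      also have "\<dots> = (\<Sum>j\<in>I. of_int (B i j) * (u * w j))"
        unfolding AB(2)[OF i] sum_distrib_left by (intro sum.cong refl) (rule mult.left_commute)
      also have "\<dots> = (\<Sum>j\<in>I. of_int (B i j) * (\<Sum>k\<in>I. of_int (A j k) * w k))"
        by (intro sum.cong refl) (simp only: AB(1))
      also have "\<dots> = (\<Sum>j\<in>I. \<Sum>k\<in>I. of_int (B i j * A j k) * w k)"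
        by (simp only: sum_distrib_left of_int_mult mult.assoc)
      also have "\<dots> = (\<Sum>k\<in>I. \<Sum>j\<in>I. of_int (B i j * A j k) * w k)" by (rule sum.swap)
      also have "\<dots> = (\<Sum>k\<in>I. of_int (\<Sum>j\<in>I. B i j * A j k) * w k)"
        by (simp only: sum_distrib_right of_int_sum)
      finally show "u * v * w i = (\<Sum>k\<in>I. of_int (\<Sum>j\<in>I. B i j * A j k) * w k)" .
    qed
  qed
  ultimately have acts: "acts (x + y)" "acts (x * y)" by blast+
  have "algebraic_int z" if "acts z" for z
  proof -
    from that obtain A :: "nat \<times> nat \<Rightarrow> nat \<times> nat \<Rightarrow> int" where "\<And>i. i \<in> I \<Longrightarrow> z * w i = (\<Sum>j\<in>I. of_int (A i j) * w j)"
      unfolding acts_def by metis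
    moreover have "(0, 0) \<in> I" "w (0, 0) \<noteq> 0" using m(1) n(1) by (simp_all add: I_def w_def)
    ultimately show ?thesis by (rule algebraic_int_integer_matrix[OF finI, rotated 2])
  qed
  with acts show "algebraic_int (x + y)" "algebraic_int (x * y)" by blast+
qed

section \<open>Galois extensions of the rationals\<close>

lemma coeff_prod_linear_in:
  fixes A :: "'a::comm_ring_1 set"
  assumes "finite A" "A \<subseteq> R"
    and R: "0 \<in> R" "1 \<in> R" "\<And>x y. x \<in> R \<Longrightarrow> y \<in> R \<Longrightarrow> x + y \<in> R" "\<And>x y. x \<in> R \<Longrightarrow> y \<in> R \<Longrightarrow> x * y \<in> R"
      "\<And>x. x \<in> R \<Longrightarrow> - x \<in> R"
  shows "coeff (\<Prod>a\<in>A. [:- a, 1:]) i \<in> R"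
  using assms(1,2)
proof (induction A arbitrary: i rule: finite_induct)
  case empty
  then show ?case using R(1,2) by (simp add: coeff_1)
next
  case (insert a B)
  have sumR: "(\<Sum>i\<in>I. g i) \<in> R" if "\<And>i. i \<in> I \<Longrightarrow> g i \<in> R" for I :: "nat set" and g
    using that by (induction I rule: infinite_finite_induct) (auto intro: R)
  have 1: "coeff (\<Prod>a\<in>B. [:- a, 1:]) j \<in> R" for j using insert.IH[of j] insert.prems by blast
  have 2: "coeff [:- a, 1:] j \<in> R" for j
  proof -
    have "a \<in> R" using insert.prems by blast
    then show ?thesis using R by (auto simp: coeff_pCons split: nat.split)
  qed
  have "coeff (\<Prod>a\<in>insert a B. [:- a, 1:]) i = coeff ([:- a, 1:] * (\<Prod>a\<in>B. [:- a, 1:])) i"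
    using insert.hyps by simp
  also have "\<dots> \<in> R" unfolding coeff_mult by (intro sumR R(4) 1 2)
  finally show ?case .
qed

lemma poly_coeffs_in_range:
  assumes "\<And>i. coeff P i \<in> range h" "inj h" "h 0 = 0"
  shows "\<exists>p. P = map_poly h p"
proof -
  have z: "inv_into UNIV h 0 = 0" using assms(2,3) by (metis inv_f_f)
  have "P = map_poly h (map_poly (inv_into UNIV h) P)"
    using assms(1) by (intro poly_eqI) (simp add: coeff_map_poly assms(3) z f_inv_into_f)
  then show ?thesis by blast
qed

text \<open>Newton interpolation: a new node is met by adding a multiple of the product that
  vanishes at the old nodes, which keeps the coefficients in \<open>K\<close>.\<close>

lemma exists_interpolation_poly:
  fixes h :: "'a::field \<Rightarrow> 'a"
  assumes "finite A" "A \<subseteq> K" "h ` A \<subseteq> K"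
    and K: "0 \<in> K" "1 \<in> K" "\<And>x y. x \<in> K \<Longrightarrow> y \<in> K \<Longrightarrow> x + y \<in> K" "\<And>x y. x \<in> K \<Longrightarrow> y \<in> K \<Longrightarrow> x * y \<in> K"
      "\<And>x. x \<in> K \<Longrightarrow> - x \<in> K" "\<And>x. x \<in> K \<Longrightarrow> inverse x \<in> K"
  shows "\<exists>P. (\<forall>i. coeff P i \<in> K) \<and> (\<forall>i\<ge>card A. coeff P i = 0) \<and> (\<forall>b\<in>A. poly P b = h b)"
  using assms(1-3)
proof (induction A rule: finite_induct)
  case empty
  then show ?case using K(1) by (intro exI[of _ 0]) auto
next
  case (insert b A)
  have sumK: "(\<Sum>i\<in>I. g i) \<in> K" if "\<And>i. i \<in> I \<Longrightarrow> g i \<in> K" for I :: "nat set" and g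
    using that by (induction I rule: infinite_finite_induct) (auto intro: K)
  have powK: "x ^ n \<in> K" if "x \<in> K" for x n using that by (induction n) (auto intro: K)
  have polyK: "poly P x \<in> K" if "\<And>i. coeff P i \<in> K" "x \<in> K" for P x
    unfolding poly_altdef using that by (intro sumK K(4) powK)
  define Q where "Q = (\<Prod>a\<in>A. [:- a, 1:])"
  have Qb: "poly Q b \<noteq> 0" using insert.hyps by (auto simp: Q_def poly_prod)
  have degQ: "degree Q = card A" unfolding Q_def by (simp add: degree_prod_eq_sum_degree)
  obtain P where P: "\<And>i. coeff P i \<in> K" "\<And>i. i \<ge> card A \<Longrightarrow> coeff P i = 0" "\<And>a. a \<in> A \<Longrightarrow> poly P a = h a"
    using insert.IH insert.prems by blast
  define c where "c = (h b - poly P b) * inverse (poly Q b)"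
  have bK: "b \<in> K" "h b \<in> K" using insert.prems by auto
  have QK': "coeff Q i \<in> K" for i
    unfolding Q_def using insert.hyps(1) insert.prems(1) by (intro coeff_prod_linear_in K) auto
  have cK: "c \<in> K"
  proof -
    have "h b + - poly P b \<in> K" by (intro K(3) bK K(5) polyK P(1))
    moreover have "inverse (poly Q b) \<in> K" by (intro K(6) polyK QK' bK)
    ultimately have "(h b + - poly P b) * inverse (poly Q b) \<in> K" by (rule K(4))
    then show ?thesis by (simp add: c_def)
  qed
  show ?case
  proof (intro exI[of _ "P + smult c Q"] conjI allI impI ballI)
    fix i
    have "coeff P i + c * coeff Q i \<in> K" by (intro K(3,4) P(1) cK QK')
    then show "coeff (P + smult c Q) i \<in> K" by simp
  next
    fix i assume i: "card (insert b A) \<le> i"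
    then have "card A < i" using insert.hyps by simp
    then show "coeff (P + smult c Q) i = 0" using P(2)[of i] degQ by (simp add: coeff_eq_0)
  next
    fix a assume a: "a \<in> insert b A"
    show "poly (P + smult c Q) a = h a"
    proof (cases "a = b")
      case True
      then show ?thesis using Qb by (simp add: c_def mult.assoc)
    next
      case False
      with a have "a \<in> A" by blast
      moreover have "poly Q a = 0" using \<open>a \<in> A\<close> insert.hyps by (auto simp: Q_def poly_prod)
      ultimately show ?thesis using P(3) by simp
    qed
  qed
qed

text \<open>Composition and identity are demanded only up to equality on \<open>K\<close>, because
  automorphisms are arbitrary outside it. The dimension \<open>n0\<close> enters through
  \<open>dep\<close> and \<open>span\<close>: elements have degree at most \<open>n0\<close>, and a
  generator needs at least \<open>n0\<close> of its powers to span \<open>K\<close>.\<close>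

locale rational_galois =
  fixes K :: "'a::field_char_0 set" and G :: "('a \<Rightarrow> 'a) set" and n0 :: nat
  assumes K0: "0 \<in> K" and K1: "1 \<in> K"
    and Kadd: "\<And>x y. x \<in> K \<Longrightarrow> y \<in> K \<Longrightarrow> x + y \<in> K"
    and Kmult: "\<And>x y. x \<in> K \<Longrightarrow> y \<in> K \<Longrightarrow> x * y \<in> K"
    and Kminus: "\<And>x. x \<in> K \<Longrightarrow> - x \<in> K"
    and Kinverse: "\<And>x. x \<in> K \<Longrightarrow> inverse x \<in> K"
    and Gclosed: "\<And>\<sigma> x. \<sigma> \<in> G \<Longrightarrow> x \<in> K \<Longrightarrow> \<sigma> x \<in> K"
    and Gadd: "\<And>\<sigma> x y. \<sigma> \<in> G \<Longrightarrow> x \<in> K \<Longrightarrow> y \<in> K \<Longrightarrow> \<sigma> (x + y) = \<sigma> x + \<sigma> y"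
    and Gmult: "\<And>\<sigma> x y. \<sigma> \<in> G \<Longrightarrow> x \<in> K \<Longrightarrow> y \<in> K \<Longrightarrow> \<sigma> (x * y) = \<sigma> x * \<sigma> y"
    and GQ: "\<And>\<sigma> x. \<sigma> \<in> G \<Longrightarrow> x \<in> \<rat> \<Longrightarrow> \<sigma> x = x"
    and Gcomp: "\<And>\<sigma> \<tau>. \<sigma> \<in> G \<Longrightarrow> \<tau> \<in> G \<Longrightarrow> \<exists>\<rho>\<in>G. \<forall>x\<in>K. \<rho> x = \<sigma> (\<tau> x)"
    and Gid: "\<exists>\<rho>\<in>G. \<forall>x\<in>K. \<rho> x = x"
    and Gfix: "\<And>x. x \<in> K \<Longrightarrow> (\<And>\<sigma>. \<sigma> \<in> G \<Longrightarrow> \<sigma> x = x) \<Longrightarrow> x \<in> \<rat>"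
    and dep: "\<And>x. x \<in> K \<Longrightarrow> \<exists>p::rat poly. p \<noteq> 0 \<and> degree p \<le> n0 \<and> poly (map_poly of_rat p) x = 0"
    and span: "\<And>\<alpha> d. \<alpha> \<in> K \<Longrightarrow> (\<And>\<gamma>. \<gamma> \<in> K \<Longrightarrow> \<exists>p::rat poly. (\<forall>i\<ge>d. coeff p i = 0) \<and> \<gamma> = poly (map_poly of_rat p) \<alpha>) \<Longrightarrow> n0 \<le> d"
begin

lemma Kof_nat: "of_nat n \<in> K"
  by (induction n) (auto intro: K0 K1 Kadd)

lemma Kof_int: "of_int n \<in> K"
  by (cases n rule: int_cases2) (simp_all add: Kof_nat Kminus)

lemma Krat: "x \<in> \<rat> \<Longrightarrow> x \<in> K"
  by (elim Rats_cases') (simp add: divide_inverse Kmult Kinverse Kof_int)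

lemma Kdiff: "x \<in> K \<Longrightarrow> y \<in> K \<Longrightarrow> x - y \<in> K"
  using Kadd[OF _ Kminus, of x y] by simp

lemma Ksum: "(\<And>i. i \<in> I \<Longrightarrow> g i \<in> K) \<Longrightarrow> sum g I \<in> K"
  by (induction I rule: infinite_finite_induct) (auto intro: K0 Kadd)

lemma Kprod: "(\<And>i. i \<in> I \<Longrightarrow> g i \<in> K) \<Longrightarrow> prod g I \<in> K"
  by (induction I rule: infinite_finite_induct) (auto intro: K1 Kmult)

lemma Kpower: "x \<in> K \<Longrightarrow> x ^ n \<in> K"
  by (induction n) (auto intro: K1 Kmult)

lemma G0: "\<sigma> \<in> G \<Longrightarrow> \<sigma> 0 = 0" and G1: "\<sigma> \<in> G \<Longrightarrow> \<sigma> 1 = 1"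
  by (auto intro: GQ)

lemma Gminus: "\<sigma> \<in> G \<Longrightarrow> x \<in> K \<Longrightarrow> \<sigma> (- x) = - \<sigma> x"
  using Gadd[of \<sigma> x "- x"] Kminus[of x] G0[of \<sigma>] by (simp add: eq_neg_iff_add_eq_0 add.commute)

lemma Gdiff: "\<sigma> \<in> G \<Longrightarrow> x \<in> K \<Longrightarrow> y \<in> K \<Longrightarrow> \<sigma> (x - y) = \<sigma> x - \<sigma> y"
  using Gadd[of \<sigma> x "- y"] Kminus[of y] Gminus[of \<sigma> y] by simp

lemma Gsum: "\<sigma> \<in> G \<Longrightarrow> (\<And>i. i \<in> I \<Longrightarrow> g i \<in> K) \<Longrightarrow> \<sigma> (sum g I) = (\<Sum>i\<in>I. \<sigma> (g i))"
proof (induction I rule: infinite_finite_induct)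
  case (insert i I)
  then have "\<sigma> (g i + sum g I) = \<sigma> (g i) + \<sigma> (sum g I)" by (intro Gadd Ksum) auto
  then show ?case using insert by simp
qed (simp_all add: G0)

lemma Gprod: "\<sigma> \<in> G \<Longrightarrow> (\<And>i. i \<in> I \<Longrightarrow> g i \<in> K) \<Longrightarrow> \<sigma> (prod g I) = (\<Prod>i\<in>I. \<sigma> (g i))"
proof (induction I rule: infinite_finite_induct)
  case (insert i I)
  then have "\<sigma> (g i * prod g I) = \<sigma> (g i) * \<sigma> (prod g I)" by (intro Gmult Kprod) auto
  then show ?case using insert by simp
qed (simp_all add: G1)

lemma Gpower: "\<sigma> \<in> G \<Longrightarrow> x \<in> K \<Longrightarrow> \<sigma> (x ^ n) = \<sigma> x ^ n"
  by (induction n) (auto simp: G1 Gmult Kpower)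

lemma Ginj:
  assumes "\<sigma> \<in> G" shows "inj_on \<sigma> K"
proof (rule inj_onI)
  fix x y assume xy: "x \<in> K" "y \<in> K" "\<sigma> x = \<sigma> y"
  define z where "z = x - y"
  have z: "z \<in> K" "\<sigma> z = 0" using xy assms by (simp_all add: z_def Kdiff Gdiff)
  have "z = 0"
  proof (rule ccontr)
    assume "z \<noteq> 0"
    then have "\<sigma> (z * inverse z) = 1" using G1[OF assms] by simp
    moreover have "\<sigma> (z * inverse z) = \<sigma> z * \<sigma> (inverse z)" by (intro Gmult assms z Kinverse)
    ultimately show False using z by simp
  qed
  then show "x = y" by (simp add: z_def)
qed

lemma Gpoly:
  assumes "\<sigma> \<in> G" "\<And>i. coeff P i \<in> K" "x \<in> K"
  shows "\<sigma> (poly P x) = poly (map_poly \<sigma> P) (\<sigma> x)"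
proof -
  have "\<sigma> (poly P x) = (\<Sum>i\<le>degree P. \<sigma> (coeff P i * x ^ i))"
    unfolding poly_altdef by (intro Gsum assms Kmult Kpower)
  also have "\<dots> = (\<Sum>i\<le>degree P. coeff (map_poly \<sigma> P) i * \<sigma> x ^ i)"
    using assms by (intro sum.cong refl) (simp add: Gmult Gpower Kpower coeff_map_poly G0)
  also have "\<dots> = poly (map_poly \<sigma> P) (\<sigma> x)"
    unfolding poly_altdef using degree_map_poly_le[of \<sigma> P]
    by (intro sum.mono_neutral_right) (auto simp: coeff_eq_0 not_le)
  finally show ?thesis .
qed

lemma map_poly_mult_G:
  assumes "\<sigma> \<in> G" "\<And>i. coeff P i \<in> K" "\<And>i. coeff Q i \<in> K"
  shows "map_poly \<sigma> (P * Q) = map_poly \<sigma> P * map_poly \<sigma> Q"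
proof (rule poly_eqI)
  fix n
  have "coeff (map_poly \<sigma> (P * Q)) n = (\<Sum>i\<le>n. \<sigma> (coeff P i * coeff Q (n - i)))"
    using assms by (simp add: coeff_map_poly G0 coeff_mult) (intro Gsum assms Kmult)
  also have "\<dots> = coeff (map_poly \<sigma> P * map_poly \<sigma> Q) n"
    using assms by (simp add: coeff_map_poly G0 coeff_mult Gmult)
  finally show "coeff (map_poly \<sigma> (P * Q)) n = coeff (map_poly \<sigma> P * map_poly \<sigma> Q) n" .
qed

definition orbit :: "'a \<Rightarrow> 'a set" where "orbit x = (\<lambda>\<sigma>. \<sigma> x) ` G"

lemma orbit_subset: "x \<in> K \<Longrightarrow> orbit x \<subseteq> K"
  unfolding orbit_def using Gclosed by blast

lemma self_in_orbit: "x \<in> K \<Longrightarrow> x \<in> orbit x"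
  unfolding orbit_def using Gid by (metis imageI)

lemma rat_poly_G:
  assumes "\<sigma> \<in> G" "x \<in> K"
  shows "\<sigma> (poly (map_poly of_rat p) x) = poly (map_poly of_rat p) (\<sigma> x)"
proof -
  have "map_poly \<sigma> (map_poly of_rat p) = map_poly of_rat p"
    by (rule poly_eqI) (simp add: coeff_map_poly G0 GQ assms)
  then show ?thesis using Gpoly[OF assms(1) _ assms(2), of "map_poly of_rat p"]
    by (simp add: coeff_map_poly Krat)
qed

lemma int_poly_G:
  assumes "\<sigma> \<in> G" "x \<in> K"
  shows "\<sigma> (poly (of_int_poly p) x) = poly (of_int_poly p) (\<sigma> x)"
proof -
  have "map_poly \<sigma> (of_int_poly p) = of_int_poly p"
    by (rule poly_eqI) (simp add: coeff_map_poly G0 GQ assms)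
  then show ?thesis using Gpoly[OF assms(1) _ assms(2), of "of_int_poly p"]
    by (simp add: coeff_map_poly Kof_int)
qed

lemma orbit_finite:
  assumes x: "x \<in> K"
  shows "finite (orbit x)" "card (orbit x) \<le> n0"
proof -
  obtain p :: "rat poly" where p: "p \<noteq> 0" "degree p \<le> n0" "poly (map_poly of_rat p) x = 0"
    using dep[OF x] by blast
  define q where "q = (map_poly of_rat p :: 'a poly)"
  have q: "q \<noteq> 0" "degree q \<le> n0" using p by (auto simp: q_def)
  have sub: "orbit x \<subseteq> {y. poly q y = 0}"
  proof
    fix y assume "y \<in> orbit x"
    then obtain \<sigma> where s: "\<sigma> \<in> G" "y = \<sigma> x" by (auto simp: orbit_def)
    have "poly q y = \<sigma> (poly q x)" using rat_poly_G[OF s(1) x] s by (simp add: q_def)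
    then show "y \<in> {y. poly q y = 0}" using p s by (simp add: q_def G0)
  qed
  show "finite (orbit x)" using sub poly_roots_finite[OF q(1)] by (rule finite_subset)
  have "card (orbit x) \<le> card {y. poly q y = 0}"
    using sub poly_roots_finite[OF q(1)] by (rule card_mono[rotated])
  also have "\<dots> \<le> degree q" using q(1) by (rule card_poly_roots_bound)
  finally show "card (orbit x) \<le> n0" using q(2) by simp
qed

lemma G_image_orbit:
  assumes "\<sigma> \<in> G" "x \<in> K"
  shows "\<sigma> ` orbit x = orbit x" "bij_betw \<sigma> (orbit x) (orbit x)"
proof -
  have sub: "\<sigma> ` orbit x \<subseteq> orbit x"
  proof
    fix y assume "y \<in> \<sigma> ` orbit x"
    then obtain \<tau> where t: "\<tau> \<in> G" "y = \<sigma> (\<tau> x)" by (auto simp: orbit_def)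
    obtain \<rho> where "\<rho> \<in> G" "\<forall>x\<in>K. \<rho> x = \<sigma> (\<tau> x)" using Gcomp[OF assms(1) t(1)] by blast
    then show "y \<in> orbit x" using t assms(2) by (auto simp: orbit_def image_iff intro!: bexI[of _ \<rho>])
  qed
  have inj: "inj_on \<sigma> (orbit x)" using Ginj[OF assms(1)] orbit_subset[OF assms(2)] by (rule inj_on_subset)
  show eq: "\<sigma> ` orbit x = orbit x"
    using endo_inj_surj[OF orbit_finite(1)[OF assms(2)] sub inj] .
  show "bij_betw \<sigma> (orbit x) (orbit x)" using inj eq by (simp add: bij_betw_def)
qed

lemma G_fixed_poly:
  assumes "\<And>i. coeff P i \<in> K" "\<And>\<sigma>. \<sigma> \<in> G \<Longrightarrow> map_poly \<sigma> P = P"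
  shows "\<exists>p. P = map_poly of_rat p"
proof -
  have rat: "coeff P i \<in> \<rat>" for i
  proof (rule Gfix[OF assms(1)])
    fix \<sigma> assume s: "\<sigma> \<in> G"
    show "\<sigma> (coeff P i) = coeff P i"
      using arg_cong[OF assms(2)[OF s], of "\<lambda>q. coeff q i"] by (simp add: coeff_map_poly G0 s)
  qed
  show ?thesis
    using rat by (intro poly_coeffs_in_range) (auto simp: inj_on_def Rats_def)
qed

text \<open>For a suitable \<open>t\<close> the conjugates of \<open>\<alpha> + t * \<gamma>\<close>
  correspond to the pairs of simultaneous conjugates of \<alpha> and \<gamma>. By maximality there
  are no more such pairs than conjugates of \<alpha>, so \<open>\<sigma> \<alpha>\<close> determines
  \<open>\<sigma> \<gamma>\<close>; the polynomial interpolating this map is fixed by all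
  automorphisms and hence rational.\<close>

lemma maximal_orbit_generates:
  assumes a: "\<alpha> \<in> K" and max: "\<And>x. x \<in> K \<Longrightarrow> card (orbit x) \<le> card (orbit \<alpha>)" and g: "\<gamma> \<in> K"
  shows "\<exists>p::rat poly. (\<forall>i\<ge>card (orbit \<alpha>). coeff p i = 0) \<and> \<gamma> = poly (map_poly of_rat p) \<alpha>"
proof -
  define Q where "Q = (\<lambda>\<sigma>. (\<sigma> \<alpha>, \<sigma> \<gamma>)) ` G"
  have finQ: "finite Q"
  proof (rule finite_subset)
    show "Q \<subseteq> orbit \<alpha> \<times> orbit \<gamma>" by (auto simp: Q_def orbit_def)
  qed (intro finite_cartesian_product orbit_finite a g)
  \<comment> \<open>Contains every \<open>t\<close> at which two pairs with different second entries
    give the same conjugate.\<close>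
  define bad where "bad = (\<lambda>((x, y), (x', y')). (x - x') / (y' - y)) ` (Q \<times> Q)"
  have "finite bad" unfolding bad_def using finQ by simp
  moreover have "infinite (range (of_nat :: nat \<Rightarrow> 'a))"
    by (rule range_inj_infinite) (simp add: inj_on_def)
  ultimately obtain t :: nat where t: "of_nat t \<notin> bad"
    by (metis finite_subset image_subsetI)
  define \<delta> where "\<delta> = \<alpha> + of_nat t * \<gamma>"
  have d: "\<delta> \<in> K" unfolding \<delta>_def by (intro Kadd Kmult Kof_nat a g)
  have orb: "orbit \<delta> = (\<lambda>(x, y). x + of_nat t * y) ` Q"
  proof -
    have "\<sigma> \<delta> = \<sigma> \<alpha> + of_nat t * \<sigma> \<gamma>" if "\<sigma> \<in> G" for \<sigma>
    proof -
      have "\<sigma> \<delta> = \<sigma> \<alpha> + \<sigma> (of_nat t * \<gamma>)" unfolding \<delta>_def by (intro Gadd that a Kmult Kof_nat g)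
      also have "\<sigma> (of_nat t * \<gamma>) = \<sigma> (of_nat t) * \<sigma> \<gamma>" by (intro Gmult that Kof_nat g)
      also have "\<sigma> (of_nat t) = of_nat t" by (intro GQ that) simp
      finally show ?thesis .
    qed
    then show ?thesis unfolding orbit_def Q_def by (simp add: image_image)
  qed
  have "inj_on (\<lambda>(x, y). x + of_nat t * y) Q"
  proof (rule inj_onI, clarify)
    fix x y x' y' assume xy: "(x, y) \<in> Q" "(x', y') \<in> Q" "x + of_nat t * y = x' + of_nat t * y'"
    have "y = y'"
    proof (rule ccontr)
      assume "y \<noteq> y'"
      with xy(3) have "of_nat t = (x - x') / (y' - y)" by (simp add: eq_divide_eq algebra_simps)
      moreover have "(x - x') / (y' - y) \<in> bad"
        unfolding bad_def using xy(1,2) by (intro image_eqI[of _ _ "((x, y), (x', y'))"]) auto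
      ultimately show False using t by simp
    qed
    with xy(3) show "x = x' \<and> y = y'" by simp
  qed
  then have "card Q = card (orbit \<delta>)" unfolding orb by (simp add: card_image)
  also have "\<dots> \<le> card (orbit \<alpha>)" by (rule max[OF d])
  also have "orbit \<alpha> = fst ` Q" by (simp add: orbit_def Q_def image_image)
  finally have injfst: "inj_on fst Q"
    using finQ card_image_le[OF finQ, of fst] by (intro eq_card_imp_inj_on) auto
  define h where "h x = (THE y. (x, y) \<in> Q)" for x
  have h: "h (\<sigma> \<alpha>) = \<sigma> \<gamma>" if "\<sigma> \<in> G" for \<sigma>
    unfolding h_def
  proof (rule the_equality)
    show *: "(\<sigma> \<alpha>, \<sigma> \<gamma>) \<in> Q" using that by (auto simp: Q_def)
    fix y assume "(\<sigma> \<alpha>, y) \<in> Q"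
    from inj_onD[OF injfst _ this *] show "y = \<sigma> \<gamma>" by simp
  qed
  have hK: "h ` orbit \<alpha> \<subseteq> K" using h Gclosed g by (auto simp: orbit_def)
  obtain P where P: "\<And>i. coeff P i \<in> K" "\<And>i. i \<ge> card (orbit \<alpha>) \<Longrightarrow> coeff P i = 0" "\<And>b. b \<in> orbit \<alpha> \<Longrightarrow> poly P b = h b"
    using exists_interpolation_poly[OF orbit_finite(1)[OF a] orbit_subset[OF a] hK K0 K1 Kadd Kmult Kminus Kinverse]
    by blast
  \<comment> \<open>Both polynomials have degree below the size of the orbit, and they agree on it
    since the interpolated map commutes with the automorphisms.\<close>
  have "map_poly \<sigma> P = P" if s: "\<sigma> \<in> G" for \<sigma>
  proof -
    have root: "poly (map_poly \<sigma> P - P) b = 0" if "b \<in> orbit \<alpha>" for b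
    proof -
      from that obtain b' where b': "b' \<in> orbit \<alpha>" "b = \<sigma> b'" using G_image_orbit(1)[OF s a] by blast
      then obtain \<tau> where t: "\<tau> \<in> G" "b' = \<tau> \<alpha>" by (auto simp: orbit_def)
      obtain \<rho> where r: "\<rho> \<in> G" "\<forall>x\<in>K. \<rho> x = \<sigma> (\<tau> x)" using Gcomp[OF s t(1)] by blast
      have "b' \<in> K" using b'(1) orbit_subset[OF a] by blast
      have "poly (map_poly \<sigma> P) b = \<sigma> (poly P b')" using Gpoly[OF s P(1) \<open>b' \<in> K\<close>] b'(2) by simp
      also have "\<dots> = \<sigma> (\<tau> \<gamma>)" using P(3)[OF b'(1)] h[OF t(1)] t(2) by simp
      also have "\<dots> = \<rho> \<gamma>" using r(2) g by simp
      also have "\<dots> = h (\<rho> \<alpha>)" using h[OF r(1)] by simp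
      also have "\<rho> \<alpha> = b" using r(2) a t(2) b'(2) by simp
      also have "h b = poly P b" using P(3)[OF that] by simp
      finally show ?thesis by simp
    qed
    show ?thesis
    proof (rule ccontr)
      assume "map_poly \<sigma> P \<noteq> P"
      then have nz: "map_poly \<sigma> P - P \<noteq> 0" by simp
      have "card (orbit \<alpha>) \<le> card {b. poly (map_poly \<sigma> P - P) b = 0}"
        using root by (intro card_mono poly_roots_finite[OF nz]) auto
      also have "\<dots> \<le> degree (map_poly \<sigma> P - P)" by (rule card_poly_roots_bound[OF nz])
      finally have "coeff (map_poly \<sigma> P - P) (degree (map_poly \<sigma> P - P)) = 0"
        using P(2) by (simp add: coeff_map_poly G0 s)
      then show False using nz leading_coeff_0_iff by blast
    qed
  qed
  from G_fixed_poly[OF P(1) this] obtain p where p: "P = map_poly of_rat p" by blast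
  have "coeff p i = 0" if "i \<ge> card (orbit \<alpha>)" for i
    using P(2)[OF that] by (simp add: p coeff_map_poly)
  moreover have "\<gamma> = poly P \<alpha>"
  proof -
    obtain \<rho> where "\<rho> \<in> G" "\<forall>x\<in>K. \<rho> x = x" using Gid by blast
    then show ?thesis using h[of \<rho>] P(3)[OF self_in_orbit[OF a]] a g by simp
  qed
  ultimately show ?thesis unfolding p by blast
qed

end

section \<open>Algebraic integers, their conjugates and the minimal polynomial\<close>

context rational_galois
begin

definition OK :: "'a set" where "OK = {x \<in> K. algebraic_int x}"

lemma OK_add: "x \<in> OK \<Longrightarrow> y \<in> OK \<Longrightarrow> x + y \<in> OK"
  by (simp add: OK_def Kadd algebraic_int_add_mult)

lemma OK_mult: "x \<in> OK \<Longrightarrow> y \<in> OK \<Longrightarrow> x * y \<in> OK"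
  by (simp add: OK_def Kmult algebraic_int_add_mult)

lemma OK_minus: "x \<in> OK \<Longrightarrow> - x \<in> OK"
  by (simp add: OK_def Kminus)

lemma OK_diff: "x \<in> OK \<Longrightarrow> y \<in> OK \<Longrightarrow> x - y \<in> OK"
  using OK_add[OF _ OK_minus, of x y] by simp

lemma OK_of_int: "of_int n \<in> OK"
  by (simp add: OK_def Kof_int int_imp_algebraic_int)

lemma OK_of_nat: "of_nat n \<in> OK"
  using OK_of_int[of "int n"] by simp

lemma OK_0: "0 \<in> OK" and OK_1: "1 \<in> OK"
  using OK_of_int[of 0] OK_of_int[of 1] by simp_all

lemma OK_prod: "(\<And>i. i \<in> I \<Longrightarrow> g i \<in> OK) \<Longrightarrow> prod g I \<in> OK"
  by (induction I rule: infinite_finite_induct) (auto intro: OK_1 OK_mult)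

lemma G_OK:
  assumes "\<sigma> \<in> G" "x \<in> OK" shows "\<sigma> x \<in> OK"
proof -
  have x: "x \<in> K" "algebraic_int x" using assms(2) by (auto simp: OK_def)
  then obtain p :: "int poly" where p: "poly (of_int_poly p) x = 0" "lead_coeff p = 1"
    unfolding algebraic_int_altdef_ipoly by blast
  have "poly (of_int_poly p) (\<sigma> x) = 0"
    using int_poly_G[OF assms(1) x(1), of p] p(1) G0[OF assms(1)] by simp
  with p(2) have "algebraic_int (\<sigma> x)" unfolding algebraic_int_altdef_ipoly by blast
  then show ?thesis using Gclosed[OF assms(1) x(1)] by (simp add: OK_def)
qed

lemma OK_fixed_int:
  assumes "x \<in> OK" "\<And>\<sigma>. \<sigma> \<in> G \<Longrightarrow> \<sigma> x = x"
  shows "x \<in> \<int>"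
  using assms Gfix[of x] by (auto simp: OK_def intro: rational_algebraic_int_is_int)

text \<open>Multiplication by a nonzero integer preserves the number of conjugates, and the leading
  coefficient of an integer equation makes the element integral.\<close>

lemma exists_integral_maximal_orbit:
  "\<exists>\<alpha>\<in>OK. \<forall>x\<in>K. card (orbit x) \<le> card (orbit \<alpha>)"
proof -
  have "\<exists>a. a \<in> K \<and> (\<forall>y. y \<in> K \<longrightarrow> card (orbit y) \<le> card (orbit a))"
    using orbit_finite(2) by (intro ex_has_greatest_nat[of _ 0 _ "Suc n0"]) (auto simp: K0 le_imp_less_Suc)
  then obtain a where a: "a \<in> K" "\<And>y. y \<in> K \<Longrightarrow> card (orbit y) \<le> card (orbit a)" by blast
  obtain p :: "rat poly" where p: "p \<noteq> 0" "poly (map_poly of_rat p) a = 0" using dep[OF a(1)] by blast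
  have "algebraic a" unfolding algebraic_altdef
    using p by (intro exI[of _ "map_poly of_rat p"]) (simp add: coeff_map_poly)
  then obtain q' where q': "\<And>i. coeff q' i \<in> \<int>" "q' \<noteq> 0" "poly q' a = 0"
    unfolding algebraic_def by blast
  then have "\<exists>q. q' = of_int_poly q"
    by (intro poly_coeffs_in_range) (auto simp: inj_on_def Ints_def)
  with q' obtain q :: "int poly" where q: "poly (of_int_poly q) a = 0" "q \<noteq> 0" by auto
  define c where "c = (of_int (lead_coeff q) :: 'a)"
  have c: "c \<noteq> 0" "c \<in> K" using q(2) by (simp_all add: c_def Kof_int)
  have "orbit (c * a) = (*) c ` orbit a"
  proof -
    have "\<sigma> (c * a) = c * \<sigma> a" if "\<sigma> \<in> G" for \<sigma>
      using Gmult[OF that c(2) a(1)] GQ[OF that, of c] by (simp add: c_def)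
    then show ?thesis by (simp add: orbit_def image_image)
  qed
  then have "card (orbit (c * a)) = card (orbit a)"
    using c(1) by (simp add: card_image inj_on_def)
  moreover have "c * a \<in> OK"
    using algebraic_int_lead_coeff_mult[OF q(2,1)] c(2) a(1) by (simp add: OK_def Kmult c_def)
  ultimately show ?thesis using a(2) by (intro bexI[of _ "c * a"]) simp_all
qed

lemma map_poly_prod_linear:
  assumes s: "\<sigma> \<in> G" and "finite B" "B \<subseteq> K"
  shows "map_poly \<sigma> (\<Prod>b\<in>B. [:- b, 1:]) = (\<Prod>b\<in>B. [:- \<sigma> b, 1:])"
  using assms(2,3)
proof (induction B rule: finite_induct)
  case empty
  then show ?case using s by (simp add: map_poly_1' G1)
next
  case (insert b B)
  have b: "b \<in> K" using insert.prems by blast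
  have "map_poly \<sigma> ([:- b, 1:] * (\<Prod>b\<in>B. [:- b, 1:])) = map_poly \<sigma> [:- b, 1:] * map_poly \<sigma> (\<Prod>b\<in>B. [:- b, 1:])"
  proof (rule map_poly_mult_G[OF s])
    show "coeff [:- b, 1:] i \<in> K" for i
      using b by (auto simp: coeff_pCons K0 K1 Kminus split: nat.split)
    show "coeff (\<Prod>b\<in>B. [:- b, 1:]) i \<in> K" for i
      using insert.hyps(1) insert.prems by (intro coeff_prod_linear_in K0 K1 Kadd Kmult Kminus) auto
  qed
  also have "map_poly \<sigma> [:- b, 1:] = [:- \<sigma> b, 1:]"
    using s b by (simp add: map_poly_pCons G0 G1 Gminus)
  finally show ?case using insert by simp
qed

text \<open>The coefficients are algebraic integers fixed by all automorphisms, hence rational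
  integers.\<close>

lemma orbit_polynomial:
  assumes a: "\<alpha> \<in> OK"
  shows "\<exists>f. of_int_poly f = (\<Prod>b\<in>orbit \<alpha>. [:- b, 1:])"
proof -
  have aK: "\<alpha> \<in> K" using a by (simp add: OK_def)
  have orbOK: "orbit \<alpha> \<subseteq> OK" using G_OK[OF _ a] by (auto simp: orbit_def)
  have "coeff (\<Prod>b\<in>orbit \<alpha>. [:- b, 1:]) i \<in> \<int>" for i
  proof (rule OK_fixed_int)
    show "coeff (\<Prod>b\<in>orbit \<alpha>. [:- b, 1:]) i \<in> OK"
      by (intro coeff_prod_linear_in orbit_finite aK orbOK OK_0 OK_1 OK_add OK_mult OK_minus)
    fix \<sigma> assume s: "\<sigma> \<in> G"
    have "map_poly \<sigma> (\<Prod>b\<in>orbit \<alpha>. [:- b, 1:]) = (\<Prod>b\<in>orbit \<alpha>. [:- \<sigma> b, 1:])"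
      by (intro map_poly_prod_linear s orbit_finite orbit_subset aK)
    also have "\<dots> = (\<Prod>b\<in>orbit \<alpha>. [:- b, 1:])"
      by (rule prod.reindex_bij_betw[OF G_image_orbit(2)[OF s aK]])
    finally have "coeff (map_poly \<sigma> (\<Prod>b\<in>orbit \<alpha>. [:- b, 1:])) i = coeff (\<Prod>b\<in>orbit \<alpha>. [:- b, 1:]) i"
      by (rule arg_cong)
    then show "\<sigma> (coeff (\<Prod>b\<in>orbit \<alpha>. [:- b, 1:]) i) = coeff (\<Prod>b\<in>orbit \<alpha>. [:- b, 1:]) i"
      by (simp add: coeff_map_poly G0 s)
  qed
  then have "\<exists>f. (\<Prod>b\<in>orbit \<alpha>. [:- b, 1:]) = of_int_poly f"
    by (intro poly_coeffs_in_range) (auto simp: inj_on_def Ints_def)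
  then show ?thesis by metis
qed

lemma roots_orbit_degree:
  fixes h :: "rat poly"
  assumes a: "\<alpha> \<in> K" and h: "h \<noteq> 0" "poly (map_poly of_rat h) \<alpha> = 0"
  shows "card (orbit \<alpha>) \<le> degree h"
proof -
  have nz: "map_poly of_rat h \<noteq> (0 :: 'a poly)" using h(1) by simp
  have "orbit \<alpha> \<subseteq> {x. poly (map_poly of_rat h) x = 0}"
  proof
    fix y assume "y \<in> orbit \<alpha>"
    then obtain \<sigma> where s: "\<sigma> \<in> G" "y = \<sigma> \<alpha>" by (auto simp: orbit_def)
    have "poly (map_poly of_rat h) y = \<sigma> (poly (map_poly of_rat h) \<alpha>)"
      using rat_poly_G[OF s(1) a, of h] s(2) by simp
    then show "y \<in> {x. poly (map_poly of_rat h) x = 0}" using h(2) G0[OF s(1)] by simp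
  qed
  then have "card (orbit \<alpha>) \<le> card {x::'a. poly (map_poly of_rat h) x = 0}"
    by (rule card_mono[OF poly_roots_finite[OF nz]])
  also have "\<dots> \<le> degree (map_poly of_rat h :: 'a poly)" by (rule card_poly_roots_bound[OF nz])
  finally show ?thesis by simp
qed

text \<open>Irreducibility through orbits: the common factor \<open>h\<close> of \<open>v\<close>
  and \<open>f\<close>, or else its cofactor in \<open>f\<close>, vanishes at \<alpha> and so has
  degree at least \<open>d\<close>. The former contradicts \<open>degree v < d\<close>, the latter
  leaves \<open>h\<close> constant.\<close>

lemma orbit_polynomial_bezout:
  fixes f :: "int poly"
  assumes a: "\<alpha> \<in> K" and f: "of_int_poly f = (\<Prod>b\<in>orbit \<alpha>. [:- b, 1:])"
  shows "monic_bezout_poly f (card (orbit \<alpha>))"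
proof
  define d where "d = card (orbit \<alpha>)"
  show dpos: "0 < card (orbit \<alpha>)" using self_in_orbit[OF a] orbit_finite(1)[OF a] by (auto simp: card_gt_0_iff)
  have degf: "degree (of_int_poly f :: 'a poly) = d" unfolding f d_def by (simp add: degree_prod_eq_sum_degree)
  then show "degree f = card (orbit \<alpha>)" by (simp add: d_def)
  have "lead_coeff (of_int_poly f :: 'a poly) = 1" unfolding f by (simp add: lead_coeff_prod)
  then have "of_int (lead_coeff f) = (1::'a)" by (simp add: coeff_map_poly)
  then show "lead_coeff f = 1" by simp
  have froot: "poly (of_int_poly f) \<alpha> = (0::'a)"
    unfolding f poly_prod using self_in_orbit[OF a] orbit_finite(1)[OF a] by (auto simp: prod_zero_iff)
  fix v :: "int poly" assume v: "v \<noteq> 0" "degree v < card (orbit \<alpha>)"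
  define V F where VF: "V = (of_int_poly v :: rat poly)" "F = (of_int_poly f :: rat poly)"
  have V0: "V \<noteq> 0" "degree V < d" using v by (simp_all add: VF d_def)
  have dF: "degree F = d" using \<open>degree f = card (orbit \<alpha>)\<close> by (simp add: VF d_def)
  then have F0: "F \<noteq> 0" using dpos by (auto simp: d_def)
  define h where "h = gcd V F"
  have h0: "h \<noteq> 0" using V0 by (simp add: h_def)
  have hV: "h dvd V" "h dvd F" by (simp_all add: h_def)
  then obtain k where k: "F = h * k" by (auto simp: dvd_def)
  have k0: "k \<noteq> 0" using k F0 by auto
  have degs: "degree F = degree h + degree k" using k h0 k0 by (simp add: degree_mult_eq)
  have "degree h = 0"
  proof (cases "poly (map_poly of_rat h) \<alpha> = 0")
    case True
    have "d \<le> degree h" unfolding d_def by (rule roots_orbit_degree[OF a h0 True])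
    moreover have "degree h \<le> degree V" using hV(1) V0(1) by (rule dvd_imp_degree_le)
    ultimately show ?thesis using V0(2) by simp
  next
    case False
    have "map_poly of_rat F = (of_int_poly f :: 'a poly)"
      by (rule poly_eqI) (simp add: VF coeff_map_poly)
    moreover have "(map_poly of_rat F :: 'a poly) = map_poly of_rat h * map_poly of_rat k"
      unfolding k by (rule poly_eqI) (simp add: coeff_map_poly coeff_mult of_rat_sum of_rat_mult)
    ultimately have "poly (map_poly of_rat h) \<alpha> * poly (map_poly of_rat k) \<alpha> = 0"
      using froot by (metis poly_mult)
    with False have "poly (map_poly of_rat k) \<alpha> = 0" by simp
    from roots_orbit_degree[OF a k0 this] show ?thesis using degs dF by (simp add: d_def)
  qed
  then have "is_unit h" using h0 by (simp add: is_unit_iff_degree)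
  then have "gcd V F = 1" unfolding h_def by (simp only: is_unit_gcd_iff)
  then have "fst (bezout_coefficients V F) * V + snd (bezout_coefficients V F) * F = 1"
    using bezout_coefficients_fst_snd[of V F] by simp
  then show "\<exists>a b. a * of_int_poly v + b * of_int_poly f = (1 :: rat poly)"
    unfolding VF by blast
qed

text \<open>\<open>E\<close> is the product of the differences over all ordered pairs of distinct
  conjugates, the discriminant up to sign. Automorphisms permute these pairs, so the product is a
  rational integer, and each difference is one of its factors.\<close>

lemma orbit_discriminant:
  assumes a: "\<alpha> \<in> OK"
  shows "\<exists>E::int. E \<noteq> 0 \<and> (\<forall>b\<in>orbit \<alpha>. \<forall>c\<in>orbit \<alpha>. b \<noteq> c \<longrightarrow> (\<exists>y\<in>OK. of_int E = (b - c) * y))"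
proof -
  have aK: "\<alpha> \<in> K" using a by (simp add: OK_def)
  have orbOK: "orbit \<alpha> \<subseteq> OK" using G_OK[OF _ a] by (auto simp: orbit_def)
  define P where "P = {(b, c). b \<in> orbit \<alpha> \<and> c \<in> orbit \<alpha> \<and> b \<noteq> c}"
  have finP: "finite P"
    by (rule finite_subset[of _ "orbit \<alpha> \<times> orbit \<alpha>"]) (auto simp: P_def orbit_finite aK)
  define D where "D = (\<Prod>q\<in>P. fst q - snd q)"
  have diffOK: "fst q - snd q \<in> OK" if "q \<in> P" for q
    using that orbOK by (auto simp: P_def intro!: OK_diff)
  have "D \<in> \<int>"
  proof (rule OK_fixed_int)
    show "D \<in> OK" unfolding D_def using diffOK by (rule OK_prod)
    fix \<sigma> assume s: "\<sigma> \<in> G"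
    have inj: "\<sigma> b = \<sigma> c \<longleftrightarrow> b = c" if "b \<in> orbit \<alpha>" "c \<in> orbit \<alpha>" for b c
      using G_image_orbit(2)[OF s aK] that by (auto simp: bij_betw_def inj_on_def)
    have mem: "\<sigma> b \<in> orbit \<alpha>" if "b \<in> orbit \<alpha>" for b
      using G_image_orbit(1)[OF s aK] that by blast
    have bij: "bij_betw (map_prod \<sigma> \<sigma>) P P"
    proof (rule bij_betw_imageI)
      show injP: "inj_on (map_prod \<sigma> \<sigma>) P" using inj by (auto simp: inj_on_def P_def)
      have "map_prod \<sigma> \<sigma> ` P \<subseteq> P" using inj mem by (auto simp: P_def)
      then show "map_prod \<sigma> \<sigma> ` P = P" using finP injP by (intro endo_inj_surj)
    qed
    have "\<sigma> D = (\<Prod>q\<in>P. \<sigma> (fst q - snd q))"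
      unfolding D_def using diffOK by (intro Gprod s) (auto simp: OK_def)
    also have "\<dots> = (\<Prod>q\<in>P. fst (map_prod \<sigma> \<sigma> q) - snd (map_prod \<sigma> \<sigma> q))"
      using orbit_subset[OF aK] by (intro prod.cong refl) (auto simp: P_def intro!: Gdiff s)
    also have "\<dots> = D" unfolding D_def by (rule prod.reindex_bij_betw[OF bij])
    finally show "\<sigma> D = D" .
  qed
  then obtain E where E: "D = of_int E" by (auto elim: Ints_cases)
  have "D \<noteq> 0" unfolding D_def using finP by (auto simp: prod_zero_iff P_def)
  then have "E \<noteq> 0" using E by auto
  moreover have "\<exists>y\<in>OK. of_int E = (b - c) * y" if "b \<in> orbit \<alpha>" "c \<in> orbit \<alpha>" "b \<noteq> c" for b c
  proof
    have "(b, c) \<in> P" using that by (simp add: P_def)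
    then have "D = (b - c) * (\<Prod>q\<in>P - {(b, c)}. fst q - snd q)"
      unfolding D_def using finP by (subst prod.remove[of P "(b, c)"]) auto
    then show "of_int E = (b - c) * (\<Prod>q\<in>P - {(b, c)}. fst q - snd q)" using E by simp
    show "(\<Prod>q\<in>P - {(b, c)}. fst q - snd q) \<in> OK" using diffOK by (intro OK_prod) auto
  qed
  ultimately show ?thesis by blast
qed

text \<open>All conjugates lie in \<open>OK\<close>, so reduction modulo the one ideal
  \<open>J\<close> applies to each of them. The residues are roots of \<open>f\<close> modulo
  \<open>p\<close>, and they remain distinct because every difference divides \<open>E\<close>,
  while \<open>p\<close> does not.\<close>

lemma residues_of_orbit:
  fixes f :: "int poly" and E :: int
  assumes a: "\<alpha> \<in> OK" and f: "of_int_poly f = (\<Prod>b\<in>orbit \<alpha>. [:- b, 1:])"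
    and E: "\<And>b c. b \<in> orbit \<alpha> \<Longrightarrow> c \<in> orbit \<alpha> \<Longrightarrow> b \<noteq> c \<Longrightarrow> \<exists>y\<in>OK. of_int E = (b - c) * y"
    and J: "\<And>x y. x \<in> J \<Longrightarrow> y \<in> J \<Longrightarrow> x - y \<in> J" "\<And>x y. x \<in> J \<Longrightarrow> y \<in> OK \<Longrightarrow> x * y \<in> J"
    and Jint: "\<And>k. of_int k \<in> J \<longleftrightarrow> int p dvd k"
    and res: "\<And>x. x \<in> OK \<Longrightarrow> \<exists>r. x - of_int r \<in> J"
    and p: "prime p" "\<not> int p dvd E"
  shows "\<exists>R. R \<subseteq> {0..<int p} \<and> card R = card (orbit \<alpha>) \<and> (\<forall>r\<in>R. int p dvd poly f r)"
proof -
  have aK: "\<alpha> \<in> K" using a by (simp add: OK_def)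
  have orbOK: "orbit \<alpha> \<subseteq> OK" using G_OK[OF _ a] by (auto simp: orbit_def)
  have J0: "0 \<in> J" using Jint[of 0] by simp
  have Jminus: "- x \<in> J" if "x \<in> J" for x using J(1)[OF J0 that] by simp
  have Jadd: "x + y \<in> J" if "x \<in> J" "y \<in> J" for x y using J(1)[OF that(1) Jminus[OF that(2)]] by simp
  have "\<exists>r. r \<in> {0..<int p} \<and> b - of_int r \<in> J" if b: "b \<in> orbit \<alpha>" for b
  proof -
    obtain r where r: "b - of_int r \<in> J" using res b orbOK by blast
    have "of_int (r - r mod int p) \<in> J" unfolding Jint by simp
    from Jadd[OF r this] have "b - of_int (r mod int p) \<in> J" by simp
    moreover have "r mod int p \<in> {0..<int p}" using prime_gt_0_nat[OF p(1)] by simp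
    ultimately show ?thesis by blast
  qed
  then obtain \<rho> where \<rho>: "\<And>b. b \<in> orbit \<alpha> \<Longrightarrow> \<rho> b \<in> {0..<int p} \<and> b - of_int (\<rho> b) \<in> J" by metis
  have "inj_on \<rho> (orbit \<alpha>)"
  proof (rule inj_onI, rule ccontr)
    fix b c assume bc: "b \<in> orbit \<alpha>" "c \<in> orbit \<alpha>" "\<rho> b = \<rho> c" "b \<noteq> c"
    have "(b - of_int (\<rho> b)) - (c - of_int (\<rho> c)) \<in> J" using J(1) \<rho> bc(1,2) by blast
    then have "b - c \<in> J" using bc(3) by simp
    moreover obtain y where "y \<in> OK" "of_int E = (b - c) * y" using E[OF bc(1,2,4)] by blast
    ultimately have "of_int E \<in> J" using J(2) by simp
    then show False using Jint p(2) by blast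
  qed
  then have "card (\<rho> ` orbit \<alpha>) = card (orbit \<alpha>)" by (rule card_image)
  moreover have "int p dvd poly f (\<rho> b)" if b: "b \<in> orbit \<alpha>" for b
  proof -
    have "of_int (poly f (\<rho> b)) = poly (of_int_poly f) (of_int (\<rho> b) :: 'a)" by simp
    also have "\<dots> = (\<Prod>c\<in>orbit \<alpha>. of_int (\<rho> b) - c)" unfolding f poly_prod by simp
    also have "\<dots> = (of_int (\<rho> b) - b) * (\<Prod>c\<in>orbit \<alpha> - {b}. of_int (\<rho> b) - c)"
      using b orbit_finite(1)[OF aK] by (subst prod.remove) auto
    also have "\<dots> \<in> J"
    proof (rule J(2))
      have "- (b - of_int (\<rho> b)) \<in> J" using \<rho>[OF b] by (intro Jminus) auto
      then show "of_int (\<rho> b) - b \<in> J" by simp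
      show "(\<Prod>c\<in>orbit \<alpha> - {b}. of_int (\<rho> b) - c) \<in> OK"
        using orbOK by (intro OK_prod OK_diff OK_of_int) auto
    qed
    finally show ?thesis unfolding Jint .
  qed
  ultimately show ?thesis using \<rho> by (intro exI[of _ "\<rho> ` orbit \<alpha>"]) blast
qed

end

section \<open>Ideals of norm exactly divisible by a prime\<close>

text \<open>A subgroup of order \<open>p\<close> contains an element of order \<open>p\<close>,
  which is coprime to \<open>m\<close>. For the quotient by an ideal this says that \<open>m\<close>
  does not annihilate it.\<close>

lemma (in group) exists_pow_noteq_one:
  assumes fin: "finite (carrier G)" and ord: "Coset.order G = p * m" and p: "prime (p::nat)" "\<not> p dvd m"
  shows "\<exists>y\<in>carrier G. y [^] m \<noteq> \<one>"
proof -
  have "Coset.order G = p ^ 1 * m" using ord by simp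
  from sylow_thm[OF p(1) is_group this fin] obtain H where H: "subgroup H G" "card H = p" by auto
  have "card H > 1" using H p(1) prime_gt_1_nat by simp
  then have "\<exists>y\<in>H. y \<noteq> \<one>"
  proof -
    have "\<not> H \<subseteq> {\<one>}"
    proof
      assume "H \<subseteq> {\<one>}"
      then have "card H \<le> card {\<one>}" by (intro card_mono) auto
      with \<open>card H > 1\<close> show False by simp
    qed
    then show ?thesis by blast
  qed
  then obtain y where y: "y \<in> H" "y \<noteq> \<one>" by blast
  have yG: "y \<in> carrier G" using y(1) H(1) subgroup.subset by blast
  interpret S: group "G\<lparr>carrier := H\<rparr>" by (rule subgroup.subgroup_is_group[OF H(1) is_group])
  have "y [^]\<^bsub>G\<lparr>carrier := H\<rparr>\<^esub> Coset.order (G\<lparr>carrier := H\<rparr>) = \<one>\<^bsub>G\<lparr>carrier := H\<rparr>\<^esub>"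
    using y(1) by (intro S.pow_order_eq_1) simp
  then have yp: "y [^] p = \<one>" using H(2) by (simp add: Coset.order_def nat_pow_consistent[symmetric])
  have "y [^] m \<noteq> \<one>"
  proof
    assume "y [^] m = \<one>"
    then have "ord y dvd m" "ord y dvd p" using yp yG by (simp_all add: pow_eq_id)
    moreover have "coprime p m" using p by (rule prime_imp_coprime)
    ultimately have "ord y = 1" by (metis coprime_common_divisor_nat)
    then show False using y(2) ord_eq_1[OF yG] by blast
  qed
  with yG show ?thesis by blast
qed

text \<open>An injective map here would give a subgroup of order \<open>p\<^sup>2\<close>.\<close>

lemma (in comm_group) pow_pair_not_inj:
  assumes fin: "finite (carrier G)" and ord: "Coset.order G = p * m" and p: "prime (p::nat)" "\<not> p dvd m"
    and a: "a \<in> carrier G" "a [^] p = \<one>" and b: "b \<in> carrier G" "b [^] p = \<one>"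
  shows "\<not> inj_on (\<lambda>(i, j). a [^] i \<otimes> b [^] j) ({..<p} \<times> {..<p})"
proof
  assume inj: "inj_on (\<lambda>(i, j). a [^] i \<otimes> b [^] j) ({..<p} \<times> {..<p})"
  define H where "H = (\<lambda>(i, j). a [^] i \<otimes> b [^] j) ` ({..<p} \<times> {..<p})"
  have p0: "p > 0" using p(1) by (rule prime_gt_0_nat)
  have modp: "x [^] (k mod p) = x [^] k" if "x \<in> carrier G" "x [^] p = \<one>" for x and k :: nat
  proof -
    have "x [^] k = x [^] (p * (k div p) + k mod p)" by simp
    also have "\<dots> = (x [^] p) [^] (k div p) \<otimes> x [^] (k mod p)"
      using that(1) by (simp only: nat_pow_mult[symmetric] nat_pow_pow)
    also have "\<dots> = x [^] (k mod p)" using that by simp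
    finally show ?thesis by simp
  qed
  have inH: "a [^] i \<otimes> b [^] j \<in> H" for i j :: nat
  proof -
    have "a [^] (i mod p) \<otimes> b [^] (j mod p) \<in> H" unfolding H_def using p0 by (intro image_eqI[of _ _ "(i mod p, j mod p)"]) auto
    then show ?thesis by (simp only: modp[OF a] modp[OF b])
  qed
  have memH: "\<exists>(i::nat) (j::nat). x = a [^] i \<otimes> b [^] j" if "x \<in> H" for x
  proof -
    have "\<exists>q :: nat \<times> nat. x = (case q of (i, j) \<Rightarrow> a [^] i \<otimes> b [^] j)" using that unfolding H_def by blast
    then show ?thesis by auto
  qed
  have mult: "(a [^] i \<otimes> b [^] j) \<otimes> (a [^] k \<otimes> b [^] l) = a [^] (i + k) \<otimes> b [^] (j + l)" for i j k l :: nat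
    using a b by (simp add: nat_pow_mult[symmetric] m_ac)
  have "subgroup H G"
  proof (rule subgroupI)
    show "H \<subseteq> carrier G" using a b by (auto simp: H_def)
    show "H \<noteq> {}" using inH by blast
  next
    fix x assume "x \<in> H"
    then obtain i j :: nat where x: "x = a [^] i \<otimes> b [^] j" using memH by blast
    have "x \<otimes> (a [^] (i * (p - 1)) \<otimes> b [^] (j * (p - 1))) = a [^] (i + i * (p - 1)) \<otimes> b [^] (j + j * (p - 1))"
      unfolding x by (rule mult)
    also have "i + i * (p - 1) = p * i" using p0 by (simp add: algebra_simps diff_mult_distrib2)
    also have "j + j * (p - 1) = p * j" using p0 by (simp add: algebra_simps diff_mult_distrib2)
    also have "a [^] (p * i) \<otimes> b [^] (p * j) = \<one>"
      using a b by (simp add: nat_pow_pow[symmetric])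
    finally have "x \<otimes> (a [^] (i * (p - 1)) \<otimes> b [^] (j * (p - 1))) = \<one>" .
    then have "inv x = a [^] (i * (p - 1)) \<otimes> b [^] (j * (p - 1))"
      using a b x by (intro comm_inv_char) auto
    then show "inv x \<in> H" using inH by simp
  next
    fix x y assume "x \<in> H" "y \<in> H"
    then obtain i j k l :: nat where "x = a [^] i \<otimes> b [^] j" "y = a [^] k \<otimes> b [^] l" using memH by metis
    then show "x \<otimes> y \<in> H" using inH by (simp add: mult)
  qed
  from lagrange[OF this] have "card H dvd p * m" unfolding ord[symmetric] by (metis dvd_triv_right)
  moreover have "card H = p * p" unfolding H_def using inj by (simp add: card_image)
  ultimately have "p dvd m" using p0 by simp
  with p(2) show False by simp
qed

lemma ring_of_integers_simps [simp]:
  fixes K :: "'a::field_char_0 set"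
  shows "carrier (ring_of_integers K) = {x \<in> K. algebraic_int x}"
    "x \<otimes>\<^bsub>ring_of_integers K\<^esub> y = x * y" "x \<oplus>\<^bsub>ring_of_integers K\<^esub> y = x + y"
    "\<zero>\<^bsub>ring_of_integers K\<^esub> = 0" "\<one>\<^bsub>ring_of_integers K\<^esub> = 1"
  by (simp_all add: ring_of_integers_def ring_of_type_algebra_def)

context rational_galois
begin

lemma carrier_ring_of_integers: "carrier (ring_of_integers K) = OK"
  by (simp add: OK_def)

text \<open>For an ideal \<open>I\<close> of norm \<open>n = p m\<close> with \<open>p\<close> not dividing \<open>m\<close>, the quotient of the ring of integers
  by \<open>J = {x. m x \<in> I}\<close> is the prime field with \<open>p\<close> elements.\<close>

lemma ideal_residue_field:
  assumes I: "ideal I (ring_of_integers K)" and n: "ideal_norm K I = p * m" and p: "prime p" "\<not> p dvd m"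
  defines "J \<equiv> {x \<in> OK. of_nat m * x \<in> I}"
  shows "\<And>x y. x \<in> J \<Longrightarrow> y \<in> J \<Longrightarrow> x - y \<in> J" "\<And>x y. x \<in> J \<Longrightarrow> y \<in> OK \<Longrightarrow> x * y \<in> J"
    "\<And>k. of_int k \<in> J \<longleftrightarrow> int p dvd k" "\<And>x. x \<in> OK \<Longrightarrow> \<exists>r. x - of_int r \<in> J"
proof -
  define R where "R = ring_of_integers K"
  interpret I: ideal I R using I by (simp add: R_def)
  have RS: "carrier R = OK" "\<And>x y. x \<otimes>\<^bsub>R\<^esub> y = x * y" "\<And>x y. x \<oplus>\<^bsub>R\<^esub> y = x + y" "\<zero>\<^bsub>R\<^esub> = 0"
    by (simp_all add: R_def OK_def)
  have IO: "I \<subseteq> OK" using I.a_subset RS by simp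
  have Iadd: "x + y \<in> I" if "x \<in> I" "y \<in> I" for x y
    using additive_subgroup.a_closed[OF I.is_additive_subgroup that] RS by simp
  have Imult: "x * y \<in> I" if "x \<in> I" "y \<in> OK" for x y
    using I.I_r_closed[of x y] that RS by simp
  have I0: "0 \<in> I" using additive_subgroup.zero_closed[OF I.is_additive_subgroup] RS by simp
  have Iminus: "- x \<in> I" if "x \<in> I" for x using Imult[OF that OK_of_int[of "-1"]] by simp
  have Idiff: "x - y \<in> I" if "x \<in> I" "y \<in> I" for x y using Iadd[OF that(1) Iminus[OF that(2)]] by simp
  have p1: "p > 1" using p(1) by (rule prime_gt_1_nat)
  have m0: "m > 0" using p(2) by (cases m) auto
  \<comment> \<open>The counting takes place in the additive group of the quotient, written
    multiplicatively: a power is a multiple of a coset.\<close>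
  define Q where "Q = add_monoid (R Quot I)"
  interpret Q: comm_group Q
    unfolding Q_def by (rule abelian_group.a_comm_group[OF ring.is_abelian_group[OF I.quotient_is_ring]])
  define cs where "cs x = I +>\<^bsub>R\<^esub> x" for x
  have cs_eq: "cs x = (\<lambda>i. i + x) ` I" for x
    by (auto simp: cs_def a_r_coset_def' RS)
  have cs_iff: "cs x = cs y \<longleftrightarrow> x - y \<in> I" for x y
  proof
    assume "cs x = cs y"
    moreover have "x \<in> cs x" unfolding cs_eq using I0 by force
    ultimately obtain i where "i \<in> I" "x = i + y" by (auto simp: cs_eq)
    then show "x - y \<in> I" by simp
  next
    assume xy: "x - y \<in> I"
    have "i + x \<in> cs y" if "i \<in> I" for i
      unfolding cs_eq using Iadd[OF that xy] by (intro image_eqI[of _ _ "i + (x - y)"]) auto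
    moreover have "i + y \<in> cs x" if "i \<in> I" for i
      unfolding cs_eq using Idiff[OF that xy] by (intro image_eqI[of _ _ "i - (x - y)"]) auto
    ultimately show "cs x = cs y" by (auto simp: cs_eq)
  qed
  have carQ: "carrier Q = cs ` OK"
    by (auto simp: Q_def FactRing_def A_RCOSETS_def' RS cs_def)
  have oneQ: "\<one>\<^bsub>Q\<^esub> = cs 0"
    using I0 by (auto simp: Q_def FactRing_def cs_eq)
  have multQ: "cs x \<otimes>\<^bsub>Q\<^esub> cs y = cs (x + y)" if "x \<in> OK" "y \<in> OK" for x y
    using I.a_rcos_sum[of x y] that by (simp add: Q_def FactRing_def cs_def RS)
  have powQ: "cs x [^]\<^bsub>Q\<^esub> k = cs (of_nat k * x)" if x: "x \<in> OK" for x and k :: nat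
  proof (induction k)
    case 0
    show ?case by (simp add: oneQ)
  next
    case (Suc k)
    have "cs x [^]\<^bsub>Q\<^esub> Suc k = cs (of_nat k * x) \<otimes>\<^bsub>Q\<^esub> cs x" by (simp add: Suc)
    also have "\<dots> = cs (of_nat k * x + x)" by (intro multQ OK_mult OK_of_nat x)
    finally show ?case by (simp add: algebra_simps)
  qed
  have ordQ: "Coset.order Q = p * m"
    using n by (simp add: Coset.order_def Q_def ideal_norm_def R_def)
  have finQ: "finite (carrier Q)"
    using ordQ p1 m0 unfolding Coset.order_def by (intro card_ge_0_finite) simp
  have nI: "of_nat (p * m) * x \<in> I" if x: "x \<in> OK" for x
  proof -
    have "cs x [^]\<^bsub>Q\<^esub> Coset.order Q = \<one>\<^bsub>Q\<^esub>" using x by (intro Q.pow_order_eq_1) (auto simp: carQ)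
    then show ?thesis unfolding ordQ powQ[OF x] oneQ cs_iff by simp
  qed
  have pJ: "of_nat p * x \<in> J" if x: "x \<in> OK" for x
    using nI[OF x] x by (simp add: J_def OK_mult OK_of_nat mult_ac)
  show J1: "x - y \<in> J" if "x \<in> J" "y \<in> J" for x y
    using that by (simp add: J_def OK_diff right_diff_distrib Idiff)
  show J2: "x * y \<in> J" if "x \<in> J" "y \<in> OK" for x y
    using that by (auto simp: J_def OK_mult mult.assoc[symmetric] intro: Imult)
  have J0: "0 \<in> J" using I0 by (simp add: J_def OK_0)
  have Jadd: "x + y \<in> J" if "x \<in> J" "y \<in> J" for x y
    using J1[OF that(1) J1[OF J0 that(2)]] by simp
  \<comment> \<open>Otherwise \<open>m\<close> would annihilate the quotient, contrary to Sylow's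
    theorem for the factor \<open>p\<close> of its order.\<close>
  have not1: "1 \<notin> J"
  proof
    assume "1 \<in> J"
    then have mI: "of_nat m \<in> I" by (simp add: J_def)
    obtain y where y: "y \<in> carrier Q" "y [^]\<^bsub>Q\<^esub> m \<noteq> \<one>\<^bsub>Q\<^esub>"
      using Q.exists_pow_noteq_one[OF finQ ordQ p] by blast
    then obtain x where x: "x \<in> OK" "y = cs x" by (auto simp: carQ)
    have "of_nat m * x \<in> I" using Imult[OF mI x(1)] .
    then have "y [^]\<^bsub>Q\<^esub> m = \<one>\<^bsub>Q\<^esub>" unfolding x(2) powQ[OF x(1)] oneQ cs_iff by simp
    with y(2) show False by simp
  qed
  have inverse: "\<exists>t l. t * k + l * int p = 1" if "\<not> int p dvd k" for k
  proof -
    have "prime (int p)" using p(1) by simp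
    then have "coprime k (int p)" using that by (metis coprime_commute prime_imp_coprime)
    then have "gcd k (int p) = 1" by (simp add: coprime_iff_gcd_eq_1)
    then show ?thesis using bezout_int[of k "int p"] by metis
  qed
  show Jint: "of_int k \<in> J \<longleftrightarrow> int p dvd k" for k
  proof
    assume "int p dvd k"
    then obtain l where "k = int p * l" by (auto elim: dvdE)
    then show "of_int k \<in> J" using pJ[OF OK_of_int[of l]] by simp
  next
    assume kJ: "of_int k \<in> J"
    show "int p dvd k"
    proof (rule ccontr)
      assume "\<not> int p dvd k"
      then obtain t l where tl: "t * k + l * int p = 1" using inverse by blast
      have "of_int k * of_int t + of_nat p * of_int l \<in> J"
        by (intro Jadd J2 kJ pJ OK_of_int)
      moreover have "of_int k * of_int t + of_nat p * of_int l = (of_int (t * k + l * int p) :: 'a)"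
        by (simp add: mult_ac)
      ultimately show False using not1 tl by simp
    qed
  qed
  show "\<exists>r. x - of_int r \<in> J" if x: "x \<in> OK" for x
  proof -
    \<comment> \<open>The cosets of \<open>m\<close> and \<open>m * x\<close> are killed by
      \<open>p\<close>. As a subgroup of order \<open>p * p\<close> is impossible, they satisfy a
      relation, which reads \<open>u + v * x \<in> J\<close> with \<open>u\<close> and
      \<open>v\<close> not both zero and smaller than \<open>p\<close> in absolute value.\<close>
    define a b where ab: "a = cs (of_nat m)" "b = cs (of_nat m * x)"
    have mO: "of_nat m \<in> OK" "of_nat m * x \<in> OK" using x by (simp_all add: OK_of_nat OK_mult)
    have abc: "a \<in> carrier Q" "b \<in> carrier Q" using mO by (simp_all add: ab carQ)
    have apow: "a [^]\<^bsub>Q\<^esub> p = \<one>\<^bsub>Q\<^esub>"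
      unfolding ab powQ[OF mO(1)] oneQ cs_iff using nI[OF OK_1] by simp
    have bpow: "b [^]\<^bsub>Q\<^esub> p = \<one>\<^bsub>Q\<^esub>"
      unfolding ab powQ[OF mO(2)] oneQ cs_iff using nI[OF x] by (simp add: mult.assoc)
    from Q.pow_pair_not_inj[OF finQ ordQ p abc(1) apow abc(2) bpow]
    obtain i j i' j' where ij: "i < p" "j < p" "i' < p" "j' < p" "(i, j) \<noteq> (i', j')"
      "a [^]\<^bsub>Q\<^esub> i \<otimes>\<^bsub>Q\<^esub> b [^]\<^bsub>Q\<^esub> j = a [^]\<^bsub>Q\<^esub> i' \<otimes>\<^bsub>Q\<^esub> b [^]\<^bsub>Q\<^esub> j'"
      by (auto simp: inj_on_def)
    have ev: "a [^]\<^bsub>Q\<^esub> i \<otimes>\<^bsub>Q\<^esub> b [^]\<^bsub>Q\<^esub> j = cs (of_nat i * of_nat m + of_nat j * (of_nat m * x))" for i j :: nat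
      unfolding ab powQ[OF mO(1)] powQ[OF mO(2)] by (intro multQ OK_mult OK_of_nat x)
    define u v where uv: "u = int i - int i'" "v = int j - int j'"
    have "of_nat m * (of_int u + of_int v * x) \<in> I"
      using ij(6) unfolding ev cs_iff by (simp add: uv algebra_simps)
    moreover have "of_int u + of_int v * x \<in> OK" by (intro OK_add OK_mult OK_of_int x)
    ultimately have uvJ: "of_int u + of_int v * x \<in> J" by (simp add: J_def)
    have bound: "w = 0" if "int p dvd w" "\<bar>w\<bar> < int p" for w
      using that zdvd_imp_le[of "int p" "\<bar>w\<bar>"] by (cases "w = 0") auto
    \<comment> \<open>With this, \<open>v\<close> is invertible modulo \<open>p\<close>, and solving
      the relation for \<open>x\<close> gives the integer residue.\<close>
    have "v \<noteq> 0"
    proof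
      assume "v = 0"
      then have "int p dvd u" using uvJ Jint[of u] by simp
      moreover have "\<bar>u\<bar> < int p" using ij(1,3) by (simp add: uv)
      ultimately have "u = 0" by (rule bound)
      with \<open>v = 0\<close> ij(5) show False by (simp add: uv)
    qed
    moreover have "\<bar>v\<bar> < int p" using ij(2,4) by (simp add: uv)
    ultimately have "\<not> int p dvd v" using bound by blast
    then obtain t l where tl: "t * v + l * int p = 1" using inverse by blast
    have "(of_int u + of_int v * x) * of_int t + of_nat p * (of_int l * x) \<in> J"
      by (intro Jadd J2 uvJ pJ OK_of_int OK_mult x)
    also have "(of_int u + of_int v * x) * of_int t + of_nat p * (of_int l * x) =
        of_int (t * v + l * int p) * x - of_int (- u * t)"
      by (simp add: algebra_simps)
    finally have "x - of_int (- u * t) \<in> J" unfolding tl by simp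
    then show ?thesis by blast
  qed
qed

end

section \<open>Number fields as subsets of a type\<close>

lemma ambient_simps [simp]:
  "carrier (ambient :: 'a::field_char_0 ring) = UNIV"
  "x \<otimes>\<^bsub>(ambient :: 'a ring)\<^esub> y = x * y" "x \<oplus>\<^bsub>(ambient :: 'a ring)\<^esub> y = x + y"
  "\<zero>\<^bsub>(ambient :: 'a ring)\<^esub> = 0" "\<one>\<^bsub>(ambient :: 'a ring)\<^esub> = 1"
  by (simp_all add: ring_of_type_algebra_def)

lemma field_ambient: "Ring.field (ambient :: 'a::field_char_0 ring)"
  by (rule field_from_type_algebra)

lemma ambient_minus [simp]: "\<ominus>\<^bsub>(ambient :: 'a::field_char_0 ring)\<^esub> x = - x"
proof -
  interpret A: Ring.field "ambient :: 'a ring" by (rule field_ambient)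
  show ?thesis by (rule A.minus_equality) simp_all
qed

lemma ambient_inverse:
  assumes "x \<noteq> (0::'a::field_char_0)"
  shows "inv\<^bsub>(ambient :: 'a ring)\<^esub> x = inverse x"
proof -
  interpret A: Ring.field "ambient :: 'a ring" by (rule field_ambient)
  show ?thesis using assms by (intro A.comm_inv_char) simp_all
qed

lemma subfield_ambient_closed:
  fixes K :: "'a::field_char_0 set"
  assumes "subfield K ambient"
  shows "0 \<in> K" "1 \<in> K" "\<And>x y. x \<in> K \<Longrightarrow> y \<in> K \<Longrightarrow> x + y \<in> K" "\<And>x y. x \<in> K \<Longrightarrow> y \<in> K \<Longrightarrow> x * y \<in> K"
    "\<And>x. x \<in> K \<Longrightarrow> - x \<in> K" "\<And>x. x \<in> K \<Longrightarrow> inverse x \<in> K"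
proof -
  interpret A: Ring.field "ambient :: 'a ring" by (rule field_ambient)
  note E = subringE[OF subfieldE(1)[OF assms]]
  show "0 \<in> K" "1 \<in> K" using E(2,3) by simp_all
  then show "inverse x \<in> K" if "x \<in> K" for x
    using A.subfield_m_inv(1)[OF assms, of x] that ambient_inverse[of x] by (cases "x = 0") auto
  show "x + y \<in> K" "x * y \<in> K" if "x \<in> K" "y \<in> K" for x y
    using E(7)[OF that] E(6)[OF that] by simp_all
  show "- x \<in> K" if "x \<in> K" for x using E(5)[OF that] by simp
qed

lemma subfield_Rats_ambient: "subfield (\<rat> :: 'a::field_char_0 set) ambient"
proof -
  interpret A: Ring.field "ambient :: 'a ring" by (rule field_ambient)
  show ?thesis
  proof (rule A.subfieldI')
    show "subring \<rat> (ambient :: 'a ring)" by (rule A.subringI) simp_all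
    fix k :: 'a assume "k \<in> \<rat> - {\<zero>\<^bsub>ambient\<^esub>}"
    then show "inv\<^bsub>ambient\<^esub> k \<in> \<rat>" by (simp add: ambient_inverse)
  qed
qed

lemma combine_ambient:
  fixes Us :: "'a::field_char_0 list"
  assumes "length Ks = length Us"
  shows "ring.combine ambient Ks Us = (\<Sum>i<length Us. Ks ! i * Us ! i)"
proof -
  interpret A: Ring.field "ambient :: 'a ring" by (rule field_ambient)
  show ?thesis using assms
  proof (induction Ks Us rule: list_induct2)
    case (Cons k Ks u Us)
    then show ?case by (simp add: lessThan_Suc_eq_insert_0 sum.reindex del: sum.lessThan_Suc)
  qed simp
qed

lemma powers_dependent:
  fixes x :: "'a::field_char_0"
  assumes dim: "ring.dimension ambient n \<rat> K" and K: "\<And>i. x ^ i \<in> K"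
  shows "\<exists>p::rat poly. p \<noteq> 0 \<and> degree p \<le> n \<and> poly (map_poly of_rat p) x = 0"
proof -
  interpret A: Ring.field "ambient :: 'a ring" by (rule field_ambient)
  define Us where "Us = map (\<lambda>i. x ^ i) [0..<Suc n]"
  have "\<not> A.independent \<rat> Us"
  proof
    assume "A.independent \<rat> Us"
    moreover have "set Us \<subseteq> K" using K by (auto simp: Us_def)
    ultimately have "length Us \<le> n"
      by (rule A.independent_length_le_dimension[OF subfield_Rats_ambient dim])
    then show False by (simp add: Us_def)
  qed
  moreover have "set Us \<subseteq> carrier ambient" by simp
  ultimately obtain Ks where "length Ks = length Us" "A.combine Ks Us = \<zero>\<^bsub>ambient\<^esub>" "set Ks \<subseteq> \<rat>"
      "set Ks \<noteq> {\<zero>\<^bsub>ambient\<^esub>}"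
    by (elim A.dependent_imp_non_trivial_combine[OF subfield_Rats_ambient, rotated])
  then have Ks: "length Ks = length Us" "A.combine Ks Us = 0" "set Ks \<subseteq> \<rat>" "set Ks \<noteq> {0}"
    by (simp_all only: ambient_simps not_False_eq_True)
  have len: "length Ks = Suc n" using Ks(1) by (simp add: Us_def)
  have "\<exists>q. Ks ! i = of_rat q" if "i < Suc n" for i
    using that Ks(3) len by (metis Rats_cases nth_mem subsetD)
  then obtain q where q: "\<And>i. i < Suc n \<Longrightarrow> Ks ! i = of_rat (q i)" by metis
  define p where "p = (\<Sum>i<Suc n. monom (q i) i)"
  have co: "coeff p i = (if i < Suc n then q i else 0)" for i
    unfolding p_def coeff_sum by (simp add: sum.delta)
  have "p \<noteq> 0"
  proof
    assume "p = 0"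
    have "Ks ! i = 0" if "i < Suc n" for i
      using co[of i] q[OF that] that \<open>p = 0\<close> by simp
    then have "set Ks \<subseteq> {0}" using len by (auto simp: in_set_conv_nth)
    moreover have "set Ks \<noteq> {}" using len by auto
    ultimately show False using Ks(4) by (metis subset_singletonD)
  qed
  moreover have dp: "degree p \<le> n" by (rule degree_le) (simp add: co)
  moreover have "poly (map_poly of_rat p) x = 0"
  proof -
    have "0 = (\<Sum>i<Suc n. Ks ! i * x ^ i)"
      using Ks(2) combine_ambient[OF Ks(1)] by (simp add: Us_def nth_append del: upt_Suc sum.lessThan_Suc)
    also have "\<dots> = (\<Sum>i<Suc n. of_rat (coeff p i) * x ^ i)"
      by (intro sum.cong refl) (simp add: co q)
    also have "\<dots> = (\<Sum>i\<le>degree (map_poly of_rat p :: 'a poly). coeff (map_poly of_rat p) i * x ^ i)"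
      using dp by (intro sum.mono_neutral_cong_right) (auto simp: coeff_map_poly coeff_eq_0 not_le)
    also have "\<dots> = poly (map_poly of_rat p) x" by (rule poly_altdef[symmetric])
    finally show ?thesis by simp
  qed
  ultimately show ?thesis by blast
qed

text \<open>The first \<open>d\<close> powers of \<open>x\<close> span \<open>K\<close>. An
  independent list of length at most \<open>d\<close> with at least the same span is extracted from
  them, and a basis of \<open>K\<close> cannot be longer than that list.\<close>

lemma dimension_le_generator:
  fixes x :: "'a::field_char_0"
  assumes dim: "ring.dimension ambient n \<rat> K"
    and gen: "\<And>y. y \<in> K \<Longrightarrow> \<exists>p::rat poly. (\<forall>i\<ge>d. coeff p i = 0) \<and> y = poly (map_poly of_rat p) x"
  shows "n \<le> d"
proof -
  interpret A: Ring.field "ambient :: 'a ring" by (rule field_ambient)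
  note Q = subfield_Rats_ambient[where 'a = 'a]
  have base: "\<exists>Vs. length Vs \<le> length Us \<and> A.independent \<rat> Vs \<and> A.Span \<rat> Us \<subseteq> A.Span \<rat> Vs" for Us
  proof (induction Us)
    case Nil
    show ?case by (intro exI[of _ "[]"]) auto
  next
    case (Cons u Us)
    then obtain Vs where Vs: "length Vs \<le> length Us" "A.independent \<rat> Vs" "A.Span \<rat> Us \<subseteq> A.Span \<rat> Vs" by blast
    have inc: "set (u # Us) \<subseteq> A.Span \<rat> Vs \<Longrightarrow> A.Span \<rat> (u # Us) \<subseteq> A.Span \<rat> Vs" for Vs
      by (rule A.mono_Span_subset[OF Q]) simp_all
    have Us: "set Us \<subseteq> A.Span \<rat> Vs" using A.Span_base_incl[OF Q, of Us] Vs(3) by auto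
    show ?case
    proof (cases "u \<in> A.Span \<rat> Vs")
      case True
      then show ?thesis using Vs Us inc[of Vs] by (intro exI[of _ Vs]) auto
    next
      case False
      then have "A.independent \<rat> (u # Vs)" using Vs(2) by (intro A.li_Cons) simp_all
      moreover have "A.Span \<rat> (u # Us) \<subseteq> A.Span \<rat> (u # Vs)"
      proof (rule inc)
        have "A.Span \<rat> Vs \<subseteq> A.Span \<rat> (u # Vs)"
          using A.Span_base_incl[OF Q, of "u # Vs"] by (intro A.mono_Span_subset[OF Q]) auto
        then show "set (u # Us) \<subseteq> A.Span \<rat> (u # Vs)"
          using Us A.Span_base_incl[OF Q, of "u # Vs"] by auto
      qed
      ultimately show ?thesis using Vs(1) by (intro exI[of _ "u # Vs"]) simp
    qed
  qed
  define Us where "Us = map (\<lambda>i. x ^ i) [0..<d]"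
  have K: "K \<subseteq> A.Span \<rat> Us"
  proof
    fix y assume "y \<in> K"
    then obtain p :: "rat poly" where p: "\<And>i. i \<ge> d \<Longrightarrow> coeff p i = 0" "y = poly (map_poly of_rat p) x"
      using gen by blast
    define Ks where "Ks = map (\<lambda>i. of_rat (coeff p i) :: 'a) [0..<d]"
    have len: "length Ks = length Us" by (simp add: Ks_def Us_def)
    have "y = (\<Sum>i\<le>degree (map_poly of_rat p :: 'a poly). coeff (map_poly of_rat p) i * x ^ i)"
      unfolding p(2) by (rule poly_altdef)
    also have "\<dots> = (\<Sum>i\<in>{i. i < d \<or> i \<le> degree p}. of_rat (coeff p i) * x ^ i)"
      by (intro sum.mono_neutral_cong_left) (auto simp: coeff_map_poly coeff_eq_0 not_le finite_nat_set_iff_bounded_le intro!: exI[of _ "d + degree p"])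
    also have "\<dots> = (\<Sum>i<d. of_rat (coeff p i) * x ^ i)"
      by (intro sum.mono_neutral_cong_right) (auto simp: p(1) not_less finite_nat_set_iff_bounded_le intro!: exI[of _ "d + degree p"])
    also have "\<dots> = A.combine Ks Us"
      unfolding combine_ambient[OF len] by (simp add: Ks_def Us_def)
    finally have "y = A.combine Ks Us" .
    moreover have "set Ks \<subseteq> \<rat>" by (auto simp: Ks_def)
    ultimately show "y \<in> A.Span \<rat> Us"
      using A.Span_mem_iff_length_version[OF Q, of Us y] len by auto
  qed
  obtain Vs where Vs: "length Vs \<le> length Us" "A.independent \<rat> Vs" "A.Span \<rat> Us \<subseteq> A.Span \<rat> Vs"
    using base by blast
  obtain Bs where Bs: "A.independent \<rat> Bs" "length Bs = n" "A.Span \<rat> Bs = K"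
    using A.exists_base[OF Q dim] by blast
  have "set Bs \<subseteq> A.Span \<rat> Vs"
    using A.Span_base_incl[OF Q, of Bs] Bs(3) K Vs(3) by auto
  then have "length Bs \<le> length Vs" by (rule A.independent_length_le[OF Q Bs(1) Vs(2)])
  then show ?thesis using Bs(2) Vs(1) by (simp add: Us_def)
qed

lemma rational_galois_number_field:
  fixes K :: "'a::field_char_0 set"
  assumes nf: "number_field K" and gal: "galois_over \<rat> K" and dim: "ring.dimension ambient n \<rat> K"
  shows "rational_galois K (field_automorphisms \<rat> K) n"
proof
  have "subfield K ambient" using nf by (simp add: number_field_def)
  note sc = subfield_ambient_closed[OF this]
  show "0 \<in> K" "1 \<in> K" by (fact sc)+
  show "x + y \<in> K" "x * y \<in> K" if "x \<in> K" "y \<in> K" for x y using sc(3)[OF that] sc(4)[OF that] by simp_all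
  show "- x \<in> K" "inverse x \<in> K" if "x \<in> K" for x using sc(5)[OF that] sc(6)[OF that] by simp_all
  define R where "R = (ambient :: 'a ring)\<lparr>carrier := K\<rparr>"
  have R: "carrier R = K" "\<And>x y. x \<otimes>\<^bsub>R\<^esub> y = x * y" "\<And>x y. x \<oplus>\<^bsub>R\<^esub> y = x + y" "\<one>\<^bsub>R\<^esub> = 1"
    by (simp_all add: R_def)
  have G: "\<sigma> \<in> field_automorphisms \<rat> K \<longleftrightarrow> \<sigma> \<in> ring_iso R R \<and> (\<forall>x\<in>\<rat>. \<sigma> x = x)" for \<sigma>
    by (simp add: field_automorphisms_def R_def)
  show "\<sigma> x \<in> K" if "\<sigma> \<in> field_automorphisms \<rat> K" "x \<in> K" for \<sigma> x
    using that ring_iso_memE(1)[of \<sigma> R R x] by (simp add: G R)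
  show "\<sigma> (x + y) = \<sigma> x + \<sigma> y" "\<sigma> (x * y) = \<sigma> x * \<sigma> y"
    if "\<sigma> \<in> field_automorphisms \<rat> K" "x \<in> K" "y \<in> K" for \<sigma> x y
    using that ring_iso_memE(2,3)[of \<sigma> R R x y] by (simp_all add: G R)
  show "\<sigma> x = x" if "\<sigma> \<in> field_automorphisms \<rat> K" "x \<in> \<rat>" for \<sigma> x
    using that by (simp add: G)
  show "\<exists>\<rho>\<in>field_automorphisms \<rat> K. \<forall>x\<in>K. \<rho> x = \<sigma> (\<tau> x)"
    if "\<sigma> \<in> field_automorphisms \<rat> K" "\<tau> \<in> field_automorphisms \<rat> K" for \<sigma> \<tau>
    using that ring_iso_set_trans[of \<tau> R R \<sigma> R] by (intro bexI[of _ "\<sigma> \<circ> \<tau>"]) (auto simp: G)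
  show "\<exists>\<rho>\<in>field_automorphisms \<rat> K. \<forall>x\<in>K. \<rho> x = x"
    by (intro bexI[of _ "\<lambda>x. x"]) (auto simp: G R bij_betw_def intro!: ring_iso_memI)
  show "x \<in> \<rat>" if "x \<in> K" "\<And>\<sigma>. \<sigma> \<in> field_automorphisms \<rat> K \<Longrightarrow> \<sigma> x = x" for x
    using gal that by (auto simp: galois_over_def)
  show "\<exists>p::rat poly. p \<noteq> 0 \<and> degree p \<le> n \<and> poly (map_poly of_rat p) x = 0" if "x \<in> K" for x
  proof (rule powers_dependent[OF dim])
    show "x ^ i \<in> K" for i using that by (induction i) (auto intro: sc)
  qed
  show "n \<le> d" if "\<alpha> \<in> K" "\<And>\<gamma>. \<gamma> \<in> K \<Longrightarrow> \<exists>p::rat poly. (\<forall>i\<ge>d. coeff p i = 0) \<and> \<gamma> = poly (map_poly of_rat p) \<alpha>" for \<alpha> d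
    using dimension_le_generator[OF dim that(2)] by blast
qed

section \<open>Counting the norms of ideals\<close>

context rational_galois
begin

lemma n0_pos: "n0 > 0"
proof (rule ccontr)
  assume "\<not> n0 > 0"
  with dep[OF K1] obtain p :: "rat poly" where p: "p \<noteq> 0" "degree p = 0" "poly (map_poly of_rat p) (1::'a) = 0"
    by auto
  then obtain c where "p = [:c:]" by (auto elim: degree_eq_zeroE)
  with p show False by (auto simp: map_poly_pCons)
qed

lemma card_ideal_norms_le:
  "\<exists>C\<ge>0. \<forall>x::real\<ge>3. real (card {n. n > 0 \<and> real n \<le> x \<and> (\<exists>I. ideal I (ring_of_integers K) \<and> ideal_norm K I = n)})
     \<le> C * (x / ln x powr (1 - 1 / real n0))"
proof -
  obtain \<alpha> where \<alpha>: "\<alpha> \<in> OK" "\<And>x. x \<in> K \<Longrightarrow> card (orbit x) \<le> card (orbit \<alpha>)"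
    using exists_integral_maximal_orbit by blast
  have \<alpha>K: "\<alpha> \<in> K" using \<alpha>(1) by (simp add: OK_def)
  define d where "d = card (orbit \<alpha>)"
  have "n0 \<le> d" unfolding d_def using maximal_orbit_generates[OF \<alpha>K \<alpha>(2)] by (intro span[OF \<alpha>K])
  obtain f where f: "of_int_poly f = (\<Prod>b\<in>orbit \<alpha>. [:- b, 1:])"
    using orbit_polynomial[OF \<alpha>(1)] by blast
  interpret f: monic_bezout_poly f d unfolding d_def by (rule orbit_polynomial_bezout[OF \<alpha>K f])
  obtain E :: int where E: "E \<noteq> 0"
    "\<And>b c. b \<in> orbit \<alpha> \<Longrightarrow> c \<in> orbit \<alpha> \<Longrightarrow> b \<noteq> c \<Longrightarrow> \<exists>y\<in>OK. of_int E = (b - c) * y"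
    using orbit_discriminant[OF \<alpha>(1)] by blast
  define S0 where "S0 = {p::nat. prime p \<and> (\<exists>R. R \<subseteq> {0..<int p} \<and> card R = d \<and> (\<forall>r\<in>R. int p dvd poly f r))}"
  define B0 where "B0 = {p::nat. prime p \<and> int p dvd E}"
  have finB0: "finite B0"
  proof (rule finite_subset)
    show "B0 \<subseteq> {..nat \<bar>E\<bar>}"
    proof
      fix p assume "p \<in> B0"
      then have "int p \<le> \<bar>E\<bar>" using E(1) by (intro zdvd_imp_le) (auto simp: B0_def)
      then show "p \<in> {..nat \<bar>E\<bar>}" by simp
    qed
  qed simp
  define C1 where "C1 = ln (3 * real f.rem_bound ^ 2) + ln 4 + real d * (2 * (2 ^ d * ln 4))"
  define C0 where "C0 = C1 + (\<Sum>p\<in>B0. ln (real p) / real p)"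
  have term0: "0 \<le> ln (real p) / real p" if "prime p" for p
    using prime_gt_1_nat[OF that] by (simp add: ln_ge_zero)
  have bound: "(\<Sum>p\<in>{p \<in> S0 \<union> B0. p \<le> 2 ^ (J * d)}. ln (real p) / real p) \<le> real J * ln 2 + C0" for J
  proof -
    define S1 where "S1 = {p \<in> S0. p \<le> 2 ^ (J * d)}"
    have finS1: "finite S1" unfolding S1_def by (rule finite_subset[of _ "{..2 ^ (J * d)}"]) auto
    have "\<forall>p\<in>S0. \<exists>R. R \<subseteq> {0..<int p} \<and> card R = d \<and> (\<forall>r\<in>R. int p dvd poly f r)"
      by (simp add: S0_def)
    from bchoice[OF this] obtain R where
      R: "\<And>p. p \<in> S0 \<Longrightarrow> R p \<subseteq> {0..<int p} \<and> card (R p) = d \<and> (\<forall>r\<in>R p. int p dvd poly f r)"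
      by blast
    have "(\<Sum>p\<in>S1. ln (real p) / real p) \<le> real J * ln 2 + C1"
      unfolding C1_def
    proof (rule f.sum_splitting_primes_le[where R = R])
      show "prime p" if "p \<in> S1" for p using that by (simp add: S1_def S0_def)
      show "R p \<subseteq> {0..<int p} \<and> card (R p) = d" if "p \<in> S1" for p using that R[of p] by (simp add: S1_def)
      show "int p dvd poly f r" if "p \<in> S1" "r \<in> R p" for p r using that R[of p] by (simp add: S1_def)
      show "p \<le> 2 ^ (J * d)" if "p \<in> S1" for p using that by (simp add: S1_def)
    qed (rule finS1)
    have "(\<Sum>p\<in>{p \<in> S0 \<union> B0. p \<le> 2 ^ (J * d)}. ln (real p) / real p) \<le> (\<Sum>p\<in>S1 \<union> B0. ln (real p) / real p)"
      using finS1 finB0 by (intro sum_mono2) (auto simp: S1_def S0_def B0_def intro: term0)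
    also have "\<dots> \<le> (\<Sum>p\<in>S1. ln (real p) / real p) + (\<Sum>p\<in>B0. ln (real p) / real p)"
    proof -
      have "(\<Sum>p\<in>S1 \<union> B0. ln (real p) / real p) + (\<Sum>p\<in>S1 \<inter> B0. ln (real p) / real p) =
          (\<Sum>p\<in>S1. ln (real p) / real p) + (\<Sum>p\<in>B0. ln (real p) / real p)"
        by (rule sum.union_inter[OF finS1 finB0])
      moreover have "0 \<le> (\<Sum>p\<in>S1 \<inter> B0. ln (real p) / real p)"
        by (intro sum_nonneg term0) (auto simp: B0_def)
      ultimately show ?thesis by linarith
    qed
    also have "\<dots> \<le> real J * ln 2 + C0"
      using \<open>(\<Sum>p\<in>S1. ln (real p) / real p) \<le> real J * ln 2 + C1\<close> by (simp add: C0_def)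
    finally show ?thesis .
  qed
  obtain C where C: "C \<ge> 0" "\<And>x::real. x \<ge> 3 \<Longrightarrow> real (card {n \<in> simple_primes_in (S0 \<union> B0). real n \<le> x}) \<le> C * (x / ln x powr (1 - 1 / real d))"
    using card_simple_primes_in_le[OF f.dpos, of "S0 \<union> B0", OF _ bound] by (auto simp: S0_def B0_def)
  have norms: "n \<in> simple_primes_in (S0 \<union> B0)" if n: "n > 0" and I: "ideal I (ring_of_integers K)" "ideal_norm K I = n" for n I
  proof -
    have "p \<in> S0 \<union> B0" if p: "prime p" "multiplicity p n = 1" for p
    proof (cases "int p dvd E")
      case True
      then show ?thesis using p by (simp add: B0_def)
    next
      case False
      have "p dvd n" using p(2) by (metis not_dvd_imp_multiplicity_0 zero_neq_one)
      then obtain m where m: "n = p * m" by (auto elim: dvdE)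
      have "\<not> p dvd m"
      proof
        assume "p dvd m"
        then have "p ^ 2 dvd n" unfolding m power2_eq_square by (rule mult_dvd_mono[OF dvd_refl])
        then have "2 \<le> multiplicity p n" using n p(1) by (intro multiplicity_geI) (auto dest: prime_gt_1_nat)
        with p(2) show False by simp
      qed
      note J = ideal_residue_field[OF I(1) I(2)[unfolded m] p(1) this]
      have "\<exists>R. R \<subseteq> {0..<int p} \<and> card R = card (orbit \<alpha>) \<and> (\<forall>r\<in>R. int p dvd poly f r)"
        by (rule residues_of_orbit[OF \<alpha>(1) f E(2) J p(1) False])
      then show ?thesis using p(1) by (simp add: S0_def d_def)
    qed
    then show ?thesis using n by (simp add: simple_primes_in_def)
  qed
  have "real (card {n. n > 0 \<and> real n \<le> x \<and> (\<exists>I. ideal I (ring_of_integers K) \<and> ideal_norm K I = n)})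
     \<le> C * (x / ln x powr (1 - 1 / real n0))" if x: "x \<ge> 3" for x :: real
  proof -
    have lnx: "ln x \<ge> 1"
    proof -
      have "ln (exp 1) \<le> ln x" using x exp_le by (intro ln_mono) auto
      then show ?thesis by simp
    qed
    have fin: "finite {n \<in> simple_primes_in (S0 \<union> B0). real n \<le> x}"
      by (rule finite_subset[of _ "{..nat \<lfloor>x\<rfloor>}"]) (auto intro!: le_nat_floor)
    have "card {n. n > 0 \<and> real n \<le> x \<and> (\<exists>I. ideal I (ring_of_integers K) \<and> ideal_norm K I = n)}
       \<le> card {n \<in> simple_primes_in (S0 \<union> B0). real n \<le> x}"
      using norms by (intro card_mono[OF fin]) blast
    then have "real (card {n. n > 0 \<and> real n \<le> x \<and> (\<exists>I. ideal I (ring_of_integers K) \<and> ideal_norm K I = n)})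
       \<le> C * (x / ln x powr (1 - 1 / real d))"
      using C(2)[OF x] by linarith
    \<comment> \<open>\<open>d \<ge> n0\<close> makes the exponent of the logarithm on the left at
      least as large, and since \<open>ln x \<ge> 1\<close> the bound with \<open>n0\<close> is the
      weaker one.\<close>
    also have "\<dots> \<le> C * (x / ln x powr (1 - 1 / real n0))"
    proof (intro mult_left_mono[OF _ C(1)] divide_left_mono)
      have "1 / real d \<le> 1 / real n0" using \<open>n0 \<le> d\<close> n0_pos by (simp add: frac_le)
      then show "ln x powr (1 - 1 / real n0) \<le> ln x powr (1 - 1 / real d)" using lnx by (intro powr_mono) auto
    qed (use x lnx in auto)
    finally show ?thesis .
  qed
  with C(1) show ?thesis by blast
qed

lemma ring_ring_of_integers: "ring (ring_of_integers K)"
proof -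
  interpret A: Ring.field "ambient :: 'a ring" by (rule field_ambient)
  have "subring OK (ambient :: 'a ring)"
    by (rule A.subringI) (simp_all add: OK_1 OK_minus OK_mult OK_add)
  then have "ring ((ambient :: 'a ring)\<lparr>carrier := OK\<rparr>)" by (rule A.subring_is_ring)
  then show ?thesis by (simp add: ring_of_integers_def OK_def)
qed

text \<open>Norm one means a single coset, so the ideal is the whole ring. This supplies the
  frequency \<open>0\<close> of the exponential sum.\<close>

lemma ideal_count_1: "ideal_count K 1 = 1"
proof -
  interpret R: ring "ring_of_integers K" by (rule ring_ring_of_integers)
  have coset: "x \<in> I +>\<^bsub>ring_of_integers K\<^esub> x" if "0 \<in> I" for x I
    using that by (force simp: a_r_coset_def')
  have "{I. ideal I (ring_of_integers K) \<and> I \<noteq> {0} \<and> ideal_norm K I = 1} = {OK}"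
  proof (intro equalityI subsetI)
    fix I assume "I \<in> {I. ideal I (ring_of_integers K) \<and> I \<noteq> {0} \<and> ideal_norm K I = 1}"
    then have I: "ideal I (ring_of_integers K)" "card (carrier (ring_of_integers K Quot I)) = 1"
      by (auto simp: ideal_norm_def)
    interpret I: ideal I "ring_of_integers K" by (rule I(1))
    have I0: "0 \<in> I" using additive_subgroup.zero_closed[OF I.is_additive_subgroup] by simp
    obtain c where c: "carrier (ring_of_integers K Quot I) = {c}" using I(2) by (auto simp: card_1_singleton_iff)
    have cos: "I +>\<^bsub>ring_of_integers K\<^esub> x = c" if "x \<in> OK" for x
      using c that by (auto simp: FactRing_def A_RCOSETS_def' carrier_ring_of_integers simp del: ring_of_integers_simps(1))
    have "I +>\<^bsub>ring_of_integers K\<^esub> 0 = I" by (simp add: a_r_coset_def')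
    then have "x \<in> I" if "x \<in> OK" for x
      using cos[OF that] cos[OF OK_0] coset[OF I0, of x] by simp
    moreover have "I \<subseteq> OK" using I.a_subset carrier_ring_of_integers by simp
    ultimately show "I \<in> {OK}" by blast
  next
    fix I assume "I \<in> {OK}"
    then have I: "I = OK" by simp
    have id: "ideal OK (ring_of_integers K)" using R.oneideal carrier_ring_of_integers by simp
    interpret I: ideal OK "ring_of_integers K" by (rule id)
    have "OK +>\<^bsub>ring_of_integers K\<^esub> x = OK" if "x \<in> OK" for x
    proof
      show "OK +>\<^bsub>ring_of_integers K\<^esub> x \<subseteq> OK" using that by (auto simp: a_r_coset_def' OK_add)
      show "OK \<subseteq> OK +>\<^bsub>ring_of_integers K\<^esub> x"
      proof
        fix y assume "y \<in> OK"
        then have "y - x \<in> OK" using that by (rule OK_diff)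
        then show "y \<in> OK +>\<^bsub>ring_of_integers K\<^esub> x" by (force simp: a_r_coset_def')
      qed
    qed
    then have car: "carrier (ring_of_integers K Quot OK) = {OK}"
      using OK_0 by (auto simp: FactRing_def A_RCOSETS_def' carrier_ring_of_integers simp del: ring_of_integers_simps(1))
    have "ideal_norm K OK = 1" unfolding ideal_norm_def car by simp
    moreover have "OK \<noteq> {0}" using OK_1 by (metis singletonD zero_neq_one)
    ultimately show "I \<in> {I. ideal I (ring_of_integers K) \<and> I \<noteq> {0} \<and> ideal_norm K I = 1}" using I id by simp
  qed
  then show ?thesis by (simp add: ideal_count_def)
qed

end

section \<open>The partial zeta function as an exponential sum\<close>

lemma zero_counting_bound:
  fixes K :: "'a::field_char_0 set" and x T :: real
  defines "A \<equiv> {n. 1 \<le> n \<and> real n \<le> x \<and> ideal_count K n \<noteq> 0}"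
  assumes a1: "ideal_count K 1 \<noteq> 0" and x: "x \<ge> 1" and T: "T > 0"
  shows "\<bar>zero_counting K x T - T / (2 * pi) * ln (real (Max {m. real m \<le> x \<and> ideal_count K m \<noteq> 0}))\<bar>
    \<le> (real (card A) + 3) / 2"
proof -
  have finA: "finite A" unfolding A_def by (rule finite_subset[of _ "{..nat \<lfloor>x\<rfloor>}"]) (auto intro!: le_nat_floor)
  have A1: "1 \<in> A" using a1 x by (simp add: A_def)
  have Apos: "n > 0" if "n \<in> A" for n using that by (simp add: A_def)
  \<comment> \<open>The frequencies; the logarithm is injective on \<open>A\<close>, so the
    coefficients can be read off through \<open>inv_into\<close>.\<close>
  define l where "l n = ln (real n)" for n :: nat
  have inj: "inj_on l A" using Apos by (auto simp: inj_on_def l_def)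
  define c where "c t = real (ideal_count K (inv_into A l t))" for t
  have c: "c (l n) = real (ideal_count K n)" if "n \<in> A" for n
    using that inj by (simp add: c_def inv_into_f_f)
  interpret P: pos_exp_sum "l ` A" c
  proof
    show "finite (l ` A)" using finA by simp
    show "0 \<in> l ` A" using A1 by (intro image_eqI[of _ _ 1]) (auto simp: l_def)
    show "0 \<le> t" if "t \<in> l ` A" for t
    proof -
      from that obtain n where "n \<in> A" "t = ln (real n)" by (auto simp: l_def)
      with Apos[of n] show ?thesis by (simp add: ln_ge_zero)
    qed
    show "0 < c t" if "t \<in> l ` A" for t
    proof -
      from that obtain n where n: "n \<in> A" "t = l n" by blast
      then show ?thesis using c[OF n(1)] by (simp add: A_def)
    qed
  qed
  have F: "dedekind_partial K x = P.F"
  proof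
    fix s
    have "dedekind_partial K x s = (\<Sum>n\<in>A. of_nat (ideal_count K n) / of_nat n powr s)"
      unfolding dedekind_partial_def
    proof (rule sum.mono_neutral_right)
      show "finite {n::nat. 1 \<le> n \<and> real n \<le> x}"
        by (rule finite_subset[of _ "{..nat \<lfloor>x\<rfloor>}"]) (auto intro!: le_nat_floor)
    qed (auto simp: A_def)
    also have "\<dots> = (\<Sum>n\<in>A. of_real (c (l n)) * exp (- of_real (l n) * s))"
    proof (rule sum.cong[OF refl])
      fix n assume n: "n \<in> A"
      have "Ln (of_nat n) = (of_real (ln (real n)) :: complex)"
        using Ln_of_real[of "real n"] Apos[OF n] by simp
      then have "of_nat n powr s = exp (of_real (l n) * s)"
        using Apos[OF n] by (simp add: powr_def l_def mult.commute)
      then show "of_nat (ideal_count K n) / of_nat n powr s = of_real (c (l n)) * exp (- of_real (l n) * s)"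
        by (simp add: c[OF n] exp_minus divide_inverse)
    qed
    also have "\<dots> = P.F s" unfolding P.F_def by (simp add: sum.reindex[OF inj])
    finally show "dedekind_partial K x s = P.F s" .
  qed
  have L: "P.L = ln (real (Max {m. real m \<le> x \<and> ideal_count K m \<noteq> 0}))"
  proof -
    define M where "M = Max A"
    have M: "M \<in> A" "\<And>n. n \<in> A \<Longrightarrow> n \<le> M" unfolding M_def using finA A1 by (auto intro!: Max_in)
    have "Max {m. real m \<le> x \<and> ideal_count K m \<noteq> 0} = M"
    proof (rule Max_eqI)
      show "finite {m. real m \<le> x \<and> ideal_count K m \<noteq> 0}"
        by (rule finite_subset[of _ "{..nat \<lfloor>x\<rfloor>}"]) (auto intro!: le_nat_floor)
      show "M \<in> {m. real m \<le> x \<and> ideal_count K m \<noteq> 0}" using M(1) by (simp add: A_def)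
      fix m assume "m \<in> {m. real m \<le> x \<and> ideal_count K m \<noteq> 0}"
      \<comment> \<open>The maximum in the statement also ranges over \<open>m = 0\<close>, which
        \<open>A\<close> excludes.\<close>
      then show "m \<le> M" using M(2)[of m] by (cases "m = 0") (auto simp: A_def)
    qed
    moreover have "P.L = ln (real M)"
      unfolding P.L_def
    proof (rule Max_eqI)
      fix t assume "t \<in> l ` A"
      then obtain n where n: "n \<in> A" "t = ln (real n)" by (auto simp: l_def)
      then show "t \<le> ln (real M)" using M(2)[OF n(1)] Apos[OF n(1)] by simp
    qed (use finA M in \<open>auto simp: l_def\<close>)
    ultimately show ?thesis by simp
  qed
  have real_nz: "\<rho> \<notin> \<real>" if "P.F \<rho> = 0" for \<rho>
    using that P.F_not_zero_real by (auto elim: Reals_cases)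
  have zeros: "zeros_upto K x t = real_of_int (\<Sum>\<rho>\<in>{z. P.F z = 0 \<and> 0 \<le> Im z \<and> Im z \<le> t}. zorder P.F \<rho>)" for t
  proof -
    have "{\<rho> \<in> nonreal_zeros K x. Im \<rho> \<in> {0..t}} = {z. P.F z = 0 \<and> 0 \<le> Im z \<and> Im z \<le> t}"
      using real_nz by (auto simp: nonreal_zeros_def F)
    then show ?thesis by (simp add: zeros_upto_def F)
  qed
  \<comment> \<open>No zero has its ordinate just above \<open>T\<close>, so for an ordinate
    \<open>T\<close> the limit equals the plain count, which already includes the zeros at height
    \<open>T\<close>.\<close>
  have "zero_counting K x T = zeros_upto K x T"
  proof (cases "\<exists>\<rho>\<in>nonreal_zeros K x. Im \<rho> = T")
    case True
    obtain \<delta> where \<delta>: "\<delta> > 0" "\<And>\<epsilon>. 0 < \<epsilon> \<Longrightarrow> \<epsilon> < \<delta> \<Longrightarrow>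
       {z. P.F z = 0 \<and> 0 \<le> Im z \<and> Im z \<le> T + \<epsilon>} = {z. P.F z = 0 \<and> 0 \<le> Im z \<and> Im z \<le> T}"
      using P.zero_sum_stable[of T] by blast
    have "eventually (\<lambda>\<epsilon>. zeros_upto K x (T + \<epsilon>) = zeros_upto K x T) (at_right 0)"
      unfolding eventually_at_right_field using \<delta> by (intro exI[of _ \<delta>]) (simp add: zeros)
    then have "((\<lambda>\<epsilon>. zeros_upto K x (T + \<epsilon>)) \<longlongrightarrow> zeros_upto K x T) (at_right 0)"
      by (rule tendsto_eventually)
    then have "Lim (at_right 0) (\<lambda>\<epsilon>. zeros_upto K x (T + \<epsilon>)) = zeros_upto K x T"
      by (intro tendsto_Lim) simp_all
    with True show ?thesis by (simp add: zero_counting_def)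
  next
    case False
    then show ?thesis unfolding zero_counting_def by (rule if_not_P)
  qed
  moreover have "\<bar>2 * pi * zeros_upto K x T - T * P.L\<bar> \<le> pi * (card (l ` A) + 3)"
    unfolding zeros by (rule P.zero_sum_bound[OF T])
  moreover have "card (l ` A) = card A" using inj by (rule card_image)
  ultimately have "\<bar>2 * pi * zero_counting K x T - T * P.L\<bar> \<le> pi * (real (card A) + 3)" by simp
  moreover have "2 * pi * zero_counting K x T - T * P.L = 2 * pi * (zero_counting K x T - T / (2 * pi) * P.L)"
    by (simp add: right_diff_distrib)
  ultimately have "2 * pi * \<bar>zero_counting K x T - T / (2 * pi) * P.L\<bar> \<le> 2 * pi * ((real (card A) + 3) / 2)"
    by (simp add: abs_mult)
  then have "\<bar>zero_counting K x T - T / (2 * pi) * P.L\<bar> \<le> (real (card A) + 3) / 2"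
    by (subst (asm) mult_le_cancel_left_pos) simp_all
  then show ?thesis unfolding L .
qed

theorem theorem2p1:
  fixes K :: "'a::field_char_0 set" and n\<^sub>0 :: nat
  assumes "number_field K"
    and "galois_over \<rat> K"
    and "ring.dimension ambient n\<^sub>0 \<rat> K"
  shows "\<exists>C::real. \<forall>T\<ge>3. \<forall>x\<ge>3. \<forall>M::nat.
           M = Max {m. real m \<le> x \<and> ideal_count K m \<noteq> 0} \<longrightarrow>
           \<bar>zero_counting K x T - T / (2 * pi) * ln (real M)\<bar>
             \<le> C * (x / (ln x) powr (1 - 1 / real n\<^sub>0))"
proof -
  interpret rational_galois K "field_automorphisms \<rat> K" "n\<^sub>0"
    using assms by (rule rational_galois_number_field)
  obtain C where C: "C \<ge> 0" "\<And>x::real. x \<ge> 3 \<Longrightarrow>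
      real (card {n. n > 0 \<and> real n \<le> x \<and> (\<exists>I. ideal I (ring_of_integers K) \<and> ideal_norm K I = n)})
      \<le> C * (x / ln x powr (1 - 1 / real n\<^sub>0))"
    using card_ideal_norms_le by blast
  have "\<bar>zero_counting K x T - T / (2 * pi) * ln (real M)\<bar> \<le> (2 * C) * (x / (ln x) powr (1 - 1 / real n\<^sub>0))"
    if T: "T \<ge> 3" and x: "x \<ge> 3" and M: "M = Max {m. real m \<le> x \<and> ideal_count K m \<noteq> 0}" for T x :: real and M
  proof -
    define A where "A = {n. 1 \<le> n \<and> real n \<le> x \<and> ideal_count K n \<noteq> 0}"
    define N where "N = {n. n > 0 \<and> real n \<le> x \<and> (\<exists>I. ideal I (ring_of_integers K) \<and> ideal_norm K I = n)}"
    have finN: "finite N" unfolding N_def by (rule finite_subset[of _ "{..nat \<lfloor>x\<rfloor>}"]) (auto intro!: le_nat_floor)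
    have AN: "A \<subseteq> N"
    proof
      fix n assume "n \<in> A"
      then have n: "1 \<le> n" "real n \<le> x" "ideal_count K n \<noteq> 0" by (auto simp: A_def)
      have "{I. ideal I (ring_of_integers K) \<and> I \<noteq> {0} \<and> ideal_norm K I = n} \<noteq> {}"
        using n(3) unfolding ideal_count_def by (metis card.empty)
      then show "n \<in> N" using n(1,2) by (auto simp: N_def)
    qed
    have "1 \<in> A" using x ideal_count_1 by (simp add: A_def)
    moreover have "finite A" using AN finN by (rule finite_subset)
    ultimately have "card A \<ge> 1" by (simp add: Suc_le_eq card_gt_0_iff) blast
    moreover have "card A \<le> card N" using finN AN by (rule card_mono)
    ultimately have "1 \<le> real (card A)" "real (card A) \<le> real (card N)" by simp_all
    \<comment> \<open>\<open>card A \<ge> 1\<close> gives \<open>3 \<le> 3 * card A\<close>, which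
      absorbs the additive constant and explains the factor \<open>2\<close> in front of
      \<open>C\<close>.\<close>
    then have "(real (card A) + 3) / 2 \<le> 2 * real (card N)" by simp
    moreover have "real (card N) \<le> C * (x / ln x powr (1 - 1 / real n\<^sub>0))" unfolding N_def by (rule C(2)[OF x])
    moreover have "\<bar>zero_counting K x T - T / (2 * pi) * ln (real M)\<bar> \<le> (real (card A) + 3) / 2"
      unfolding M A_def using ideal_count_1 x T by (intro zero_counting_bound) simp_all
    ultimately show ?thesis by linarith
  qed
  then show ?thesis by blast
qed

end
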